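(* Let $V=\mathbb{C}^3$ with basis $\{e_1,e_2,e_3\}$. Consider three associative multiplications on $V$, each with unit $e_1$ (that is, $e_1e_i=e_ie_1=e_i$ for all $i$) and $e_2e_2=e_2$: - $\mathcal{A}_1$: $e_2e_3=e_3e_2=e_3$, $e_3e_3=e_3$; - $\mathcal{A}_2$: $e_2e_3=e_3e_2=e_3$, $e_3e_3=0$; - $\mathcal{A}_3$: $e_2e_3=e_3$, $e_3e_2=0$, $e_3e_3=0$. Every $3$-dimensional weak bialgebra over $\mathbb{C}$ is isomorphic to one of the following weak bialgebras. With underlying algebra $\mathcal{A}_1$: (1) $\Delta(e_1)=e_1\otimes e_1$, $\Delta(e_2)=e_1\otimes(e_1-e_3)+e_2\otimes(2e_3-e_2)+e_3\otimes(2e_2-e_3-e_1)$, $\Delta(e_3)=e_1\otimes(e_2-e_3)+e_2\otimes(e_1-2e_2+e_3)+e_3\otimes(e_2+e_3-e_1)$, $\varepsilon(e_1)=\varepsilon(e_2)=\varepsilon(e_3)=1$. (2) $\Delta(e_i)=e_i\otimes e_i$ and $\varepsilon(e_i)=1$ for $i=1,2,3$. (3) $\Delta(e_1)=e_1\otimes e_1$, $\Delta(e_2)=e_2\otimes e_2$, $\Delta(e_3)=(e_2-e_3)\otimes e_3+e_3\otimes(e_2-e_3)$, $\varepsilon(e_1)=\varepsilon(e_2)=1$, $\varepsilon(e_3)=0$. (4) $\Delta(e_1)=e_1\otimes e_1$, $\Delta(e_2)=(e_2-e_3)\otimes e_3+e_3\otimes e_2$, $\Delta(e_3)=e_3\otimes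 e_3$, $\varepsilon(e_1)=\varepsilon(e_2)=\varepsilon(e_3)=1$. (5) $\Delta(e_1)=e_1\otimes e_1$, $\Delta(e_2)=e_2\otimes e_2+(e_1-e_2)\otimes e_3$, $\Delta(e_3)=(e_1-e_3)\otimes e_3+e_3\otimes e_2$, $\varepsilon(e_1)=\varepsilon(e_2)=1$, $\varepsilon(e_3)=0$. (6) $\Delta(e_1)=e_1\otimes e_1$, $\Delta(e_2)=e_2\otimes e_2+e_3\otimes(e_1-e_2)$, $\Delta(e_3)=e_2\otimes e_3+e_3\otimes e_1-e_3\otimes e_3$, $\varepsilon(e_1)=\varepsilon(e_2)=\varepsilon(e_3)=1$. (7) $\Delta(e_1)=e_1\otimes e_1$, $\Delta(e_2)=(e_1-e_2)\otimes(e_1-e_2)+e_2\otimes e_2$, $\Delta(e_3)=e_3\otimes e_3$, $\varepsilon(e_1)=\varepsilon(e_2)=\varepsilon(e_3)=1$. (8) $\Delta(e_1)=(e_1-e_2)\otimes(e_1-e_2)+e_2\otimes e_2$, $\Delta(e_2)=e_2\otimes e_2$, $\Delta(e_3)=e_3\otimes e_3$, $\varepsilon(e_1)=2$, $\varepsilon(e_2)=1$, $\varepsilon(e_3)=1$. (9) $\Delta(e_1)=(e_1-e_2)\otimes(e_1-e_2)+e_2\otimes e_2$, $\Delta(e_2)=e_2\otimes e_2$, $\Delta(e_3)=(e_2-e_3)\otimes e_3+e_3\otimes(e_2-e_3)$, $\varepsilon(e_1)=2$, $\varepsilon(e_2)=1$, $\varepsilon(e_3)=0$. (10) $\Delta(e_1)=(e_1-e_2)\otimes(e_1-e_2)+(e_2-e_3)\otimes(e_2-e_3)+e_3\otimes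 e_3$, $\Delta(e_2)=(e_2-e_3)\otimes(e_2-e_3)+e_3\otimes e_3$, $\Delta(e_3)=e_3\otimes e_3$, $\varepsilon(e_1)=3$, $\varepsilon(e_2)=2$, $\varepsilon(e_3)=1$. (11) $\Delta(e_1)=e_1\otimes(e_2-e_3)+e_3\otimes(e_1-2e_2+2e_3)$, $\Delta(e_2)=(e_2-e_3)\otimes(e_2-e_3)+e_3\otimes e_3$, $\Delta(e_3)=e_3\otimes e_3$, $\varepsilon(e_1)=2$, $\varepsilon(e_2)=2$, $\varepsilon(e_3)=1$. With underlying algebra $\mathcal{A}_2$, and in each case $\Delta(e_1)=e_1\otimes e_1$, $\Delta(e_2)=e_1\otimes e_2+e_2\otimes e_1-e_2\otimes e_2$, $\varepsilon(e_1)=1$, $\varepsilon(e_2)=\varepsilon(e_3)=0$: (12) $\Delta(e_3)=e_1\otimes e_3+e_3\otimes e_1-e_3\otimes e_2$. (13) $\Delta(e_3)=e_1\otimes e_3-e_2\otimes e_3+e_3\otimes e_1-e_3\otimes e_2+e_3\otimes e_3$. (14) $\Delta(e_3)=e_1\otimes e_3-e_2\otimes e_3+e_3\otimes e_1$. (15) $\Delta(e_3)=e_1\otimes e_3-e_3\otimes e_2+e_3\otimes e_1-e_2\otimes e_3$. With underlying algebra $\mathcal{A}_3$: (16) $\Delta(e_1)=(e_1-e_2)\otimes(e_1-e_2)+e_2\otimes e_2$, $\Delta(e_2)=e_2\otimes e_2$, $\Delta(e_3)=e_3\otimes e_3$, $\varepsilon(e_1)=2$, $\varepsilon(e_2)=\varepsilon(e_3)=1$.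 (17) $\Delta(e_1)=e_1\otimes e_1$, $\Delta(e_2)=e_1\otimes e_2+e_2\otimes e_1-e_2\otimes e_2$, $\Delta(e_3)=e_1\otimes e_3+e_3\otimes e_1-e_2\otimes e_3-e_3\otimes e_2$, $\varepsilon(e_1)=1$, $\varepsilon(e_2)=\varepsilon(e_3)=0$. (18) $\Delta(e_1)=e_1\otimes e_1$, $\Delta(e_2)=e_1\otimes e_2+e_2\otimes e_1-e_2\otimes e_2-e_3\otimes e_3$, $\Delta(e_3)=e_1\otimes e_3-e_2\otimes e_3+e_3\otimes e_1-e_3\otimes e_2$, $\varepsilon(e_1)=1$, $\varepsilon(e_2)=\varepsilon(e_3)=0$. (19) $\Delta(e_1)=e_1\otimes e_1$, $\Delta(e_2)=e_2\otimes e_2$, $\Delta(e_3)=e_2\otimes e_3+e_3\otimes e_2$, $\varepsilon(e_1)=\varepsilon(e_2)=1$, $\varepsilon(e_3)=0$. (20) $\Delta(e_1)=e_1\otimes e_1$, $\Delta(e_2)=e_2\otimes e_2+e_3\otimes e_3$, $\Delta(e_3)=e_2\otimes e_3+e_3\otimes e_2$, $\varepsilon(e_1)=\varepsilon(e_2)=1$, $\varepsilon(e_3)=0$.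
   Context: Weak bialgebra (here $\mathbb{K}=\mathbb{C}$). Write $xy=m(x\otimes y)$ and use Sweedler notation $\Delta(x)=x_{(1)}\otimes x_{(2)}$ (summation understood). A weak bialgebra is a quintuple $(V,m,\eta,\Delta,\varepsilon)$ with linear maps $m:V\otimes V\to V$, $\eta:\mathbb{K}\to V$ (write $1=\eta(1)$), $\Delta:V\to V\otimes V$, $\varepsilon:V\to\mathbb{K}$ such that: (1) $(V,m,\eta)$ is a unital associative algebra; (2) $(V,\Delta,\varepsilon)$ is a coassociative counital coalgebra; (3) for all $x,y,z\in V$: $\Delta(xy)=\Delta(x)\bullet\Delta(y)$; $(\Delta\otimes \mathrm{id})\Delta(1)=(\Delta(1)\otimes 1)\bullet(1\otimes\Delta(1))=(1\otimes\Delta(1))\bullet(\Delta(1)\otimes 1)$; and $\varepsilon(xyz)=\varepsilon(xy_{(1)})\,\varepsilon(y_{(2)}z)$. Here $\bullet$ is the usual componentwise multiplication on tensor powers of $V$. Two weak bialgebras are isomorphic if there is a linear bijection between them compatible with multiplications, comultiplications and counits.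
   Formalization: In item (6) the formal statement has ε(e_3)=0 instead of the printed ε(e_3)=1, since with the printed value (ε⊗id)Δ(e_2)=e_1≠e_2, so the printed datum is not counital and not a weak bialgebra. *)

theory Defs
  imports "HOL-Analysis.Analysis" "HOL-Library.Poly_Mapping"
begin

section \<open>Complex vector spaces\<close>

class complex_vector = ab_group_add +
  fixes scaleC :: "complex \<Rightarrow> 'a \<Rightarrow> 'a" (infixr "*\<^sub>C" 75)
  assumes scaleC_add_right: "a *\<^sub>C (x + y) = a *\<^sub>C x + a *\<^sub>C y"
    and scaleC_add_left: "(a + b) *\<^sub>C x = a *\<^sub>C x + b *\<^sub>C x"
    and scaleC_scaleC: "a *\<^sub>C (b *\<^sub>C x) = (a * b) *\<^sub>C x"
    and scaleC_one: "1 *\<^sub>C x = x"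

global_interpretation cvec: vector_space "scaleC :: complex \<Rightarrow> 'a \<Rightarrow> 'a::complex_vector"
  by unfold_locales (rule scaleC_add_right scaleC_add_left scaleC_scaleC scaleC_one)+

abbreviation clinear :: "('a::complex_vector \<Rightarrow> 'b::complex_vector) \<Rightarrow> bool" where
  "clinear \<equiv> Vector_Spaces.linear scaleC scaleC"

lemma clinearI:
  assumes "\<And>x y. f (x + y) = f x + f y" and "\<And>c x. f (c *\<^sub>C x) = c *\<^sub>C f x"
  shows "clinear f"
  using assms by unfold_locales

definition cbilinear ::
  "('a::complex_vector \<Rightarrow> 'b::complex_vector \<Rightarrow> 'c::complex_vector) \<Rightarrow> bool" where
  "cbilinear f \<longleftrightarrow> (\<forall>x. clinear (f x)) \<and> (\<forall>y. clinear (\<lambda>x. f x y))"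

lemma cbilinearI:
  assumes "\<And>x y z. f (x + y) z = f x z + f y z" and "\<And>c x z. f (c *\<^sub>C x) z = c *\<^sub>C f x z"
    and "\<And>x y z. f z (x + y) = f z x + f z y" and "\<And>c x z. f z (c *\<^sub>C x) = c *\<^sub>C f z x"
  shows "cbilinear f"
  unfolding cbilinear_def using assms by (auto intro!: clinearI)

lemma cbilinearD:
  assumes "cbilinear f"
  shows "f (x + y) z = f x z + f y z" and "f (c *\<^sub>C x) z = c *\<^sub>C f x z"
    and "f w (u + v) = f w u + f w v" and "f w (c *\<^sub>C u) = c *\<^sub>C f w u"
proof -
  have l: "clinear (f w)" and r: "clinear (\<lambda>x. f x z)"
    using assms by (auto simp: cbilinear_def)
  interpret l: Vector_Spaces.linear scaleC scaleC "f w" by (rule l)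
  interpret r: Vector_Spaces.linear scaleC scaleC "\<lambda>x. f x z" by (rule r)
  show "f (x + y) z = f x z + f y z" by (rule r.add)
  show "f (c *\<^sub>C x) z = c *\<^sub>C f x z" by (rule r.scale)
  show "f w (u + v) = f w u + f w v" by (rule l.add)
  show "f w (c *\<^sub>C u) = c *\<^sub>C f w u" by (rule l.scale)
qed

instantiation complex :: complex_vector
begin
definition scaleC_complex :: "complex \<Rightarrow> complex \<Rightarrow> complex" where
  "scaleC_complex c x = c * x"
instance by standard (simp_all add: scaleC_complex_def algebra_simps)
end

instantiation vec :: (complex_vector, finite) complex_vector
begin
definition scaleC_vec :: "complex \<Rightarrow> 'a ^ 'b \<Rightarrow> 'a ^ 'b" where
  "scaleC_vec c x = (\<chi> i. c *\<^sub>C (x $ i))"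
instance
  by standard
    (simp_all add: scaleC_vec_def vec_eq_iff scaleC_add_right scaleC_add_left scaleC_scaleC scaleC_one)
end

section \<open>The tensor product\<close>

text \<open>
  The free complex vector space on \<open>V \<times> W\<close> (finitely supported functions), modulo the subspace
  spanned by the bilinearity relations.
\<close>

instantiation poly_mapping :: (type, complex_vector) complex_vector
begin
lift_definition scaleC_poly_mapping :: "complex \<Rightarrow> ('a \<Rightarrow>\<^sub>0 'b) \<Rightarrow> ('a \<Rightarrow>\<^sub>0 'b)"
  is "\<lambda>c p k. c *\<^sub>C p k"
  by (erule rev_finite_subset) auto
instance
  by standard
    (transfer; simp add: fun_eq_iff scaleC_add_right scaleC_add_left scaleC_scaleC scaleC_one)+
end

definition tensor_relations ::
  "(('a::complex_vector \<times> 'b::complex_vector) \<Rightarrow>\<^sub>0 complex) set" where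
  "tensor_relations =
     {Poly_Mapping.single (x + x', y) 1 - Poly_Mapping.single (x, y) 1
        - Poly_Mapping.single (x', y) 1 | x x' y. True}
   \<union> {Poly_Mapping.single (x, y + y') 1 - Poly_Mapping.single (x, y) 1
        - Poly_Mapping.single (x, y') 1 | x y y'. True}
   \<union> {Poly_Mapping.single (c *\<^sub>C x, y) 1 - c *\<^sub>C Poly_Mapping.single (x, y) 1 | c x y. True}
   \<union> {Poly_Mapping.single (x, c *\<^sub>C y) 1 - c *\<^sub>C Poly_Mapping.single (x, y) 1 | c x y. True}"

definition tensor_rel ::
  "(('a::complex_vector \<times> 'b::complex_vector) \<Rightarrow>\<^sub>0 complex) \<Rightarrow>
   (('a \<times> 'b) \<Rightarrow>\<^sub>0 complex) \<Rightarrow> bool" where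
  "tensor_rel s t \<longleftrightarrow> s - t \<in> cvec.span tensor_relations"

lemma equivp_tensor_rel:
  "equivp (tensor_rel ::
     (('a::complex_vector \<times> 'b::complex_vector) \<Rightarrow>\<^sub>0 complex) \<Rightarrow> _)"
proof (rule equivpI)
  show "reflp (tensor_rel :: (('a \<times> 'b) \<Rightarrow>\<^sub>0 complex) \<Rightarrow> _)"
    by (auto simp: reflp_def tensor_rel_def cvec.span_zero)
  show "symp (tensor_rel :: (('a \<times> 'b) \<Rightarrow>\<^sub>0 complex) \<Rightarrow> _)"
    unfolding symp_def tensor_rel_def
    using cvec.span_neg[of "_ - _"] by (metis minus_diff_eq)
  have "s - u \<in> cvec.span tensor_relations"
    if "s - t \<in> cvec.span tensor_relations" "t - u \<in> cvec.span tensor_relations"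
    for s t u :: "('a \<times> 'b) \<Rightarrow>\<^sub>0 complex"
    using cvec.span_add[OF that] by simp
  then show "transp (tensor_rel :: (('a \<times> 'b) \<Rightarrow>\<^sub>0 complex) \<Rightarrow> _)"
    unfolding transp_def tensor_rel_def by blast
qed

quotient_type (overloaded) ('a, 'b) tensor =
  "('a::complex_vector \<times> 'b::complex_vector) \<Rightarrow>\<^sub>0 complex" / tensor_rel
  by (rule equivp_tensor_rel)

instantiation tensor :: (complex_vector, complex_vector) complex_vector
begin

lift_definition zero_tensor :: "('a, 'b) tensor" is 0 .

lift_definition plus_tensor :: "('a, 'b) tensor \<Rightarrow> ('a, 'b) tensor \<Rightarrow> ('a, 'b) tensor" is "(+)"
  unfolding tensor_rel_def by (simp only: add_diff_add cvec.span_add)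

lift_definition minus_tensor :: "('a, 'b) tensor \<Rightarrow> ('a, 'b) tensor \<Rightarrow> ('a, 'b) tensor" is "(-)"
  unfolding tensor_rel_def
proof -
  fix p p' q q' :: "('a \<times> 'b) \<Rightarrow>\<^sub>0 complex"
  assume "p - p' \<in> cvec.span tensor_relations" "q - q' \<in> cvec.span tensor_relations"
  then have "(p - p') - (q - q') \<in> cvec.span tensor_relations" by (rule cvec.span_diff)
  then show "p - q - (p' - q') \<in> cvec.span tensor_relations" by (simp add: algebra_simps)
qed

lift_definition uminus_tensor :: "('a, 'b) tensor \<Rightarrow> ('a, 'b) tensor" is uminus
  unfolding tensor_rel_def by (simp only: minus_diff_minus cvec.span_neg)

lift_definition scaleC_tensor :: "complex \<Rightarrow> ('a, 'b) tensor \<Rightarrow> ('a, 'b) tensor" is scaleC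
  unfolding tensor_rel_def
  by (simp only: cvec.scale_right_diff_distrib[symmetric] cvec.span_scale)

instance
proof
  fix a b c :: "('a, 'b) tensor" and k l :: complex
  have eq: "tensor_rel s s" for s :: "('a \<times> 'b) \<Rightarrow>\<^sub>0 complex"
    by (simp add: tensor_rel_def cvec.span_zero)
  show "a + b + c = a + (b + c)" by transfer (simp add: add.assoc eq)
  show "a + b = b + a" by transfer (simp add: add.commute eq)
  show "0 + a = a" by transfer (simp add: eq)
  show "- a + a = 0" by transfer (simp add: eq)
  show "a - b = a + - b" by transfer (simp add: eq)
  show "k *\<^sub>C (a + b) = k *\<^sub>C a + k *\<^sub>C b" by transfer (simp add: scaleC_add_right eq)
  show "(k + l) *\<^sub>C a = k *\<^sub>C a + l *\<^sub>C a" by transfer (simp add: scaleC_add_left eq)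
  show "k *\<^sub>C (l *\<^sub>C a) = (k * l) *\<^sub>C a" by transfer (simp add: scaleC_scaleC eq)
  show "1 *\<^sub>C a = a" by transfer (simp add: scaleC_one eq)
qed

end

lift_definition tens :: "'a::complex_vector \<Rightarrow> 'b::complex_vector \<Rightarrow> ('a, 'b) tensor"
  (infixr "\<otimes>" 70) is "\<lambda>x y. Poly_Mapping.single (x, y) 1" .

definition free_extend ::
  "('a \<Rightarrow> 'b \<Rightarrow> 'c::complex_vector) \<Rightarrow> (('a \<times> 'b) \<Rightarrow>\<^sub>0 complex) \<Rightarrow> 'c" where
  "free_extend f p =
     (\<Sum>k\<in>Poly_Mapping.keys p. Poly_Mapping.lookup p k *\<^sub>C f (fst k) (snd k))"

lemma free_extend_superset:
  assumes "finite A" "Poly_Mapping.keys p \<subseteq> A"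
  shows "free_extend f p = (\<Sum>k\<in>A. Poly_Mapping.lookup p k *\<^sub>C f (fst k) (snd k))"
  unfolding free_extend_def using assms
  by (intro sum.mono_neutral_left) (auto simp: in_keys_iff)

lemma free_extend_add: "free_extend f (p + q) = free_extend f p + free_extend f q"
proof -
  define A where "A = Poly_Mapping.keys p \<union> Poly_Mapping.keys q"
  have "finite A" "Poly_Mapping.keys p \<subseteq> A" "Poly_Mapping.keys q \<subseteq> A"
    "Poly_Mapping.keys (p + q) \<subseteq> A"
    using Poly_Mapping.keys_add[of p q] by (auto simp: A_def)
  then show ?thesis
    by (simp add: free_extend_superset[of A] lookup_add scaleC_add_left sum.distrib)
qed

lemma free_extend_scale: "free_extend f (c *\<^sub>C p) = c *\<^sub>C free_extend f p"
proof -
  have "Poly_Mapping.keys (c *\<^sub>C p) \<subseteq> Poly_Mapping.keys p"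
    by (auto simp: in_keys_iff scaleC_poly_mapping.rep_eq scaleC_complex_def)
  then have "free_extend f (c *\<^sub>C p) = (\<Sum>k\<in>Poly_Mapping.keys p.
      Poly_Mapping.lookup (c *\<^sub>C p) k *\<^sub>C f (fst k) (snd k))"
    by (intro free_extend_superset) auto
  then show ?thesis
    by (simp add: free_extend_def scaleC_poly_mapping.rep_eq scaleC_complex_def
        scaleC_scaleC cvec.scale_sum_right)
qed

lemma clinear_free_extend: "clinear (free_extend f)"
  by (intro clinearI free_extend_add free_extend_scale)

lemma free_extend_diff: "free_extend f (p - q) = free_extend f p - free_extend f q"
  using free_extend_add[of f "p - q" q] by simp

lemma free_extend_single: "free_extend f (Poly_Mapping.single (x, y) 1) = f x y"
  by (simp add: free_extend_def scaleC_one)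

lemma free_extend_relations:
  assumes "cbilinear f" "p \<in> cvec.span tensor_relations"
  shows "free_extend f p = 0"
  using assms(2)
proof (induction rule: cvec.span_induct_alt)
  case base
  show ?case by (simp add: free_extend_def)
next
  case (step c r p)
  have "free_extend f r = 0"
    using step.hyps(1) unfolding tensor_relations_def
    by (auto simp: free_extend_diff free_extend_single free_extend_scale cbilinearD[OF assms(1)])
  then show ?case
    using step by (simp add: free_extend_add free_extend_scale)
qed

text \<open>
  The linear map on the tensor product induced by a bilinear map; the value is irrelevant (and set
  to \<open>0\<close>) if the argument is not bilinear.
\<close>

lift_definition tensor_lift ::
  "('a::complex_vector \<Rightarrow> 'b::complex_vector \<Rightarrow> 'c::complex_vector) \<Rightarrow> ('a, 'b) tensor \<Rightarrow> 'c"
  is "\<lambda>f p. if cbilinear f then free_extend f p else 0"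
proof -
  fix f :: "'a \<Rightarrow> 'b \<Rightarrow> 'c" and p q :: "('a \<times> 'b) \<Rightarrow>\<^sub>0 complex"
  assume "tensor_rel p q"
  then have "free_extend f (p - q) = 0" if "cbilinear f"
    using free_extend_relations[OF that] by (simp add: tensor_rel_def)
  then show "(if cbilinear f then free_extend f p else 0) = (if cbilinear f then free_extend f q else 0)"
    by (simp add: free_extend_diff)
qed

lemma cbilinear_tens: "cbilinear (\<otimes>)"
proof -
  have rels:
    "Poly_Mapping.single (x + x', y) 1 - Poly_Mapping.single (x, y) 1
       - Poly_Mapping.single (x', y) 1 \<in> tensor_relations"
    "Poly_Mapping.single (x, y + y') 1 - Poly_Mapping.single (x, y) 1
       - Poly_Mapping.single (x, y') 1 \<in> tensor_relations"
    "Poly_Mapping.single (c *\<^sub>C x, y) 1 - c *\<^sub>C Poly_Mapping.single (x, y) 1 \<in> tensor_relations"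
    "Poly_Mapping.single (x, c *\<^sub>C y) 1 - c *\<^sub>C Poly_Mapping.single (x, y) 1 \<in> tensor_relations"
    for x x' :: 'a and y y' :: 'b and c
    unfolding tensor_relations_def by blast+
  show ?thesis
    by (rule cbilinearI; transfer; unfold tensor_rel_def diff_diff_eq[symmetric];
        intro cvec.span_base rels)
qed

lemma tensor_lift_add: "tensor_lift f (s + t) = tensor_lift f s + tensor_lift f t"
  by transfer (simp add: free_extend_add)

lemma tensor_lift_scale: "tensor_lift f (c *\<^sub>C t) = c *\<^sub>C tensor_lift f t"
  by transfer (simp add: free_extend_scale)

lemma clinear_tensor_lift: "clinear (tensor_lift f)"
  by (intro clinearI tensor_lift_add tensor_lift_scale)

lemma tensor_lift_tens: "cbilinear f \<Longrightarrow> tensor_lift f (x \<otimes> y) = f x y"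
  by transfer (simp add: free_extend_single)

lemma tensor_induct [case_names tens add scale]:
  assumes tens: "\<And>x y. P (x \<otimes> y)"
    and add: "\<And>s t. P s \<Longrightarrow> P t \<Longrightarrow> P (s + t)"
    and scale: "\<And>c t. P t \<Longrightarrow> P (c *\<^sub>C t)"
  shows "P t"
proof -
  have *: "P (abs_tensor p)" for p
  proof (induction p rule: Poly_Mapping.update_induct)
    case const
    have "P (0 *\<^sub>C (0 \<otimes> 0))" by (intro scale tens)
    then show ?case by (simp add: zero_tensor_def cvec.scale_zero_left)
  next
    case (update p k c)
    have eq: "Poly_Mapping.update k c p = p + c *\<^sub>C Poly_Mapping.single k 1"
      using update.hyps
      by (intro poly_mapping_eqI)
        (auto simp: lookup_add lookup_update scaleC_poly_mapping.rep_eq scaleC_complex_def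
          lookup_single when_def in_keys_iff)
    have "P (c *\<^sub>C (fst k \<otimes> snd k))" by (intro scale tens)
    then have "P (abs_tensor (c *\<^sub>C Poly_Mapping.single k 1))"
      by (simp add: tens.abs_eq scaleC_tensor.abs_eq)
    with update.IH have "P (abs_tensor p + abs_tensor (c *\<^sub>C Poly_Mapping.single k 1))"
      by (rule add)
    then show ?case by (simp add: eq plus_tensor.abs_eq)
  qed
  show ?thesis using * by (metis Quotient_tensor Quotient_abs_rep)
qed

lemma tensor_lift_unique:
  assumes "clinear g" "clinear h" "\<And>x y. g (x \<otimes> y) = h (x \<otimes> y)"
  shows "g t = h t"
proof -
  interpret g: Vector_Spaces.linear scaleC scaleC g by fact
  interpret h: Vector_Spaces.linear scaleC scaleC h by fact
  show ?thesis
    by (induction t rule: tensor_induct) (simp_all add: assms(3) g.add h.add g.scale h.scale)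
qed

definition tensor_map ::
  "('a::complex_vector \<Rightarrow> 'c::complex_vector) \<Rightarrow> ('b::complex_vector \<Rightarrow> 'd::complex_vector) \<Rightarrow>
   ('a, 'b) tensor \<Rightarrow> ('c, 'd) tensor" where
  "tensor_map f g = tensor_lift (\<lambda>x y. f x \<otimes> g y)"

definition tensor_assoc ::
  "(('a::complex_vector, 'b::complex_vector) tensor, 'c::complex_vector) tensor \<Rightarrow>
   ('a, ('b, 'c) tensor) tensor" where
  "tensor_assoc = tensor_lift (\<lambda>s z. tensor_lift (\<lambda>x y. x \<otimes> (y \<otimes> z)) s)"

text \<open>
  Componentwise multiplication on the tensor product of two algebras with multiplications
  \<open>m\<close> and \<open>n\<close>: \<open>(x \<otimes> y) \<bullet> (x' \<otimes> y') = m (x \<otimes> x') \<otimes> n (y \<otimes> y')\<close>.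
\<close>

definition tensor_mult ::
  "(('a::complex_vector, 'a) tensor \<Rightarrow> 'a) \<Rightarrow> (('b::complex_vector, 'b) tensor \<Rightarrow> 'b) \<Rightarrow>
   (('a, 'b) tensor, ('a, 'b) tensor) tensor \<Rightarrow> ('a, 'b) tensor" where
  "tensor_mult m n =
     tensor_lift (\<lambda>s t. tensor_lift (\<lambda>x y. tensor_lift (\<lambda>x' y'. m (x \<otimes> x') \<otimes> n (y \<otimes> y')) t) s)"

text \<open>
  The lifts in these definitions are of maps that are bilinear (given linear \<open>f\<close>, \<open>g\<close>, \<open>m\<close>, \<open>n\<close>), so
  the default value of \<open>tensor_lift\<close> does not occur and the expected formulas hold:
\<close>

lemma tensor_map_tens:
  assumes "clinear f" "clinear g"
  shows "tensor_map f g (x \<otimes> y) = f x \<otimes> g y"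
proof -
  interpret f: Vector_Spaces.linear scaleC scaleC f by fact
  interpret g: Vector_Spaces.linear scaleC scaleC g by fact
  show ?thesis
    unfolding tensor_map_def
    by (subst tensor_lift_tens)
      (auto intro!: cbilinearI simp: f.add f.scale g.add g.scale cbilinearD[OF cbilinear_tens])
qed

lemma cbilinear_tensor_lift:
  assumes "\<And>z. cbilinear (f z)" and "\<And>x y. clinear (\<lambda>z. f z x y)"
  shows "cbilinear (\<lambda>z. tensor_lift (f z))" and "cbilinear (\<lambda>t z. tensor_lift (f z) t)"
proof -
  have lin: "clinear (\<lambda>z. tensor_lift (f z) t)" for t
  proof (induction t rule: tensor_induct)
    case (tens x y)
    then show ?case using assms by (simp add: tensor_lift_tens)
  next
    case (add s t)
    interpret s: Vector_Spaces.linear scaleC scaleC "\<lambda>z. tensor_lift (f z) s" by fact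
    interpret t: Vector_Spaces.linear scaleC scaleC "\<lambda>z. tensor_lift (f z) t" by fact
    show ?case
      by (rule clinearI)
        (simp_all add: tensor_lift_add s.add s.scale t.add t.scale scaleC_add_right)
  next
    case (scale c t)
    interpret t: Vector_Spaces.linear scaleC scaleC "\<lambda>z. tensor_lift (f z) t" by fact
    show ?case
      by (rule clinearI)
        (simp_all add: tensor_lift_scale t.add t.scale scaleC_add_right scaleC_scaleC mult.commute)
  qed
  show "cbilinear (\<lambda>z. tensor_lift (f z))" "cbilinear (\<lambda>t z. tensor_lift (f z) t)"
    using lin by (auto simp: cbilinear_def clinear_tensor_lift)
qed

lemma tensor_assoc_tens: "tensor_assoc ((x \<otimes> y) \<otimes> z) = x \<otimes> (y \<otimes> z)"
proof -
  have 1: "cbilinear (\<lambda>x y. x \<otimes> (y \<otimes> z))" for z :: 'c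
    by (rule cbilinearI) (simp_all add: cbilinearD[OF cbilinear_tens])
  have 2: "clinear (\<lambda>z::'c. x \<otimes> (y \<otimes> z))" for x :: 'a and y :: 'b
    by (rule clinearI) (simp_all add: cbilinearD[OF cbilinear_tens])
  show ?thesis
    unfolding tensor_assoc_def
    by (simp add: tensor_lift_tens[OF cbilinear_tensor_lift(2)[OF 1 2]] tensor_lift_tens[OF 1])
qed

lemma tensor_mult_tens:
  assumes "clinear m" "clinear n"
  shows "tensor_mult m n ((x \<otimes> y) \<otimes> (x' \<otimes> y')) = m (x \<otimes> x') \<otimes> n (y \<otimes> y')"
proof -
  interpret m: Vector_Spaces.linear scaleC scaleC m by fact
  interpret n: Vector_Spaces.linear scaleC scaleC n by fact
  note [simp] = m.add n.add m.scale n.scale cbilinearD[OF cbilinear_tens]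
  have 1: "cbilinear (\<lambda>x' y'. m (x \<otimes> x') \<otimes> n (y \<otimes> y'))" for x y
    by (rule cbilinearI) simp_all
  have "clinear (\<lambda>x. m (x \<otimes> x') \<otimes> n (y \<otimes> y'))" "clinear (\<lambda>y. m (x \<otimes> x') \<otimes> n (y \<otimes> y'))"
    for x y x' y' by (rule clinearI; simp)+
  then have 4: "cbilinear (\<lambda>x y. m (x \<otimes> x') \<otimes> n (y \<otimes> y'))" for x' y'
    by (simp add: cbilinear_def)
  have 2: "cbilinear (\<lambda>x y. tensor_lift (\<lambda>x' y'. m (x \<otimes> x') \<otimes> n (y \<otimes> y')) t)" for t
    using cbilinear_tensor_lift(1)[of "\<lambda>x x' y'. m (x \<otimes> x') \<otimes> n (y \<otimes> y')" for y, OF 1]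
      cbilinear_tensor_lift(1)[of "\<lambda>y x' y'. m (x \<otimes> x') \<otimes> n (y \<otimes> y')" for x, OF 1] 4
    by (auto simp: cbilinear_def)
  have 3: "clinear (\<lambda>t. tensor_lift (\<lambda>x' y'. m (x \<otimes> x') \<otimes> n (y \<otimes> y')) t)" for x y
    by (rule clinear_tensor_lift)
  show ?thesis
    unfolding tensor_mult_def
    by (simp only: tensor_lift_tens[OF cbilinear_tensor_lift(2)[OF 2 3]] tensor_lift_tens[OF 2]
        tensor_lift_tens[OF 1] tensor_lift_tens[OF 4])
qed

section \<open>Weak bialgebras\<close>

record (overloaded) 'v bialg_data =
  mult :: "('v, 'v) tensor \<Rightarrow> 'v"
  unit :: "complex \<Rightarrow> 'v"
  comult :: "'v \<Rightarrow> ('v, 'v) tensor"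
  counit :: "'v \<Rightarrow> complex"

text \<open>
  Triple tensors are compared in \<open>V \<otimes> (V \<otimes> V)\<close>, whence the occurrences of \<open>tensor_assoc\<close>.
  In Sweedler notation \<open>\<Delta> y = \<Sum> y' \<otimes> y''\<close>, only the condition \<open>\<epsilon> (x y z) = \<Sum> \<epsilon> (x y') \<epsilon> (y'' z)\<close> is
  imposed on the counit; some authors also require the version with \<open>y'\<close> and \<open>y''\<close> exchanged.
\<close>

locale weak_bialgebra =
  fixes B :: "'v::complex_vector bialg_data"
  assumes linear_mult: "clinear (mult B)"
    and linear_unit: "clinear (unit B)"
    and linear_comult: "clinear (comult B)"
    and linear_counit: "clinear (counit B)"
    and mult_assoc: "mult B (mult B (x \<otimes> y) \<otimes> z) = mult B (x \<otimes> mult B (y \<otimes> z))"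
    and unit_left: "mult B (unit B 1 \<otimes> x) = x"
    and unit_right: "mult B (x \<otimes> unit B 1) = x"
    and comult_coassoc:
      "tensor_assoc (tensor_map (comult B) id (comult B x)) = tensor_map id (comult B) (comult B x)"
    and counit_left: "tensor_lift (\<lambda>a b. counit B a *\<^sub>C b) (comult B x) = x"
    and counit_right: "tensor_lift (\<lambda>a b. counit B b *\<^sub>C a) (comult B x) = x"
    and comult_mult:
      "comult B (mult B (x \<otimes> y)) = tensor_mult (mult B) (mult B) (comult B x \<otimes> comult B y)"
    and comult_unit:
      "tensor_assoc (tensor_map (comult B) id (comult B (unit B 1))) =
         tensor_mult (mult B) (tensor_mult (mult B) (mult B))
           (tensor_assoc (comult B (unit B 1) \<otimes> unit B 1) \<otimes> (unit B 1 \<otimes> comult B (unit B 1)))"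
      "tensor_assoc (tensor_map (comult B) id (comult B (unit B 1))) =
         tensor_mult (mult B) (tensor_mult (mult B) (mult B))
           ((unit B 1 \<otimes> comult B (unit B 1)) \<otimes> tensor_assoc (comult B (unit B 1) \<otimes> unit B 1))"
    and counit_mult:
      "counit B (mult B (mult B (x \<otimes> y) \<otimes> z)) =
         tensor_lift (\<lambda>a b. counit B (mult B (x \<otimes> a)) * counit B (mult B (b \<otimes> z))) (comult B y)"

definition bialg_isomorphic ::
  "'v::complex_vector bialg_data \<Rightarrow> 'w::complex_vector bialg_data \<Rightarrow> bool" where
  "bialg_isomorphic B C \<longleftrightarrow>
     (\<exists>f. clinear f \<and> bij f \<and>
       (\<forall>t. f (mult B t) = mult C (tensor_map f f t)) \<and>
       (\<forall>x. tensor_map f f (comult B x) = comult C (f x)) \<and>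
       (\<forall>x. counit B x = counit C (f x)))"

section \<open>The weak bialgebras of the classification\<close>

abbreviation e1 :: "complex ^ 3" where "e1 \<equiv> axis 1 1"
abbreviation e2 :: "complex ^ 3" where "e2 \<equiv> axis 2 1"
abbreviation e3 :: "complex ^ 3" where "e3 \<equiv> axis 3 1"

definition lin3 :: "'a::complex_vector \<Rightarrow> 'a \<Rightarrow> 'a \<Rightarrow> complex ^ 3 \<Rightarrow> 'a" where
  "lin3 a b c v = v $ 1 *\<^sub>C a + v $ 2 *\<^sub>C b + v $ 3 *\<^sub>C c"

text \<open>
  The multiplication with unit \<open>e1\<close> and \<open>e2 e2 = e2\<close>, given the products
  \<open>p = e2 e3\<close>, \<open>q = e3 e2\<close> and \<open>r = e3 e3\<close>.
\<close>

definition table_mult ::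
  "complex ^ 3 \<Rightarrow> complex ^ 3 \<Rightarrow> complex ^ 3 \<Rightarrow> (complex ^ 3, complex ^ 3) tensor \<Rightarrow> complex ^ 3" where
  "table_mult p q r =
     tensor_lift (\<lambda>x y. lin3 (lin3 e1 e2 e3 y) (lin3 e2 e2 p y) (lin3 e3 q r y) x)"

definition A1_mult where "A1_mult = table_mult e3 e3 e3"
definition A2_mult where "A2_mult = table_mult e3 e3 0"
definition A3_mult where "A3_mult = table_mult e3 0 0"

text \<open>
  The remaining arguments of \<open>bialg\<close> are the values of the comultiplication and of the counit
  on \<open>e1, e2, e3\<close>.
\<close>

definition bialg ::
  "((complex ^ 3, complex ^ 3) tensor \<Rightarrow> complex ^ 3) \<Rightarrow>
   (complex ^ 3, complex ^ 3) tensor \<Rightarrow> (complex ^ 3, complex ^ 3) tensor \<Rightarrow>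
   (complex ^ 3, complex ^ 3) tensor \<Rightarrow> complex \<Rightarrow> complex \<Rightarrow> complex \<Rightarrow>
   (complex ^ 3) bialg_data" where
  "bialg m d1 d2 d3 c1 c2 c3 =
     \<lparr>mult = m, unit = (\<lambda>c. c *\<^sub>C e1), comult = lin3 d1 d2 d3, counit = lin3 c1 c2 c3\<rparr>"

definition A1_bialgs :: "(complex ^ 3) bialg_data list" where
  "A1_bialgs =
   [bialg A1_mult
      (e1 \<otimes> e1)
      (e1 \<otimes> (e1 - e3) + e2 \<otimes> (2 *\<^sub>C e3 - e2) + e3 \<otimes> (2 *\<^sub>C e2 - e3 - e1))
      (e1 \<otimes> (e2 - e3) + e2 \<otimes> (e1 - 2 *\<^sub>C e2 + e3) + e3 \<otimes> (e2 + e3 - e1))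
      1 1 1,
    bialg A1_mult
      (e1 \<otimes> e1)
      (e2 \<otimes> e2)
      (e3 \<otimes> e3)
      1 1 1,
    bialg A1_mult
      (e1 \<otimes> e1)
      (e2 \<otimes> e2)
      ((e2 - e3) \<otimes> e3 + e3 \<otimes> (e2 - e3))
      1 1 0,
    bialg A1_mult
      (e1 \<otimes> e1)
      ((e2 - e3) \<otimes> e3 + e3 \<otimes> e2)
      (e3 \<otimes> e3)
      1 1 1,
    bialg A1_mult
      (e1 \<otimes> e1)
      (e2 \<otimes> e2 + (e1 - e2) \<otimes> e3)
      ((e1 - e3) \<otimes> e3 + e3 \<otimes> e2)
      1 1 0,
    \<comment> \<open>\<open>\<epsilon> e3 = 1\<close>, as found in print, is a misprint: applying \<open>\<epsilon> \<otimes> id\<close> to \<open>\<Delta> e2\<close> gives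
       \<open>\<epsilon> e2 *\<^sub>C e2 + \<epsilon> e3 *\<^sub>C (e1 - e2) = e2\<close>, which forces \<open>\<epsilon> e3 = 0\<close>.\<close>
    bialg A1_mult
      (e1 \<otimes> e1)
      (e2 \<otimes> e2 + e3 \<otimes> (e1 - e2))
      (e2 \<otimes> e3 + e3 \<otimes> e1 - e3 \<otimes> e3)
      1 1 0,
    bialg A1_mult
      (e1 \<otimes> e1)
      ((e1 - e2) \<otimes> (e1 - e2) + e2 \<otimes> e2)
      (e3 \<otimes> e3)
      1 1 1,
    bialg A1_mult
      ((e1 - e2) \<otimes> (e1 - e2) + e2 \<otimes> e2)
      (e2 \<otimes> e2)
      (e3 \<otimes> e3)
      2 1 1,
    bialg A1_mult
      ((e1 - e2) \<otimes> (e1 - e2) + e2 \<otimes> e2)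
      (e2 \<otimes> e2)
      ((e2 - e3) \<otimes> e3 + e3 \<otimes> (e2 - e3))
      2 1 0,
    bialg A1_mult
      ((e1 - e2) \<otimes> (e1 - e2) + (e2 - e3) \<otimes> (e2 - e3) + e3 \<otimes> e3)
      ((e2 - e3) \<otimes> (e2 - e3) + e3 \<otimes> e3)
      (e3 \<otimes> e3)
      3 2 1,
    bialg A1_mult
      (e1 \<otimes> (e2 - e3) + e3 \<otimes> (e1 - 2 *\<^sub>C e2 + 2 *\<^sub>C e3))
      ((e2 - e3) \<otimes> (e2 - e3) + e3 \<otimes> e3)
      (e3 \<otimes> e3)
      2 2 1]"

definition A2_bialgs :: "(complex ^ 3) bialg_data list" where
  "A2_bialgs =
   [bialg A2_mult
      (e1 \<otimes> e1)
      (e1 \<otimes> e2 + e2 \<otimes> e1 - e2 \<otimes> e2)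
      (e1 \<otimes> e3 + e3 \<otimes> e1 - e3 \<otimes> e2)
      1 0 0,
    bialg A2_mult
      (e1 \<otimes> e1)
      (e1 \<otimes> e2 + e2 \<otimes> e1 - e2 \<otimes> e2)
      (e1 \<otimes> e3 - e2 \<otimes> e3 + e3 \<otimes> e1 - e3 \<otimes> e2 + e3 \<otimes> e3)
      1 0 0,
    bialg A2_mult
      (e1 \<otimes> e1)
      (e1 \<otimes> e2 + e2 \<otimes> e1 - e2 \<otimes> e2)
      (e1 \<otimes> e3 - e2 \<otimes> e3 + e3 \<otimes> e1)
      1 0 0,
    bialg A2_mult
      (e1 \<otimes> e1)
      (e1 \<otimes> e2 + e2 \<otimes> e1 - e2 \<otimes> e2)
      (e1 \<otimes> e3 - e3 \<otimes> e2 + e3 \<otimes> e1 - e2 \<otimes> e3)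
      1 0 0]"

definition A3_bialgs :: "(complex ^ 3) bialg_data list" where
  "A3_bialgs =
   [bialg A3_mult
      ((e1 - e2) \<otimes> (e1 - e2) + e2 \<otimes> e2)
      (e2 \<otimes> e2)
      (e3 \<otimes> e3)
      2 1 1,
    bialg A3_mult
      (e1 \<otimes> e1)
      (e1 \<otimes> e2 + e2 \<otimes> e1 - e2 \<otimes> e2)
      (e1 \<otimes> e3 + e3 \<otimes> e1 - e2 \<otimes> e3 - e3 \<otimes> e2)
      1 0 0,
    bialg A3_mult
      (e1 \<otimes> e1)
      (e1 \<otimes> e2 + e2 \<otimes> e1 - e2 \<otimes> e2 - e3 \<otimes> e3)
      (e1 \<otimes> e3 - e2 \<otimes> e3 + e3 \<otimes> e1 - e3 \<otimes> e2)
      1 0 0,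
    bialg A3_mult
      (e1 \<otimes> e1)
      (e2 \<otimes> e2)
      (e2 \<otimes> e3 + e3 \<otimes> e2)
      1 1 0,
    bialg A3_mult
      (e1 \<otimes> e1)
      (e2 \<otimes> e2 + e3 \<otimes> e3)
      (e2 \<otimes> e3 + e3 \<otimes> e2)
      1 1 0]"

end

theory Submission
  imports Defs "HOL-Computational_Algebra.Fundamental_Theorem_Algebra"
begin

text \<open>
  In a basis, a weak bialgebra is a solution of polynomial equations in the structure constants of
  its operations (\<open>weak_bialgebra_iff\<close>), and two weak bialgebras with the same structure constants
  in suitable bases are isomorphic (\<open>isomorphic_if_same_constants\<close>). Verifying that the twenty
  entries of the list are weak bialgebras and recognising a given weak bialgebra in the list thus
  become statements about arrays of complex numbers, once a good basis is chosen. The basis is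
  chosen by the algebra.
  
  A unital algebra of dimension three that has an idempotent \<open>e\<close> other than \<open>0\<close> and \<open>1\<close> is
  spanned by \<open>e\<close>, \<open>f = 1 - e\<close> and one vector from a Peirce corner. A vector in \<open>eAe\<close> or \<open>fAf\<close>
  generates a quadratic extension of that corner, so the algebra is \<open>\<complex>\<^sup>3\<close> or \<open>\<complex>\<close> times the dual
  numbers; a vector in \<open>eAf\<close> or \<open>fAe\<close> gives the upper triangular matrices. These are the algebras
  \<open>A1\<close>, \<open>A2\<close>, \<open>A3\<close>. Without such an idempotent every element is a scalar plus a nilpotent, and the
  algebra is \<open>\<complex>[x]/(x\<^sup>3)\<close> or \<open>\<complex>[x, y]/(x, y)\<^sup>2\<close> (\<open>has_table_cases\<close>).
  
  The last two carry no weak bialgebra structure (\<open>no_local_structure\<close>): \<open>\<Delta>(1)\<close> is a nonzero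
  idempotent of a local algebra, hence \<open>1 \<otimes> 1\<close>, so \<open>\<epsilon>\<close> is a character and
  \<open>\<Delta>(x) = x \<otimes> 1 + 1 \<otimes> x + \<dots>\<close> for nilpotent \<open>x\<close>. The binomial coefficient of the mixed term of
  \<open>\<Delta>(x)\<^sup>2\<close> or \<open>\<Delta>(x)\<^sup>3\<close> does not vanish, although the power of \<open>x\<close> does.
  
  On \<open>\<complex>\<^sup>3\<close>, the functions on three points, an algebra homomorphism to the functions on pairs of points
  is the same as a partial binary operation on the points. The remaining axioms say that
  this operation is the composition of a category with three morphisms and that \<open>\<epsilon>\<close> is the sum of the values
  at the identities (\<open>structure_equations_of_category\<close>, \<open>category_of_structure_equations\<close>). There are
  eleven such categories: the seven monoids of order three, the disjoint unions of each of the two monoids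
  of order two with a point, the discrete category, and the category of an arrow.
  
  On \<open>A2\<close> and \<open>A3\<close>, with basis idempotents \<open>p\<close>, \<open>q\<close> and nilpotent \<open>n\<close>, comparing coefficients in the
  order of increasing nilpotency determines \<open>\<Delta>\<close> up to a few parameters (\<open>dual_structure\<close>,
  \<open>triangular_structure_bialgebra\<close>, \<open>triangular_structure_category\<close>). A change of basis
  \<open>(p - s n, q + s n, \<mu> n)\<close>, with \<open>s = 0\<close> in the commutative case, respects the multiplication and
  reduces the parameters to the values in the list.
\<close>


section \<open>Coordinates on tensor products\<close>

lemma clinearD:
  assumes "clinear f"
  shows "f (x + y) = f x + f y" "f (c *\<^sub>C x) = c *\<^sub>C f x" "f 0 = 0"
    "f (\<Sum>i\<in>A. g i) = (\<Sum>i\<in>A. f (g i))" "f (x - y) = f x - f y"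
proof -
  interpret f: Vector_Spaces.linear scaleC scaleC f by fact
  show "f (x + y) = f x + f y" "f (c *\<^sub>C x) = c *\<^sub>C f x" "f 0 = 0"
    "f (\<Sum>i\<in>A. g i) = (\<Sum>i\<in>A. f (g i))" "f (x - y) = f x - f y"
    by (rule f.add, rule f.scale, rule f.zero, rule f.sum, rule f.diff)
qed

lemma tens_simps:
  "(x + x') \<otimes> y = x \<otimes> y + x' \<otimes> y" "(c *\<^sub>C x) \<otimes> y = c *\<^sub>C (x \<otimes> y)"
  "x \<otimes> (y + y') = x \<otimes> y + x \<otimes> y'" "x \<otimes> (c *\<^sub>C y) = c *\<^sub>C (x \<otimes> y)"
  by (simp_all only: cbilinearD[OF cbilinear_tens])

lemma delta_mult:
  "(if P then y else 0) * (x::complex) = (if P then y * x else 0)"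
  "(x::complex) * (if P then y else 0) = (if P then x * y else 0)"
  by simp_all

lemma clinear_compose: "clinear f \<Longrightarrow> clinear g \<Longrightarrow> clinear (\<lambda>x. f (g x))"
  by (rule clinearI) (simp_all only: clinearD[of f] clinearD[of g])

lemma clinear_tensor_map: "clinear (tensor_map f g)"
  unfolding tensor_map_def by (rule clinear_tensor_lift)

lemma clinear_tensor_assoc: "clinear tensor_assoc"
  unfolding tensor_assoc_def by (rule clinear_tensor_lift)

lemma clinear_tensor_mult: "clinear (tensor_mult m n)"
  unfolding tensor_mult_def by (rule clinear_tensor_lift)

lemmas tensor_op_simps =
  clinearD(1,2)[OF clinear_tensor_map] clinearD(1,2)[OF clinear_tensor_assoc]
  clinearD(1,2)[OF clinear_tensor_mult] tensor_lift_add tensor_lift_scale tens_simps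

lemma clinear_id: "clinear (id :: 'a \<Rightarrow> 'a::complex_vector)"
  by (rule clinearI) simp_all

text \<open>
  A basis is kept together with its dual basis of coordinate functionals, so that bases of tensor products
  come with explicit functionals and equations between tensors can be tested coordinatewise.
\<close>
locale coordinates =
  fixes b :: "'n::finite \<Rightarrow> 'v::complex_vector" and \<beta> :: "'n \<Rightarrow> 'v \<Rightarrow> complex"
  assumes linear_coord: "clinear (\<beta> i)"
    and coord_basis: "\<beta> i (b j) = (if i = j then 1 else 0)"
    and expand: "(\<Sum>i\<in>UNIV. \<beta> i x *\<^sub>C b i) = x"
begin

lemma coord_eqI:
  assumes "\<And>i. \<beta> i x = \<beta> i y"
  shows "x = y"
proof -
  have "(\<Sum>i\<in>UNIV. \<beta> i x *\<^sub>C b i) = (\<Sum>i\<in>UNIV. \<beta> i y *\<^sub>C b i)" by (simp only: assms)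
  then show ?thesis by (simp only: expand)
qed

lemma clinear_eqI:
  assumes "clinear f" "clinear g" "\<And>i. f (b i) = g (b i)"
  shows "f x = g x"
proof -
  have "f (\<Sum>i\<in>UNIV. \<beta> i x *\<^sub>C b i) = g (\<Sum>i\<in>UNIV. \<beta> i x *\<^sub>C b i)"
    by (simp only: clinearD[OF assms(1)] clinearD[OF assms(2)] assms(3))
  then show ?thesis by (simp only: expand)
qed

lemma clinear_coord_expand: "clinear f \<Longrightarrow> f x = (\<Sum>i\<in>UNIV. \<beta> i x *\<^sub>C f (b i))"
  by (subst expand[of x, symmetric]) (simp only: clinearD[of f])

end

definition tensor_coord ::
  "('n \<Rightarrow> 'v::complex_vector \<Rightarrow> complex) \<Rightarrow> ('m \<Rightarrow> 'w::complex_vector \<Rightarrow> complex) \<Rightarrow>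
   'n \<times> 'm \<Rightarrow> ('v, 'w) tensor \<Rightarrow> complex" where
  "tensor_coord \<beta> \<gamma> = (\<lambda>(i, j). tensor_lift (\<lambda>x y. \<beta> i x * \<gamma> j y))"

lemma clinear_tensor_coord: "clinear (tensor_coord \<beta> \<gamma> p)"
  by (cases p) (simp add: tensor_coord_def clinear_tensor_lift)

lemma tensor_coord_tens:
  assumes "\<And>i. clinear (\<beta> i)" "\<And>j. clinear (\<gamma> j)"
  shows "tensor_coord \<beta> \<gamma> (i, j) (x \<otimes> y) = \<beta> i x * \<gamma> j y"
  unfolding tensor_coord_def prod.case
  by (rule tensor_lift_tens, rule cbilinearI)
    (simp_all add: clinearD[OF assms(1)] clinearD[OF assms(2)] scaleC_complex_def algebra_simps)

text \<open>
  The coordinate functionals on the tensor product are lifts of products of coordinates, so the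
  elementary tensors of basis vectors are again a basis; applied twice, this handles triple tensors.
\<close>
lemma coordinates_tensor:
  assumes "coordinates b \<beta>" "coordinates c \<gamma>"
  shows "coordinates (\<lambda>(i, j). b i \<otimes> c j) (tensor_coord \<beta> \<gamma>)"
proof -
  interpret b: coordinates b \<beta> by fact
  interpret c: coordinates c \<gamma> by fact
  note tc = tensor_coord_tens[OF b.linear_coord c.linear_coord]
  have tc': "tensor_coord \<beta> \<gamma> p (x \<otimes> y) = \<beta> (fst p) x * \<gamma> (snd p) y" for p x y
    by (cases p) (simp only: tc fst_conv snd_conv)
  show ?thesis
  proof (rule coordinates.intro)
    show "clinear (tensor_coord \<beta> \<gamma> p)" for p by (rule clinear_tensor_coord)
    show "tensor_coord \<beta> \<gamma> p (case q of (i, j) \<Rightarrow> b i \<otimes> c j) = (if p = q then 1 else 0)" for p q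
      by (cases p; cases q) (simp add: tc b.coord_basis c.coord_basis)
    show "(\<Sum>p\<in>UNIV. tensor_coord \<beta> \<gamma> p t *\<^sub>C (case p of (i, j) \<Rightarrow> b i \<otimes> c j)) = t" for t
    proof (induction t rule: tensor_induct)
      case (tens x y)
      have "x \<otimes> y = (\<Sum>i\<in>UNIV. \<beta> i x *\<^sub>C b i) \<otimes> (\<Sum>j\<in>UNIV. \<gamma> j y *\<^sub>C c j)"
        by (simp only: b.expand c.expand)
      also have "\<dots> = (\<Sum>i\<in>UNIV. \<Sum>j\<in>UNIV. (\<beta> i x * \<gamma> j y) *\<^sub>C (b i \<otimes> c j))"
      proof -
        have l: "clinear (\<lambda>u. u \<otimes> w)" "clinear (\<lambda>u. w' \<otimes> u)" for w :: 'd and w' :: 'b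
          by (rule clinearI; simp add: tens_simps)+
        show ?thesis
          by (subst clinearD(4)[OF l(1)], subst clinearD(4)[OF l(2)])
            (simp only: tens_simps scaleC_scaleC mult_ac)
      qed
      finally have eq: "x \<otimes> y = (\<Sum>i\<in>UNIV. \<Sum>j\<in>UNIV. (\<beta> i x * \<gamma> j y) *\<^sub>C (b i \<otimes> c j))" .
      have "(\<Sum>p\<in>UNIV. tensor_coord \<beta> \<gamma> p (x \<otimes> y) *\<^sub>C (case p of (i, j) \<Rightarrow> b i \<otimes> c j)) =
          (\<Sum>i\<in>UNIV. \<Sum>j\<in>UNIV. (\<beta> i x * \<gamma> j y) *\<^sub>C (b i \<otimes> c j))"
        by (simp only: tc' split_beta UNIV_Times_UNIV[symmetric] sum.cartesian_product)
          (rule sum.cong, auto)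
      from trans[OF this eq[symmetric]] show ?case .
    next
      case (add s t)
      then show ?case
        by (simp only: clinearD[OF clinear_tensor_coord] scaleC_add_left sum.distrib)
    next
      case (scale k t)
      then show ?case
        by (simp only: clinearD[OF clinear_tensor_coord] scaleC_complex_def
            scaleC_scaleC[symmetric] cvec.scale_sum_right[symmetric])
    qed
  qed
qed

section \<open>Weak bialgebras in coordinates\<close>

text \<open>
  The coefficients of the componentwise product of two tensors with coefficients \<open>X\<close> and \<open>Y\<close>, over an
  algebra with structure constants \<open>M\<close>.
\<close>
definition tensor_product_coeff ::
  "('n::finite \<Rightarrow> 'n \<Rightarrow> 'n \<Rightarrow> complex) \<Rightarrow> ('n \<Rightarrow> 'n \<Rightarrow> complex) \<Rightarrow> ('n \<Rightarrow> 'n \<Rightarrow> complex) \<Rightarrow> 'n \<Rightarrow> 'n \<Rightarrow> complex"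
  where "tensor_product_coeff M X Y r s =
    (\<Sum>a\<in>UNIV. \<Sum>b\<in>UNIV. \<Sum>c\<in>UNIV. \<Sum>d\<in>UNIV. X a b * Y c d * M a c r * M b d s)"

text \<open>
  The axioms of a weak bialgebra for the structure constants \<open>M i j k\<close> (coefficient of \<open>b k\<close> in
  \<open>b i b j\<close>), \<open>D k i j\<close> (coefficient of \<open>b i \<otimes> b j\<close> in \<open>\<Delta>(b k)\<close>), \<open>U\<close> (coefficients of the unit) and
  \<open>E\<close> (values of the counit). The array \<open>T\<close> consists of the coefficients of \<open>\<Delta>(1)\<close>.
\<close>
definition structure_equations ::
  "('n::finite \<Rightarrow> 'n \<Rightarrow> 'n \<Rightarrow> complex) \<Rightarrow> ('n \<Rightarrow> complex) \<Rightarrow> ('n \<Rightarrow> 'n \<Rightarrow> 'n \<Rightarrow> complex) \<Rightarrow>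
   ('n \<Rightarrow> complex) \<Rightarrow> bool" where
  "structure_equations M U D E \<longleftrightarrow>
    (\<forall>i j k r. (\<Sum>l\<in>UNIV. M i j l * M l k r) = (\<Sum>l\<in>UNIV. M j k l * M i l r)) \<and>
    (\<forall>i r. (\<Sum>l\<in>UNIV. U l * M l i r) = (if r = i then 1 else 0)) \<and>
    (\<forall>i r. (\<Sum>l\<in>UNIV. U l * M i l r) = (if r = i then 1 else 0)) \<and>
    (\<forall>r i j k. (\<Sum>l\<in>UNIV. D r l k * D l i j) = (\<Sum>l\<in>UNIV. D r i l * D l j k)) \<and>
    (\<forall>i r. (\<Sum>l\<in>UNIV. E l * D i l r) = (if r = i then 1 else 0)) \<and>
    (\<forall>i r. (\<Sum>l\<in>UNIV. E l * D i r l) = (if r = i then 1 else 0)) \<and>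
    (\<forall>i j r s. (\<Sum>l\<in>UNIV. M i j l * D l r s) = tensor_product_coeff M (D i) (D j) r s) \<and>
    (let T = (\<lambda>r s. \<Sum>l\<in>UNIV. U l * D l r s) in
      (\<forall>i j k. (\<Sum>l\<in>UNIV. T l k * D l i j) = (\<Sum>a\<in>UNIV. \<Sum>b\<in>UNIV. T i a * T b k * M a b j)) \<and>
      (\<forall>i j k. (\<Sum>l\<in>UNIV. T l k * D l i j) = (\<Sum>a\<in>UNIV. \<Sum>b\<in>UNIV. T i a * T b k * M b a j))) \<and>
    (\<forall>i j k. (\<Sum>l\<in>UNIV. M i j l * (\<Sum>r\<in>UNIV. M l k r * E r)) =
       (\<Sum>a\<in>UNIV. \<Sum>b\<in>UNIV. D j a b * (\<Sum>r\<in>UNIV. M i a r * E r) * (\<Sum>s\<in>UNIV. M b k s * E s)))"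

locale linear_data = coordinates b \<beta>
  for b :: "'n::finite \<Rightarrow> 'v::complex_vector" and \<beta> :: "'n \<Rightarrow> 'v \<Rightarrow> complex" +
  fixes B :: "'v bialg_data" and M D :: "'n \<Rightarrow> 'n \<Rightarrow> 'n \<Rightarrow> complex" and U E :: "'n \<Rightarrow> complex"
  assumes lin_mult: "clinear (mult B)"
    and lin_unit: "clinear (unit B)"
    and lin_comult: "clinear (comult B)"
    and lin_counit: "clinear (counit B)"
    and mult_basis: "mult B (b i \<otimes> b j) = (\<Sum>k\<in>UNIV. M i j k *\<^sub>C b k)"
    and unit_basis: "unit B 1 = (\<Sum>k\<in>UNIV. U k *\<^sub>C b k)"
    and comult_basis: "comult B (b k) = (\<Sum>i\<in>UNIV. \<Sum>j\<in>UNIV. D k i j *\<^sub>C (b i \<otimes> b j))"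
    and counit_basis: "counit B (b k) = E k"
begin

abbreviation "\<beta>2 \<equiv> tensor_coord \<beta> \<beta>"
abbreviation "\<beta>3 \<equiv> tensor_coord \<beta> \<beta>2"

sublocale t2: coordinates "\<lambda>(i, j). b i \<otimes> b j" \<beta>2
  by (intro coordinates_tensor) unfold_locales

sublocale t3: coordinates "\<lambda>(i, p). b i \<otimes> (case p of (j, k) \<Rightarrow> b j \<otimes> b k)" \<beta>3
  by (intro coordinates_tensor) unfold_locales

lemmas \<beta>_simps = clinearD[OF linear_coord] clinearD[OF t2.linear_coord] clinearD[OF t3.linear_coord]
lemmas \<beta>2_tens = tensor_coord_tens[OF linear_coord linear_coord]
lemmas \<beta>3_tens = tensor_coord_tens[OF linear_coord t2.linear_coord]
lemmas lin_simps = clinearD(1,2)[OF lin_mult] clinearD(1,2)[OF lin_comult]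
  clinearD(1,2)[OF lin_counit]

lemma coord_unit: "\<beta> k (unit B 1) = U k"
  by (simp add: unit_basis \<beta>_simps coord_basis scaleC_complex_def delta_mult)

lemma coord_counit: "counit B x = (\<Sum>i\<in>UNIV. \<beta> i x * E i)"
  by (subst clinear_coord_expand[OF lin_counit]) (simp add: counit_basis scaleC_complex_def)

lemma coord_comult: "\<beta>2 (i, j) (comult B x) = (\<Sum>k\<in>UNIV. \<beta> k x * D k i j)"
proof -
  have "\<beta>2 (i, j) (comult B (b k)) = D k i j" for k
    by (simp add: comult_basis \<beta>_simps \<beta>2_tens coord_basis scaleC_complex_def delta_mult)
  then show ?thesis
    by (subst clinear_coord_expand[OF lin_comult])
      (simp add: \<beta>_simps scaleC_complex_def)
qed

lemma coord_mult: "\<beta> k (mult B (x \<otimes> y)) = (\<Sum>i\<in>UNIV. \<Sum>j\<in>UNIV. \<beta> i x * \<beta> j y * M i j k)"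
proof -
  have *: "\<beta> k (mult B (b i \<otimes> b j)) = M i j k" for i j
    by (simp add: mult_basis \<beta>_simps coord_basis scaleC_complex_def delta_mult)
  have l: "clinear (\<lambda>x. mult B (x \<otimes> z))" "clinear (\<lambda>y. mult B (z \<otimes> y))" for z
    by (rule clinearI; simp add: lin_simps tens_simps)+
  have "mult B (x \<otimes> y) = (\<Sum>i\<in>UNIV. \<beta> i x *\<^sub>C (\<Sum>j\<in>UNIV. \<beta> j y *\<^sub>C mult B (b i \<otimes> b j)))"
    by (subst clinear_coord_expand[OF l(1)], subst clinear_coord_expand[OF l(2)]) simp
  then show ?thesis
    by (simp add: \<beta>_simps scaleC_complex_def * sum_distrib_left mult.assoc)
qed

text \<open>
  Each operation in the axioms is linear in its tensor argument, so its coordinates need only be computed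
  on elementary tensors; the lemmas up to \<open>coord_tensor_mult\<close> rest on this.
\<close>
lemma coord_map_comult_id:
  "\<beta>3 (i, j, k) (tensor_assoc (tensor_map (comult B) id t)) = (\<Sum>l\<in>UNIV. \<beta>2 (l, k) t * D l i j)"
proof -
  have *: "\<beta>3 (i, j, k) (tensor_assoc (s \<otimes> z)) = \<beta>2 (i, j) s * \<beta> k z" for s z
    by (induction s rule: tensor_induct)
      (simp_all add: tensor_op_simps tensor_assoc_tens \<beta>_simps \<beta>2_tens \<beta>3_tens
        scaleC_complex_def algebra_simps)
  show ?thesis
    by (induction t rule: tensor_induct)
      (simp_all add: tensor_op_simps tensor_map_tens[OF lin_comult clinear_id, unfolded id_def] * coord_comult
        \<beta>_simps \<beta>2_tens scaleC_complex_def sum.distrib sum_distrib_left sum_distrib_right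
        algebra_simps)
qed

lemma coord_map_id_comult:
  "\<beta>3 (i, j, k) (tensor_map id (comult B) t) = (\<Sum>l\<in>UNIV. \<beta>2 (i, l) t * D l j k)"
  by (induction t rule: tensor_induct)
    (simp_all add: tensor_op_simps tensor_map_tens[OF clinear_id lin_comult, unfolded id_def] \<beta>3_tens coord_comult
      \<beta>_simps \<beta>2_tens scaleC_complex_def sum.distrib sum_distrib_left algebra_simps)

lemma coord_counit_left:
  "\<beta> r (tensor_lift (\<lambda>x y. counit B x *\<^sub>C y) t) = (\<Sum>l\<in>UNIV. E l * \<beta>2 (l, r) t)"
proof -
  have "cbilinear (\<lambda>x y. counit B x *\<^sub>C y)"
    by (rule cbilinearI) (simp_all add: lin_simps scaleC_add_left scaleC_add_right scaleC_scaleC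
        scaleC_complex_def mult.commute)
  note lift = tensor_lift_tens[OF this]
  show ?thesis
  proof (induction t rule: tensor_induct)
    case (tens x y)
    show ?case
      by (simp only: lift \<beta>_simps \<beta>2_tens scaleC_complex_def)
        (simp only: coord_counit sum_distrib_left sum_distrib_right mult_ac)
  qed (simp_all add: tensor_op_simps \<beta>_simps scaleC_complex_def sum.distrib sum_distrib_left
      algebra_simps)
qed

lemma coord_counit_right:
  "\<beta> r (tensor_lift (\<lambda>x y. counit B y *\<^sub>C x) t) = (\<Sum>l\<in>UNIV. E l * \<beta>2 (r, l) t)"
proof -
  have "cbilinear (\<lambda>x y. counit B y *\<^sub>C x)"
    by (rule cbilinearI) (simp_all add: lin_simps scaleC_add_left scaleC_add_right scaleC_scaleC
        scaleC_complex_def mult.commute)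
  note lift = tensor_lift_tens[OF this]
  show ?thesis
  proof (induction t rule: tensor_induct)
    case (tens x y)
    show ?case
      by (simp only: lift \<beta>_simps \<beta>2_tens scaleC_complex_def)
        (simp only: coord_counit sum_distrib_left sum_distrib_right mult_ac)
  qed (simp_all add: tensor_op_simps \<beta>_simps scaleC_complex_def sum.distrib sum_distrib_left
      algebra_simps)
qed

lemma coord_tensor_mult:
  "\<beta>2 (r, s) (tensor_mult (mult B) (mult B) (t \<otimes> u)) =
    (\<Sum>a\<in>UNIV. \<Sum>b\<in>UNIV. \<Sum>c\<in>UNIV. \<Sum>d\<in>UNIV. \<beta>2 (a, b) t * \<beta>2 (c, d) u * M a c r * M b d s)"
proof -
  have *: "\<beta>2 (r, s) (tensor_mult (mult B) (mult B) ((x \<otimes> y) \<otimes> u)) =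
    (\<Sum>a\<in>UNIV. \<Sum>b\<in>UNIV. \<Sum>c\<in>UNIV. \<Sum>d\<in>UNIV. \<beta>2 (a, b) (x \<otimes> y) * \<beta>2 (c, d) u * M a c r * M b d s)"
    for x y
  proof (induction u rule: tensor_induct)
    case (tens x' y')
    have "\<beta>2 (r, s) (tensor_mult (mult B) (mult B) ((x \<otimes> y) \<otimes> (x' \<otimes> y'))) =
      (\<Sum>a\<in>UNIV. \<Sum>c\<in>UNIV. \<beta> a x * \<beta> c x' * M a c r) * (\<Sum>b\<in>UNIV. \<Sum>d\<in>UNIV. \<beta> b y * \<beta> d y' * M b d s)"
      by (simp only: tensor_mult_tens[OF lin_mult lin_mult] \<beta>2_tens coord_mult)
    also have "\<dots> = (\<Sum>a\<in>UNIV. \<Sum>b\<in>UNIV. \<Sum>c\<in>UNIV. \<Sum>d\<in>UNIV.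
        (\<beta> a x * \<beta> c x' * M a c r) * (\<beta> b y * \<beta> d y' * M b d s))"
      by (simp only: sum_product)
    finally show ?case by (simp add: \<beta>2_tens mult_ac)
  next
    case (add s t)
    then show ?case
      by (simp only: tensor_op_simps \<beta>_simps distrib_left distrib_right sum.distrib)
  next
    case (scale c t)
    then show ?case
      by (simp only: tensor_op_simps \<beta>_simps scaleC_complex_def sum_distrib_left mult_ac)
  qed
  show ?thesis
  proof (induction t rule: tensor_induct)
    case (tens x y)
    show ?case by (rule *)
  next
    case (add s t)
    then show ?case
      by (simp only: tensor_op_simps \<beta>_simps distrib_left distrib_right sum.distrib)
  next
    case (scale c t)
    then show ?case
      by (simp only: tensor_op_simps \<beta>_simps scaleC_complex_def sum_distrib_left mult_ac)
  qed
qed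

abbreviation "unit_comult \<equiv> (\<lambda>r s. \<Sum>l\<in>UNIV. U l * D l r s)"

lemma coord_comult_unit: "\<beta>2 (r, s) (comult B (unit B 1)) = unit_comult r s"
  by (simp add: coord_comult coord_unit)

text \<open>
  The unit laws collapse the outer factors of the two products of \<open>\<Delta>(1) \<otimes> 1\<close> and \<open>1 \<otimes> \<Delta>(1)\<close>, so that only
  the middle factors are multiplied; that is why a single constant \<open>M\<close> occurs per summand.
\<close>
lemma unit_comult_products:
  defines "T \<equiv> unit_comult"
  assumes unit: "\<And>i r. (\<Sum>l\<in>UNIV. U l * M l i r) = (if r = i then 1 else 0)"
    "\<And>i r. (\<Sum>l\<in>UNIV. U l * M i l r) = (if r = i then 1 else 0)"
  shows "\<beta>3 (i, j, k) (tensor_mult (mult B) (tensor_mult (mult B) (mult B))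
      (tensor_assoc (comult B (unit B 1) \<otimes> unit B 1) \<otimes> (unit B 1 \<otimes> comult B (unit B 1)))) =
      (\<Sum>a\<in>UNIV. \<Sum>b\<in>UNIV. T i a * T b k * M a b j)" (is "?l1 = _")
    and "\<beta>3 (i, j, k) (tensor_mult (mult B) (tensor_mult (mult B) (mult B))
      ((unit B 1 \<otimes> comult B (unit B 1)) \<otimes> tensor_assoc (comult B (unit B 1) \<otimes> unit B 1))) =
      (\<Sum>a\<in>UNIV. \<Sum>b\<in>UNIV. T i a * T b k * M b a j)" (is "?l2 = _")
proof -
  let ?one = "unit B 1"
  have one: "mult B (?one \<otimes> x) = x" "mult B (x \<otimes> ?one) = x" for x
  proof -
    have "\<beta> k (mult B (?one \<otimes> x)) = (\<Sum>j\<in>UNIV. \<beta> j x * (\<Sum>i\<in>UNIV. U i * M i j k))" for k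
      by (simp only: coord_mult coord_unit sum_distrib_left, subst sum.swap) (simp only: mult_ac)
    then show "mult B (?one \<otimes> x) = x" by (intro coord_eqI) (simp add: unit delta_mult)
    have "\<beta> k (mult B (x \<otimes> ?one)) = (\<Sum>i\<in>UNIV. \<beta> i x * (\<Sum>j\<in>UNIV. U j * M i j k))" for k
      by (simp only: coord_mult coord_unit sum_distrib_left mult_ac)
    then show "mult B (x \<otimes> ?one) = x" by (intro coord_eqI) (simp add: unit delta_mult)
  qed
  note tm = tensor_mult_tens[OF lin_mult clinear_tensor_mult] tensor_mult_tens[OF lin_mult lin_mult]
  have 1: "\<beta>3 (i, j, k) (tensor_mult (mult B) (tensor_mult (mult B) (mult B))
      (tensor_assoc (s \<otimes> ?one) \<otimes> (?one \<otimes> t))) =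
      (\<Sum>a\<in>UNIV. \<Sum>b\<in>UNIV. \<beta>2 (i, a) s * \<beta>2 (b, k) t * M a b j)" for s t
  proof (induction s rule: tensor_induct)
    case (tens x y)
    show ?case
    proof (induction t rule: tensor_induct)
      case (tens x' y')
      show ?case
        by (simp only: tensor_assoc_tens tm one \<beta>3_tens \<beta>2_tens coord_mult sum_distrib_left
            sum_distrib_right mult_ac)
    next
      case (add s t)
      then show ?case
        by (simp only: tensor_op_simps \<beta>_simps distrib_left distrib_right sum.distrib)
    next
      case (scale c t)
      then show ?case
        by (simp only: tensor_op_simps \<beta>_simps scaleC_complex_def sum_distrib_left mult_ac)
    qed
  next
    case (add s t)
    then show ?case
      by (simp only: tensor_op_simps \<beta>_simps distrib_left distrib_right sum.distrib)
  next
    case (scale c t)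
    then show ?case
      by (simp only: tensor_op_simps \<beta>_simps scaleC_complex_def sum_distrib_left mult_ac)
  qed
  have 2: "\<beta>3 (i, j, k) (tensor_mult (mult B) (tensor_mult (mult B) (mult B))
      ((?one \<otimes> t) \<otimes> tensor_assoc (s \<otimes> ?one))) =
      (\<Sum>a\<in>UNIV. \<Sum>b\<in>UNIV. \<beta>2 (i, a) s * \<beta>2 (b, k) t * M b a j)" for s t
  proof (induction s rule: tensor_induct)
    case (tens x y)
    show ?case
    proof (induction t rule: tensor_induct)
      case (tens x' y')
      have "\<beta> i x * (\<beta> j (mult B (x' \<otimes> y)) * \<beta> k y') =
          (\<Sum>a\<in>UNIV. \<Sum>b\<in>UNIV. \<beta> i x * \<beta> a y * (\<beta> b x' * \<beta> k y') * M b a j)"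
        unfolding coord_mult by (subst sum.swap) (simp only: sum_distrib_left sum_distrib_right mult_ac)
      then show ?case
        by (simp only: tensor_assoc_tens tm one \<beta>3_tens \<beta>2_tens)
    next
      case (add s t)
      then show ?case
        by (simp only: tensor_op_simps \<beta>_simps distrib_left distrib_right sum.distrib)
    next
      case (scale c t)
      then show ?case
        by (simp only: tensor_op_simps \<beta>_simps scaleC_complex_def sum_distrib_left mult_ac)
    qed
  next
    case (add s t)
    then show ?case
      by (simp only: tensor_op_simps \<beta>_simps distrib_left distrib_right sum.distrib)
  next
    case (scale c t)
    then show ?case
      by (simp only: tensor_op_simps \<beta>_simps scaleC_complex_def sum_distrib_left mult_ac)
  qed
  show "?l1 = (\<Sum>a\<in>UNIV. \<Sum>b\<in>UNIV. T i a * T b k * M a b j)"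
    "?l2 = (\<Sum>a\<in>UNIV. \<Sum>b\<in>UNIV. T i a * T b k * M b a j)"
    by (simp_all only: 1 2 coord_comult_unit T_def)
qed

lemma coord_mult_left: "\<beta> k (mult B (b i \<otimes> y)) = (\<Sum>j\<in>UNIV. \<beta> j y * M i j k)"
  by (subst coord_mult, subst sum.swap) (simp add: coord_basis delta_mult)

lemma coord_mult_right: "\<beta> k (mult B (x \<otimes> b j)) = (\<Sum>i\<in>UNIV. \<beta> i x * M i j k)"
  by (subst coord_mult) (simp add: coord_basis delta_mult)

lemma coord_comult_basis: "\<beta>2 (i, j) (comult B (b k)) = D k i j"
  by (simp add: coord_comult coord_basis delta_mult)

lemma coord_mult_basis: "\<beta> k (mult B (b i \<otimes> b j)) = M i j k"
  by (simp add: coord_mult_right coord_basis delta_mult)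

lemma counit_mult_lift:
  "tensor_lift (\<lambda>u v. counit B (mult B (x \<otimes> u)) * counit B (mult B (v \<otimes> z))) t =
    (\<Sum>a\<in>UNIV. \<Sum>c\<in>UNIV. \<beta>2 (a, c) t * counit B (mult B (x \<otimes> b a)) * counit B (mult B (b c \<otimes> z)))"
proof -
  have bil: "cbilinear (\<lambda>u v. counit B (mult B (x \<otimes> u)) * counit B (mult B (v \<otimes> z)))"
    by (rule cbilinearI) (simp_all add: lin_simps tens_simps scaleC_complex_def algebra_simps)
  have l: "clinear (\<lambda>u. counit B (mult B (x \<otimes> u)))" "clinear (\<lambda>v. counit B (mult B (v \<otimes> z)))"
    by (rule clinearI; simp add: lin_simps tens_simps)+
  show ?thesis
  proof (induction t rule: tensor_induct)
    case (tens u v)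
    have "counit B (mult B (x \<otimes> u)) * counit B (mult B (v \<otimes> z)) =
      (\<Sum>a\<in>UNIV. \<beta> a u *\<^sub>C counit B (mult B (x \<otimes> b a))) *
      (\<Sum>c\<in>UNIV. \<beta> c v *\<^sub>C counit B (mult B (b c \<otimes> z)))"
      by (simp only: clinear_coord_expand[OF l(1), of u] clinear_coord_expand[OF l(2), of v])
    also have "\<dots> = (\<Sum>a\<in>UNIV. \<Sum>c\<in>UNIV.
      (\<beta> a u *\<^sub>C counit B (mult B (x \<otimes> b a))) * (\<beta> c v *\<^sub>C counit B (mult B (b c \<otimes> z))))"
      by (rule sum_product)
    finally show ?case
      by (subst tensor_lift_tens[OF bil]) (simp only: \<beta>2_tens scaleC_complex_def mult_ac)
  qed (simp_all add: tensor_op_simps \<beta>_simps scaleC_complex_def sum.distrib sum_distrib_left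
      algebra_simps)
qed

lemma counit_mult_basis: "counit B (mult B (b i \<otimes> b j)) = (\<Sum>r\<in>UNIV. M i j r * E r)"
  by (simp add: coord_counit coord_mult_basis)

text \<open>
  Conversely, the axioms follow from the equations because they are multilinear and can be checked on the
  basis.
\<close>
lemma bilinear_eqI:
  assumes "\<And>y. clinear (\<lambda>x. f x y)" "\<And>x. clinear (f x)" "\<And>y. clinear (\<lambda>x. g x y)" "\<And>x. clinear (g x)"
    "\<And>i j. f (b i) (b j) = g (b i) (b j)"
  shows "f x y = g x y"
proof -
  have "f (b i) y = g (b i) y" for i y
    by (rule clinear_eqI[OF assms(2) assms(4)]) (rule assms(5))
  then show ?thesis by (rule clinear_eqI[OF assms(1) assms(3)])
qed

lemma trilinear_eqI:
  assumes "\<And>y z. clinear (\<lambda>x. f x y z)" "\<And>x z. clinear (\<lambda>y. f x y z)" "\<And>x y. clinear (f x y)"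
    "\<And>y z. clinear (\<lambda>x. g x y z)" "\<And>x z. clinear (\<lambda>y. g x y z)" "\<And>x y. clinear (g x y)"
    "\<And>i j k. f (b i) (b j) (b k) = g (b i) (b j) (b k)"
  shows "f x y z = g x y z"
proof -
  have "f (b i) y z = g (b i) y z" for i y z
    by (rule bilinear_eqI[of "f (b i)" "g (b i)"]) (rule assms)+
  then show ?thesis by (rule clinear_eqI[OF assms(1) assms(4)])
qed

lemma unit_law_iff:
  "(\<forall>x. mult B (unit B 1 \<otimes> x) = x) \<longleftrightarrow> (\<forall>i r. (\<Sum>l\<in>UNIV. U l * M l i r) = (if r = i then 1 else 0))"
  (is "?A = ?B")
  "(\<forall>x. mult B (x \<otimes> unit B 1) = x) \<longleftrightarrow> (\<forall>i r. (\<Sum>l\<in>UNIV. U l * M i l r) = (if r = i then 1 else 0))"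
  (is "?A' = ?B'")
proof -
  have l: "clinear (\<lambda>x. mult B (unit B 1 \<otimes> x))" "clinear (\<lambda>x. mult B (x \<otimes> unit B 1))"
    "clinear (\<lambda>x::'v. x)"
    by (rule clinearI; simp add: lin_simps tens_simps)+
  have c: "\<beta> r (mult B (unit B 1 \<otimes> b i)) = (\<Sum>l\<in>UNIV. U l * M l i r)"
    "\<beta> r (mult B (b i \<otimes> unit B 1)) = (\<Sum>l\<in>UNIV. U l * M i l r)" for i r
    by (simp_all only: coord_mult_left coord_mult_right coord_unit)
  show "?A = ?B"
  proof
    assume ?A then show ?B unfolding c[symmetric] by (simp add: coord_basis)
  next
    assume B: ?B show ?A
      by (rule allI, rule clinear_eqI[OF l(1,3)], rule coord_eqI) (simp only: c coord_basis B)
  qed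
  show "?A' = ?B'"
  proof
    assume ?A' then show ?B' unfolding c[symmetric] by (simp add: coord_basis)
  next
    assume B: ?B' show ?A'
      by (rule allI, rule clinear_eqI[OF l(2,3)], rule coord_eqI) (simp only: c coord_basis B)
  qed
qed

lemma assoc_iff:
  "(\<forall>x y z. mult B (mult B (x \<otimes> y) \<otimes> z) = mult B (x \<otimes> mult B (y \<otimes> z))) \<longleftrightarrow>
    (\<forall>i j k r. (\<Sum>l\<in>UNIV. M i j l * M l k r) = (\<Sum>l\<in>UNIV. M j k l * M i l r))" (is "?A = ?B")
proof -
  have c: "\<beta> r (mult B (mult B (b i \<otimes> b j) \<otimes> b k)) = (\<Sum>l\<in>UNIV. M i j l * M l k r)"
    "\<beta> r (mult B (b i \<otimes> mult B (b j \<otimes> b k))) = (\<Sum>l\<in>UNIV. M j k l * M i l r)" for i j k r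
    by (simp_all only: coord_mult_right[of _ "mult B _"] coord_mult_left[of _ _ "mult B _"]
        coord_mult_basis)
  show ?thesis
  proof
    assume ?A then show ?B unfolding c[symmetric] by simp
  next
    assume B: ?B
    have "mult B (mult B (x \<otimes> y) \<otimes> z) = mult B (x \<otimes> mult B (y \<otimes> z))" for x y z
      by (rule trilinear_eqI[of "\<lambda>x y z. mult B (mult B (x \<otimes> y) \<otimes> z)"
            "\<lambda>x y z. mult B (x \<otimes> mult B (y \<otimes> z))"])
        ((rule clinearI; simp add: lin_simps tens_simps)+, rule coord_eqI, simp add: c B)
    then show ?A by blast
  qed
qed

lemma coassoc_iff:
  "(\<forall>x. tensor_assoc (tensor_map (comult B) id (comult B x)) =
      tensor_map id (comult B) (comult B x)) \<longleftrightarrow>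
    (\<forall>r i j k. (\<Sum>l\<in>UNIV. D r l k * D l i j) = (\<Sum>l\<in>UNIV. D r i l * D l j k))" (is "?A = ?B")
proof -
  note c = coord_map_comult_id coord_map_id_comult coord_comult_basis
  have l: "clinear (\<lambda>x. tensor_assoc (tensor_map (comult B) id (comult B x)))"
    "clinear (\<lambda>x. tensor_map id (comult B) (comult B x))"
    by (rule clinearI; simp add: lin_simps tensor_op_simps)+
  show ?thesis
  proof
    assume A: ?A
    then have "\<beta>3 (i, j, k) (tensor_assoc (tensor_map (comult B) id (comult B (b r)))) =
      \<beta>3 (i, j, k) (tensor_map id (comult B) (comult B (b r)))" for i j k r by simp
    then show ?B by (simp only: c) simp
  next
    assume B: ?B
    have "\<beta>3 p (tensor_assoc (tensor_map (comult B) id (comult B (b r)))) =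
      \<beta>3 p (tensor_map id (comult B) (comult B (b r)))" for p r
      by (cases p) (simp only: c B)
    then show ?A by (intro allI) (rule clinear_eqI[OF l], rule t3.coord_eqI)
  qed
qed

lemma counit_law_iff:
  "(\<forall>x. tensor_lift (\<lambda>a b. counit B a *\<^sub>C b) (comult B x) = x) \<longleftrightarrow>
    (\<forall>i r. (\<Sum>l\<in>UNIV. E l * D i l r) = (if r = i then 1 else 0))" (is "?A = ?B")
  "(\<forall>x. tensor_lift (\<lambda>a b. counit B b *\<^sub>C a) (comult B x) = x) \<longleftrightarrow>
    (\<forall>i r. (\<Sum>l\<in>UNIV. E l * D i r l) = (if r = i then 1 else 0))" (is "?A' = ?B'")
proof -
  note c = coord_counit_left coord_counit_right coord_comult_basis
  have l: "clinear (\<lambda>x. tensor_lift (\<lambda>a b. counit B a *\<^sub>C b) (comult B x))"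
    "clinear (\<lambda>x. tensor_lift (\<lambda>a b. counit B b *\<^sub>C a) (comult B x))" "clinear (\<lambda>x::'v. x)"
    by (rule clinearI; simp add: lin_simps tensor_op_simps)+
  show "?A = ?B"
  proof
    assume ?A
    then have "\<beta> r (tensor_lift (\<lambda>a b. counit B a *\<^sub>C b) (comult B (b i))) = \<beta> r (b i)" for i r by simp
    then show ?B by (simp only: c coord_basis) simp
  next
    assume B: ?B show ?A
      by (rule allI, rule clinear_eqI[OF l(1,3)], rule coord_eqI) (simp only: c coord_basis B)
  qed
  show "?A' = ?B'"
  proof
    assume ?A'
    then have "\<beta> r (tensor_lift (\<lambda>a b. counit B b *\<^sub>C a) (comult B (b i))) = \<beta> r (b i)" for i r by simp
    then show ?B' by (simp only: c coord_basis) simp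
  next
    assume B: ?B' show ?A'
      by (rule allI, rule clinear_eqI[OF l(2,3)], rule coord_eqI) (simp only: c coord_basis B)
  qed
qed

lemma comult_mult_iff:
  "(\<forall>x y. comult B (mult B (x \<otimes> y)) = tensor_mult (mult B) (mult B) (comult B x \<otimes> comult B y)) \<longleftrightarrow>
    (\<forall>i j r s. (\<Sum>l\<in>UNIV. M i j l * D l r s) =
       (\<Sum>a\<in>UNIV. \<Sum>b\<in>UNIV. \<Sum>c\<in>UNIV. \<Sum>d\<in>UNIV. D i a b * D j c d * M a c r * M b d s))"
  (is "?A = ?B")
proof -
  have c: "\<beta>2 (r, s) (comult B (mult B (b i \<otimes> b j))) = (\<Sum>l\<in>UNIV. M i j l * D l r s)" for i j r s
    by (simp only: coord_comult[of _ _ "mult B _"] coord_mult_basis)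
  note c = c coord_tensor_mult coord_comult_basis
  show ?thesis
  proof
    assume A: ?A
    then have "\<beta>2 (r, s) (comult B (mult B (b i \<otimes> b j))) =
      \<beta>2 (r, s) (tensor_mult (mult B) (mult B) (comult B (b i) \<otimes> comult B (b j)))" for i j r s by simp
    then show ?B by (simp only: c) simp
  next
    assume B: ?B
    have bas: "\<beta>2 p (comult B (mult B (b i \<otimes> b j))) =
      \<beta>2 p (tensor_mult (mult B) (mult B) (comult B (b i) \<otimes> comult B (b j)))" for p i j
      by (cases p) (simp only: c B)
    have "comult B (mult B (x \<otimes> y)) = tensor_mult (mult B) (mult B) (comult B x \<otimes> comult B y)" for x y
      by (rule bilinear_eqI[of "\<lambda>x y. comult B (mult B (x \<otimes> y))"
            "\<lambda>x y. tensor_mult (mult B) (mult B) (comult B x \<otimes> comult B y)"])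
        ((rule clinearI; simp add: lin_simps tensor_op_simps)+, rule t2.coord_eqI, rule bas)
    then show ?A by blast
  qed
qed

lemma comult_unit_iff:
  assumes unit: "\<And>i r. (\<Sum>l\<in>UNIV. U l * M l i r) = (if r = i then 1 else 0)"
    "\<And>i r. (\<Sum>l\<in>UNIV. U l * M i l r) = (if r = i then 1 else 0)"
  shows "tensor_assoc (tensor_map (comult B) id (comult B (unit B 1))) =
      tensor_mult (mult B) (tensor_mult (mult B) (mult B))
        (tensor_assoc (comult B (unit B 1) \<otimes> unit B 1) \<otimes> (unit B 1 \<otimes> comult B (unit B 1))) \<longleftrightarrow>
    (\<forall>i j k. (\<Sum>l\<in>UNIV. unit_comult l k * D l i j) =
       (\<Sum>a\<in>UNIV. \<Sum>b\<in>UNIV. unit_comult i a * unit_comult b k * M a b j))" (is "?A = ?B")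
  and "tensor_assoc (tensor_map (comult B) id (comult B (unit B 1))) =
      tensor_mult (mult B) (tensor_mult (mult B) (mult B))
        ((unit B 1 \<otimes> comult B (unit B 1)) \<otimes> tensor_assoc (comult B (unit B 1) \<otimes> unit B 1)) \<longleftrightarrow>
    (\<forall>i j k. (\<Sum>l\<in>UNIV. unit_comult l k * D l i j) =
       (\<Sum>a\<in>UNIV. \<Sum>b\<in>UNIV. unit_comult i a * unit_comult b k * M b a j))" (is "?A' = ?B'")
proof -
  have eq: "u = v \<longleftrightarrow> (\<forall>i j k. \<beta>3 (i, j, k) u = \<beta>3 (i, j, k) v)" for u v
    by (auto intro!: t3.coord_eqI)
  show "?A = ?B" "?A' = ?B'"
    by (simp_all only: eq unit_comult_products[OF unit] coord_map_comult_id coord_comult_unit)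
qed

lemma counit_mult_iff:
  "(\<forall>x y z. counit B (mult B (mult B (x \<otimes> y) \<otimes> z)) =
      tensor_lift (\<lambda>a b. counit B (mult B (x \<otimes> a)) * counit B (mult B (b \<otimes> z))) (comult B y)) \<longleftrightarrow>
    (\<forall>i j k. (\<Sum>l\<in>UNIV. M i j l * (\<Sum>r\<in>UNIV. M l k r * E r)) =
       (\<Sum>a\<in>UNIV. \<Sum>b\<in>UNIV. D j a b * (\<Sum>r\<in>UNIV. M i a r * E r) * (\<Sum>s\<in>UNIV. M b k s * E s)))"
  (is "?A = ?B")
proof -
  have l: "clinear (\<lambda>u. counit B (mult B (u \<otimes> b k)))" for k
    by (rule clinearI; simp add: lin_simps tens_simps)
  have c1: "counit B (mult B (mult B (b i \<otimes> b j) \<otimes> b k)) =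
      (\<Sum>l\<in>UNIV. M i j l * (\<Sum>r\<in>UNIV. M l k r * E r))" for i j k
    by (subst clinear_coord_expand[OF l])
      (simp only: coord_mult_basis counit_mult_basis scaleC_complex_def)
  have c2: "tensor_lift (\<lambda>u v. counit B (mult B (b i \<otimes> u)) * counit B (mult B (v \<otimes> b k))) (comult B (b j)) =
      (\<Sum>a\<in>UNIV. \<Sum>b\<in>UNIV. D j a b * (\<Sum>r\<in>UNIV. M i a r * E r) * (\<Sum>s\<in>UNIV. M b k s * E s))" for i j k
    by (simp only: counit_mult_lift coord_comult_basis counit_mult_basis)
  show ?thesis
  proof
    assume A: ?A
    then show ?B unfolding c1[symmetric] c2[symmetric] by simp
  next
    assume B: ?B
    have bas: "counit B (mult B (mult B (b i \<otimes> b j) \<otimes> b k)) =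
      tensor_lift (\<lambda>u v. counit B (mult B (b i \<otimes> u)) * counit B (mult B (v \<otimes> b k))) (comult B (b j))"
      for i j k by (simp only: c1 c2 B)
    let ?g = "\<lambda>x y z. \<Sum>a\<in>UNIV. \<Sum>c\<in>UNIV. \<beta>2 (a, c) (comult B y) *
      counit B (mult B (x \<otimes> b a)) * counit B (mult B (b c \<otimes> z))"
    have "counit B (mult B (mult B (x \<otimes> y) \<otimes> z)) = ?g x y z" for x y z
    proof (rule trilinear_eqI[of "\<lambda>x y z. counit B (mult B (mult B (x \<otimes> y) \<otimes> z))" ?g])
      show "counit B (mult B (mult B (b i \<otimes> b j) \<otimes> b k)) = ?g (b i) (b j) (b k)" for i j k
        using bas[of i j k] by (simp only: counit_mult_lift)
    qed (rule clinearI; simp add: lin_simps tens_simps \<beta>_simps scaleC_complex_def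
          sum.distrib sum_distrib_left algebra_simps)+
    then have "counit B (mult B (mult B (x \<otimes> y) \<otimes> z)) =
      tensor_lift (\<lambda>u v. counit B (mult B (x \<otimes> u)) * counit B (mult B (v \<otimes> z))) (comult B y)" for x y z
      by (simp only: counit_mult_lift)
    then show ?A by blast
  qed
qed

theorem weak_bialgebra_iff: "weak_bialgebra B \<longleftrightarrow> structure_equations M U D E"
proof
  assume "weak_bialgebra B"
  then interpret weak_bialgebra B .
  have u: "(\<Sum>l\<in>UNIV. U l * M l i r) = (if r = i then 1 else 0)"
    "(\<Sum>l\<in>UNIV. U l * M i l r) = (if r = i then 1 else 0)" for i r
    using unit_law_iff unit_left unit_right by blast+
  show "structure_equations M U D E"
    unfolding structure_equations_def Let_def tensor_product_coeff_def
    apply (intro conjI)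
    subgoal by (rule iffD1[OF assoc_iff]) (intro allI mult_assoc)
    subgoal by (intro allI u)
    subgoal by (intro allI u)
    subgoal by (rule iffD1[OF coassoc_iff]) (intro allI comult_coassoc)
    subgoal by (rule iffD1[OF counit_law_iff(1)]) (intro allI counit_left)
    subgoal by (rule iffD1[OF counit_law_iff(2)]) (intro allI counit_right)
    subgoal by (rule iffD1[OF comult_mult_iff]) (intro allI comult_mult)
    subgoal by (rule iffD1[OF comult_unit_iff(1)[OF u] comult_unit(1)])
    subgoal by (rule iffD1[OF comult_unit_iff(2)[OF u] comult_unit(2)])
    subgoal by (rule iffD1[OF counit_mult_iff]) (intro allI counit_mult)
    done
next
  assume "structure_equations M U D E"
  note s = this[unfolded structure_equations_def Let_def tensor_product_coeff_def]
  note s2 = conjunct2[OF s]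
  note s3 = conjunct2[OF s2]
  note s4 = conjunct2[OF s3]
  note s5 = conjunct2[OF s4]
  note s6 = conjunct2[OF s5]
  note s7 = conjunct2[OF s6]
  note s8 = conjunct2[OF s7]
  note u = conjunct1[OF s2, rule_format] conjunct1[OF s3, rule_format]
  have laws:
    "\<forall>x y z. mult B (mult B (x \<otimes> y) \<otimes> z) = mult B (x \<otimes> mult B (y \<otimes> z))"
    "\<forall>x. mult B (unit B 1 \<otimes> x) = x" "\<forall>x. mult B (x \<otimes> unit B 1) = x"
    "\<forall>x. tensor_assoc (tensor_map (comult B) id (comult B x)) = tensor_map id (comult B) (comult B x)"
    "\<forall>x. tensor_lift (\<lambda>a b. counit B a *\<^sub>C b) (comult B x) = x"
    "\<forall>x. tensor_lift (\<lambda>a b. counit B b *\<^sub>C a) (comult B x) = x"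
    "\<forall>x y. comult B (mult B (x \<otimes> y)) = tensor_mult (mult B) (mult B) (comult B x \<otimes> comult B y)"
    "\<forall>x y z. counit B (mult B (mult B (x \<otimes> y) \<otimes> z)) =
      tensor_lift (\<lambda>a b. counit B (mult B (x \<otimes> a)) * counit B (mult B (b \<otimes> z))) (comult B y)"
    by (rule iffD2[OF assoc_iff conjunct1[OF s]] iffD2[OF unit_law_iff(1) conjunct1[OF s2]]
        iffD2[OF unit_law_iff(2) conjunct1[OF s3]] iffD2[OF coassoc_iff conjunct1[OF s4]]
        iffD2[OF counit_law_iff(1) conjunct1[OF s5]] iffD2[OF counit_law_iff(2) conjunct1[OF s6]]
        iffD2[OF comult_mult_iff conjunct1[OF s7]] iffD2[OF counit_mult_iff conjunct2[OF s8]])+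
  show "weak_bialgebra B"
    by (rule weak_bialgebra.intro[OF lin_mult lin_unit lin_comult lin_counit];
        (rule laws[rule_format] iffD2[OF comult_unit_iff(1)[OF u] conjunct1[OF conjunct1[OF s8]]]
          iffD2[OF comult_unit_iff(2)[OF u] conjunct2[OF conjunct1[OF s8]]]))
qed

end

section \<open>Isomorphism by equal structure constants\<close>

text \<open>
  The linear map that carries one basis to the other respects the operations on basis vectors, hence
  everywhere.
\<close>
lemma (in linear_data) isomorphic_if_same_constants:
  assumes "linear_data c \<gamma> C M D U' E"
  shows "bialg_isomorphic B C"
proof -
  interpret C: linear_data c \<gamma> C M D U' E by fact
  define f where "f x = (\<Sum>i\<in>UNIV. \<beta> i x *\<^sub>C c i)" for x
  define g where "g y = (\<Sum>i\<in>UNIV. \<gamma> i y *\<^sub>C b i)" for y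
  have f: "clinear f"
    by (rule clinearI) (simp_all only: f_def \<beta>_simps scaleC_add_left sum.distrib
        scaleC_complex_def cvec.scale_sum_right scaleC_scaleC)
  have g: "clinear g"
    by (rule clinearI) (simp_all only: g_def C.\<beta>_simps scaleC_add_left sum.distrib
        scaleC_complex_def cvec.scale_sum_right scaleC_scaleC)
  have delta: "(\<Sum>i\<in>UNIV. (if i = j then 1 else 0) *\<^sub>C h i) = h j"
    for j and h :: "'n::finite \<Rightarrow> 'w::complex_vector"
  proof -
    have "(\<Sum>i\<in>UNIV. (if i = j then 1 else 0) *\<^sub>C h i) = (\<Sum>i\<in>UNIV. if i = j then h i else 0)"
      by (rule sum.cong) (auto simp: scaleC_one)
    also have "\<dots> = h j" by simp
    finally show ?thesis .
  qed
  have fb: "f (b i) = c i" and gc: "g (c i) = b i" for i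
    by (simp_all only: f_def g_def coord_basis C.coord_basis delta)
  have "g (f x) = x" for x
    by (rule clinear_eqI[OF clinear_compose[OF g f] clinear_id[unfolded id_def]])
      (simp only: fb gc)
  moreover have "f (g y) = y" for y
    by (rule C.clinear_eqI[OF clinear_compose[OF f g] clinear_id[unfolded id_def]])
      (simp only: fb gc)
  ultimately have "bij f"
    by (intro bij_betw_byWitness[of UNIV g f UNIV]) auto
  moreover have "f (mult B t) = mult C (tensor_map f f t)" for t
  proof (rule t2.clinear_eqI)
    show "clinear (\<lambda>t. f (mult B t))" "clinear (\<lambda>t. mult C (tensor_map f f t))"
      by (rule clinear_compose[OF f lin_mult], rule clinear_compose[OF C.lin_mult clinear_tensor_map])
    show "f (mult B (case p of (i, j) \<Rightarrow> b i \<otimes> b j)) =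
      mult C (tensor_map f f (case p of (i, j) \<Rightarrow> b i \<otimes> b j))" for p
      by (cases p)
        (simp only: prod.case tensor_map_tens[OF f f] fb mult_basis C.mult_basis clinearD[OF f])
  qed
  moreover have "tensor_map f f (comult B x) = comult C (f x)" for x
  proof (rule clinear_eqI)
    show "clinear (\<lambda>x. tensor_map f f (comult B x))" "clinear (\<lambda>x. comult C (f x))"
      by (rule clinear_compose[OF clinear_tensor_map lin_comult], rule clinear_compose[OF C.lin_comult f])
    show "tensor_map f f (comult B (b i)) = comult C (f (b i))" for i
      by (simp only: fb comult_basis C.comult_basis clinearD[OF clinear_tensor_map]
          tensor_map_tens[OF f f])
  qed
  moreover have "counit B x = counit C (f x)" for x
    by (rule clinear_eqI[OF lin_counit clinear_compose[OF C.lin_counit f]])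
      (simp only: fb counit_basis C.counit_basis)
  ultimately show ?thesis unfolding bialg_isomorphic_def using f by blast
qed

text \<open>
  Relabelling a basis permutes the structure constants. This justifies normalising the position of
  distinguished basis vectors.
\<close>
lemma coordinates_relabel:
  assumes "coordinates b \<beta>" "bij \<pi>"
  shows "coordinates (b \<circ> \<pi>) (\<beta> \<circ> \<pi>)"
proof -
  interpret coordinates b \<beta> by fact
  show ?thesis
  proof (rule coordinates.intro)
    show "clinear ((\<beta> \<circ> \<pi>) i)" for i by (simp add: linear_coord)
    show "(\<beta> \<circ> \<pi>) i ((b \<circ> \<pi>) j) = (if i = j then 1 else 0)" for i j
      using assms(2) by (simp add: coord_basis bij_def inj_eq)
    show "(\<Sum>i\<in>UNIV. (\<beta> \<circ> \<pi>) i x *\<^sub>C (b \<circ> \<pi>) i) = x" for x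
      using sum.reindex_bij_betw[of \<pi> UNIV UNIV "\<lambda>i. \<beta> i x *\<^sub>C b i"] assms(2)
      by (simp only: o_apply expand)
  qed
qed

lemma (in linear_data) relabel:
  assumes "bij \<pi>"
  shows "linear_data (b \<circ> \<pi>) (\<beta> \<circ> \<pi>) B (\<lambda>i j k. M (\<pi> i) (\<pi> j) (\<pi> k))
    (\<lambda>k i j. D (\<pi> k) (\<pi> i) (\<pi> j)) (U \<circ> \<pi>) (E \<circ> \<pi>)"
proof -
  have re: "(\<Sum>k\<in>UNIV. h (\<pi> k)) = (\<Sum>k\<in>UNIV. h k)" for h :: "_ \<Rightarrow> 'd::comm_monoid_add"
    using sum.reindex_bij_betw[of \<pi> UNIV UNIV h] assms by simp
  have re2: "(\<Sum>i\<in>UNIV. \<Sum>j\<in>UNIV. h (\<pi> i) (\<pi> j)) = (\<Sum>i\<in>UNIV. \<Sum>j\<in>UNIV. h i j)"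
    for h :: "_ \<Rightarrow> _ \<Rightarrow> 'd::comm_monoid_add"
  proof -
    have "(\<Sum>i\<in>UNIV. \<Sum>j\<in>UNIV. h (\<pi> i) (\<pi> j)) = (\<Sum>i\<in>UNIV. \<Sum>j\<in>UNIV. h (\<pi> i) j)"
      by (rule sum.cong[OF refl]) (rule re)
    also have "\<dots> = (\<Sum>i\<in>UNIV. \<Sum>j\<in>UNIV. h i j)" by (rule re)
    finally show ?thesis .
  qed
  show ?thesis
  proof (intro linear_data.intro linear_data_axioms.intro)
    show "coordinates (b \<circ> \<pi>) (\<beta> \<circ> \<pi>)"
      by (rule coordinates_relabel[OF _ assms]) unfold_locales
    show "mult B ((b \<circ> \<pi>) i \<otimes> (b \<circ> \<pi>) j) = (\<Sum>k\<in>UNIV. M (\<pi> i) (\<pi> j) (\<pi> k) *\<^sub>C (b \<circ> \<pi>) k)" for i j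
      using re[of "\<lambda>k. M (\<pi> i) (\<pi> j) k *\<^sub>C b k"] by (simp only: o_apply mult_basis)
    show "unit B 1 = (\<Sum>k\<in>UNIV. (U \<circ> \<pi>) k *\<^sub>C (b \<circ> \<pi>) k)"
      using re[of "\<lambda>k. U k *\<^sub>C b k"] by (simp only: o_apply unit_basis)
    show "comult B ((b \<circ> \<pi>) k) =
      (\<Sum>i\<in>UNIV. \<Sum>j\<in>UNIV. D (\<pi> k) (\<pi> i) (\<pi> j) *\<^sub>C ((b \<circ> \<pi>) i \<otimes> (b \<circ> \<pi>) j))" for k
      using re2[of "\<lambda>i j. D (\<pi> k) i j *\<^sub>C (b i \<otimes> b j)"] by (simp only: o_apply comult_basis)
    show "counit B ((b \<circ> \<pi>) k) = (E \<circ> \<pi>) k" for k by (simp add: counit_basis)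
  qed (rule lin_mult lin_unit lin_comult lin_counit)+
qed

lemma (in weak_bialgebra) structure_constants:
  assumes "coordinates b \<beta>"
    and "\<And>i j. mult B (b i \<otimes> b j) = (\<Sum>k\<in>UNIV. M i j k *\<^sub>C b k)"
    and "unit B 1 = (\<Sum>k\<in>UNIV. U k *\<^sub>C b k)"
  obtains D E where "linear_data b \<beta> B M D U E" "structure_equations M U D E"
proof -
  interpret coordinates b \<beta> by fact
  interpret t2: coordinates "\<lambda>(i, j). b i \<otimes> b j" "tensor_coord \<beta> \<beta>"
    by (rule coordinates_tensor) (rule assms)+
  have "comult B (b k) = (\<Sum>i\<in>UNIV. \<Sum>j\<in>UNIV. tensor_coord \<beta> \<beta> (i, j) (comult B (b k)) *\<^sub>C (b i \<otimes> b j))"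
    for k
  proof -
    have "comult B (b k) = (\<Sum>p\<in>UNIV. tensor_coord \<beta> \<beta> p (comult B (b k)) *\<^sub>C (case p of (i, j) \<Rightarrow> b i \<otimes> b j))"
      by (rule t2.expand[symmetric])
    also have "\<dots> = (\<Sum>i\<in>UNIV. \<Sum>j\<in>UNIV. tensor_coord \<beta> \<beta> (i, j) (comult B (b k)) *\<^sub>C (b i \<otimes> b j))"
      unfolding UNIV_Times_UNIV[symmetric] sum.cartesian_product by (rule sum.cong) auto
    finally show ?thesis .
  qed
  then have ld: "linear_data b \<beta> B M (\<lambda>k i j. tensor_coord \<beta> \<beta> (i, j) (comult B (b k))) U (\<lambda>k. counit B (b k))"
    by (intro linear_data.intro linear_data_axioms.intro refl assms linear_mult linear_unit
        linear_comult linear_counit)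
  with that show ?thesis using linear_data.weak_bialgebra_iff[OF ld] weak_bialgebra_axioms by blast
qed

definition tri :: "'a \<Rightarrow> 'a \<Rightarrow> 'a \<Rightarrow> 3 \<Rightarrow> 'a" where
  "tri x y z i = (if i = 1 then x else if i = 2 then y else z)"

lemma tri_simps [simp]: "tri x y z 1 = x" "tri x y z 2 = y" "tri x y z 3 = z"
  by (simp_all add: tri_def)

lemma coordinates_of_independent:
  fixes x y z :: "'v::complex_vector"
  assumes dim: "cvec.dim (UNIV :: 'v set) = 3"
    and indep: "\<And>k l m. k *\<^sub>C x + l *\<^sub>C y + m *\<^sub>C z = 0 \<Longrightarrow> k = 0 \<and> l = 0 \<and> m = 0"
  obtains \<beta> where "coordinates (tri x y z) \<beta>"
proof -
  have ne: "x \<noteq> y" "x \<noteq> z" "y \<noteq> z"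
  proof -
    show "x \<noteq> y" using indep[of 1 "-1" 0] by (auto simp: scaleC_one cvec.scale_zero_left cvec.scale_minus_left)
    show "x \<noteq> z" using indep[of 1 0 "-1"] by (auto simp: scaleC_one cvec.scale_zero_left cvec.scale_minus_left)
    show "y \<noteq> z" using indep[of 0 1 "-1"] by (auto simp: scaleC_one cvec.scale_zero_left cvec.scale_minus_left)
  qed
  define b where "b = tri x y z"
  have inj: "inj b"
  proof -
    have "\<forall>i j. b i = b j \<longrightarrow> i = j"
      by (simp add: forall_3 b_def ne ne[symmetric])
    then show ?thesis by (simp add: inj_def)
  qed
  have range: "range b = {x, y, z}"
    by (simp add: b_def UNIV_3)
  have ind: "cvec.independent {x, y, z}"
  proof (rule cvec.independent_if_scalars_zero)
    show "finite {x, y, z}" by simp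
    fix f u assume "(\<Sum>v\<in>{x, y, z}. f v *\<^sub>C v) = 0" "u \<in> {x, y, z}"
    moreover have "(\<Sum>v\<in>{x, y, z}. f v *\<^sub>C v) = f x *\<^sub>C x + f y *\<^sub>C y + f z *\<^sub>C z"
      using ne by (simp add: add.assoc)
    ultimately show "f u = 0" using indep[of "f x" "f y" "f z"] by auto
  qed
  have span: "cvec.span {x, y, z} = UNIV"
  proof (rule ccontr)
    assume "cvec.span {x, y, z} \<noteq> UNIV"
    then obtain w where w: "w \<notin> cvec.span {x, y, z}" by blast
    have iw: "cvec.independent (insert w {x, y, z})"
      by (rule cvec.independent_insertI[OF w ind])
    have "w \<notin> {x, y, z}" using w cvec.span_superset[of "{x, y, z}"] by blast
    then have card: "card (insert w {x, y, z}) = 4" using ne by simp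
    obtain S :: "'v set" where S: "S \<subseteq> UNIV" "cvec.independent S" "UNIV \<subseteq> cvec.span S"
      "card S = cvec.dim (UNIV :: 'v set)"
      using cvec.basis_exists[of "UNIV :: 'v set"] .
    then have "finite S" using card_ge_0_finite[of S] dim by simp
    moreover have "insert w {x, y, z} \<subseteq> cvec.span S" using S(3) by (rule subset_trans[OF subset_UNIV])
    ultimately have "card (insert w {x, y, z}) \<le> card S"
      by (intro conjunct2[OF cvec.independent_span_bound[OF _ iw]])
    then show False using card S(4) dim by simp
  qed
  define \<beta> where "\<beta> i v = cvec.representation {x, y, z} v (b i)" for i v
  have "coordinates b \<beta>"
  proof (rule coordinates.intro)
    show "clinear (\<beta> i)" for i
      unfolding \<beta>_def
      by (rule clinearI)
        (simp_all add: cvec.representation_add[OF ind] cvec.representation_scale[OF ind] span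
          scaleC_complex_def)
    show "\<beta> i (b j) = (if i = j then 1 else 0)" for i j
    proof -
      have "b j \<in> {x, y, z}" unfolding range[symmetric] by (rule rangeI)
      then show ?thesis using inj by (simp add: \<beta>_def cvec.representation_basis[OF ind] inj_eq)
    qed
    show "(\<Sum>i\<in>UNIV. \<beta> i v *\<^sub>C b i) = v" for v
    proof -
      have "(\<Sum>i\<in>UNIV. \<beta> i v *\<^sub>C b i) = (\<Sum>u\<in>range b. cvec.representation {x, y, z} v u *\<^sub>C u)"
        by (simp add: sum.reindex[OF inj] \<beta>_def)
      also have "\<dots> = v"
        unfolding range by (rule cvec.sum_representation_eq[OF ind]) (auto simp: span)
      finally show ?thesis .
    qed
  qed
  then show thesis using that by (simp add: b_def)
qed

lemma coordinates_axis: "coordinates (\<lambda>i. axis i 1 :: complex ^ 'n::finite) (\<lambda>i x. x $ i)"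
proof (rule coordinates.intro)
  show "clinear (\<lambda>x. x $ i)" for i :: 'n by (rule clinearI) (simp_all add: scaleC_vec_def)
  show "(axis j 1 :: complex ^ 'n) $ i = (if i = j then 1 else 0)" for i j by (auto simp: axis_def)
  show "(\<Sum>i\<in>UNIV. x $ i *\<^sub>C axis i 1) = x" for x :: "complex ^ 'n"
    by (simp add: vec_eq_iff scaleC_vec_def scaleC_complex_def axis_def delta_mult)
qed

text \<open>
  Standard coordinates on \<open>\<complex>\<^sup>3 \<otimes> \<complex>\<^sup>3\<close>, which make the equality of two explicit tensors a finite
  computation.
\<close>
definition std2 :: "3 \<Rightarrow> 3 \<Rightarrow> (complex ^ 3, complex ^ 3) tensor \<Rightarrow> complex" where
  "std2 i j = tensor_coord (\<lambda>i x. x $ i) (\<lambda>i x. x $ i) (i, j)"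

lemma std2_tens: "std2 i j (x \<otimes> y) = x $ i * y $ j"
proof -
  interpret coordinates "\<lambda>i. axis i 1 :: complex ^ 3" "\<lambda>i x. x $ i" by (rule coordinates_axis)
  show ?thesis unfolding std2_def by (rule tensor_coord_tens[OF linear_coord linear_coord])
qed

lemma std2_simps:
  "std2 i j (s + t) = std2 i j s + std2 i j t" "std2 i j (s - t) = std2 i j s - std2 i j t"
  "std2 i j (c *\<^sub>C t) = c * std2 i j t" "std2 i j 0 = 0"
  unfolding std2_def by (simp_all add: clinearD[OF clinear_tensor_coord] scaleC_complex_def)

lemma tensor_eq_iff_std2: "s = t \<longleftrightarrow> (\<forall>i j. std2 i j s = std2 i j t)"
proof -
  interpret coordinates "\<lambda>p. case p of (i, j) \<Rightarrow> (axis i 1 :: complex ^ 3) \<otimes> (axis j 1 :: complex ^ 3)"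
    "tensor_coord (\<lambda>i x. x $ i) (\<lambda>i x. x $ i)"
    by (rule coordinates_tensor) (rule coordinates_axis)+
  show ?thesis unfolding std2_def by (auto intro!: coord_eqI)
qed

lemma scaleC_nth [simp]: "(k *\<^sub>C x) $ i = k * x $ i" for x :: "complex ^ 'n::finite"
  by (simp add: scaleC_vec_def scaleC_complex_def)

lemma clinear_lin3: "clinear (lin3 x y z)"
  by (rule clinearI)
    (simp_all add: lin3_def scaleC_add_left scaleC_add_right scaleC_scaleC add_ac)

lemma table_mult_tens:
  "table_mult p q r (x \<otimes> y) = lin3 (lin3 e1 e2 e3 y) (lin3 e2 e2 p y) (lin3 e3 q r y) x"
proof -
  have "clinear (\<lambda>y. lin3 (lin3 e1 e2 e3 y) (lin3 e2 e2 p y) (lin3 e3 q r y) x)" for x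
    by (rule clinearI; simp only: clinearD[OF clinear_lin3])
      (simp_all only: lin3_def scaleC_add_right scaleC_scaleC mult_ac add_ac)
  then have "cbilinear (\<lambda>x y. lin3 (lin3 e1 e2 e3 y) (lin3 e2 e2 p y) (lin3 e3 q r y) x)"
    by (simp add: cbilinear_def clinear_lin3)
  then show ?thesis
    unfolding table_mult_def by (rule tensor_lift_tens)
qed

text \<open>
  The entries of the classification are presented in the standard basis, but their structure constants are much sparser
  in a basis adapted to the algebra; this lemma transfers an entry to any basis \<open>c\<close>.
\<close>
lemma linear_data_bialg:
  fixes c :: "3 \<Rightarrow> complex ^ 3"
  assumes c: "coordinates c \<gamma>"
    and "\<And>i j. table_mult p q r (c i \<otimes> c j) = (\<Sum>k\<in>UNIV. M i j k *\<^sub>C c k)"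
    and "e1 = (\<Sum>k\<in>UNIV. U k *\<^sub>C c k)"
    and comult: "\<And>k i j. std2 i j (lin3 d1 d2 d3 (c k)) =
      (\<Sum>l\<in>UNIV. \<Sum>m\<in>UNIV. D k l m * (c l $ i * c m $ j))"
    and "\<And>k. lin3 c1 c2 c3 (c k) = E k"
  shows "linear_data c \<gamma> (bialg (table_mult p q r) d1 d2 d3 c1 c2 c3) M D U E"
proof (intro linear_data.intro linear_data_axioms.intro)
  show "coordinates c \<gamma>" by fact
  have "lin3 d1 d2 d3 (c k) = (\<Sum>l\<in>UNIV. \<Sum>m\<in>UNIV. D k l m *\<^sub>C (c l \<otimes> c m))" for k
    by (simp add: tensor_eq_iff_std2 comult sum_3 std2_simps std2_tens)
  then show "comult (bialg (table_mult p q r) d1 d2 d3 c1 c2 c3) (c k) =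
      (\<Sum>l\<in>UNIV. \<Sum>m\<in>UNIV. D k l m *\<^sub>C (c l \<otimes> c m))" for k
    by (simp add: bialg_def)
  show "clinear (unit (bialg (table_mult p q r) d1 d2 d3 c1 c2 c3))"
    by (rule clinearI) (simp_all add: bialg_def scaleC_add_left scaleC_complex_def scaleC_scaleC)
  show "clinear (mult (bialg (table_mult p q r) d1 d2 d3 c1 c2 c3))"
    by (simp add: bialg_def table_mult_def clinear_tensor_lift)
qed (simp_all add: bialg_def assms clinear_lin3 scaleC_one)

section \<open>Unital algebras of dimension three\<close>

text \<open>
  The multiplication tables of the possible algebras: orthogonal idempotents; then, with indices for
  \<open>p\<close>, \<open>q\<close>, \<open>n\<close>, the tables with \<open>q n = n q = n\<close> and with \<open>q n = n = n p\<close>; finally the local algebras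
  with basis \<open>1\<close>, \<open>x\<close>, \<open>y\<close> and only nontrivial product \<open>x x = \<kappa> y\<close>.
\<close>
definition idempotent_table :: "'n \<Rightarrow> 'n \<Rightarrow> 'n \<Rightarrow> complex" where
  "idempotent_table i j k = of_bool (i = j \<and> j = k)"

definition dual_table :: "3 \<Rightarrow> 3 \<Rightarrow> 3 \<Rightarrow> complex" where
  "dual_table i j k = (if (i, j, k) \<in> {(1,1,1), (2,2,2), (2,3,3), (3,2,3)} then 1 else 0)"

definition triangular_table :: "3 \<Rightarrow> 3 \<Rightarrow> 3 \<Rightarrow> complex" where
  "triangular_table i j k = (if (i, j, k) \<in> {(1,1,1), (2,2,2), (2,3,3), (3,1,3)} then 1 else 0)"

definition local_table :: "complex \<Rightarrow> 3 \<Rightarrow> 3 \<Rightarrow> 3 \<Rightarrow> complex" where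
  "local_table \<kappa> i j k = (if (i, j, k) = (2,2,3) then \<kappa>
     else if (i, j, k) \<in> {(1,1,1), (1,2,2), (2,1,2), (1,3,3), (3,1,3)} then 1 else 0)"

lemma scaleC_double: "(2 * a) *\<^sub>C x = a *\<^sub>C x + a *\<^sub>C x" "(a * 2) *\<^sub>C x = a *\<^sub>C x + a *\<^sub>C x"
  "(a * (b * 2)) *\<^sub>C x = (a * b) *\<^sub>C x + (a * b) *\<^sub>C x"
  by (simp_all only: mult_2 mult_2_right scaleC_add_left distrib_left)

locale algebra3 =
  fixes mul :: "'v::complex_vector \<Rightarrow> 'v \<Rightarrow> 'v" (infixl "\<cdot>" 75) and one :: 'v
  assumes bilinear: "cbilinear mul"
    and assoc: "(x \<cdot> y) \<cdot> z = x \<cdot> (y \<cdot> z)"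
    and one_left [simp]: "one \<cdot> x = x"
    and one_right [simp]: "x \<cdot> one = x"
    and dim: "cvec.dim (UNIV :: 'v set) = 3"
begin

definition has_table :: "(3 \<Rightarrow> 3 \<Rightarrow> 3 \<Rightarrow> complex) \<Rightarrow> (3 \<Rightarrow> complex) \<Rightarrow> bool" where
  "has_table M U \<longleftrightarrow> (\<exists>b \<beta>. coordinates b \<beta> \<and>
     (\<forall>i j. b i \<cdot> b j = (\<Sum>k\<in>UNIV. M i j k *\<^sub>C b k)) \<and> one = (\<Sum>k\<in>UNIV. U k *\<^sub>C b k))"

lemmas bil [simp] = cbilinearD[OF bilinear]

lemma linear_mul: "clinear (\<lambda>x. x \<cdot> y)" "clinear (\<lambda>y. x \<cdot> y)"
  using bilinear by (auto simp: cbilinear_def)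

lemma bil' [simp]: "0 \<cdot> x = 0" "x \<cdot> 0 = 0" "(x - y) \<cdot> z = x \<cdot> z - y \<cdot> z"
  "z \<cdot> (x - y) = z \<cdot> x - z \<cdot> y"
  using clinearD(3,5)[OF linear_mul(1)] clinearD(3,5)[OF linear_mul(2)] by blast+

lemma has_tableI:
  assumes indep: "\<And>k l m. k *\<^sub>C x + l *\<^sub>C y + m *\<^sub>C z = 0 \<Longrightarrow> k = 0 \<and> l = 0 \<and> m = 0"
    and "\<forall>i j. tri x y z i \<cdot> tri x y z j = M i j 1 *\<^sub>C x + M i j 2 *\<^sub>C y + M i j 3 *\<^sub>C z"
    and "one = U 1 *\<^sub>C x + U 2 *\<^sub>C y + U 3 *\<^sub>C z"
  shows "has_table M U"
proof -
  obtain \<beta> where "coordinates (tri x y z) \<beta>"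
    using coordinates_of_independent[OF dim indep] by blast
  moreover have "\<forall>i j. tri x y z i \<cdot> tri x y z j = (\<Sum>k\<in>UNIV. M i j k *\<^sub>C tri x y z k)"
    unfolding sum_3 tri_simps by (rule assms(2))
  moreover have "one = (\<Sum>k\<in>UNIV. U k *\<^sub>C tri x y z k)"
    unfolding sum_3 tri_simps by (rule assms(3))
  ultimately show ?thesis unfolding has_table_def by blast
qed

lemma outside_plane:
  fixes x y :: 'v
  obtains z where "\<And>k l. z \<noteq> k *\<^sub>C x + l *\<^sub>C y"
proof -
  have "\<not> UNIV \<subseteq> cvec.span {x, y}"
  proof
    assume "UNIV \<subseteq> cvec.span {x, y}"
    then have "cvec.dim (UNIV::'v set) \<le> card {x, y}" by (rule cvec.dim_le_card) simp
    also have "\<dots> \<le> 2" by (rule order_trans[OF card_insert_le_m1[of 2]]) auto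
    finally show False using dim by simp
  qed
  then obtain z where z: "z \<notin> cvec.span {x, y}" by blast
  have "z \<noteq> k *\<^sub>C x + l *\<^sub>C y" for k l
  proof
    assume "z = k *\<^sub>C x + l *\<^sub>C y"
    moreover have "k *\<^sub>C x + l *\<^sub>C y \<in> cvec.span {x, y}"
      by (intro cvec.span_add cvec.span_scale cvec.span_base) auto
    ultimately show False using z by simp
  qed
  then show thesis by (rule that)
qed

lemma independent_extend:
  fixes x y z :: 'v
  assumes z: "\<And>k l. z \<noteq> k *\<^sub>C x + l *\<^sub>C y"
    and xy: "\<And>k l. k *\<^sub>C x + l *\<^sub>C y = 0 \<Longrightarrow> k = 0 \<and> l = 0"
    and "k *\<^sub>C x + l *\<^sub>C y + m *\<^sub>C z = 0"
  shows "k = 0 \<and> l = 0 \<and> m = 0"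
proof -
  have "m = 0"
  proof (rule ccontr)
    assume m: "m \<noteq> 0"
    have "m *\<^sub>C z = - (k *\<^sub>C x + l *\<^sub>C y)" using assms(3) by (simp only: add_eq_0_iff)
    then have "(1 / m) *\<^sub>C (m *\<^sub>C z) = (1 / m) *\<^sub>C (- (k *\<^sub>C x + l *\<^sub>C y))" by simp
    then have "z = (1 / m) *\<^sub>C (- (k *\<^sub>C x + l *\<^sub>C y))" using m by (simp add: scaleC_scaleC scaleC_one)
    also have "\<dots> = (- k / m) *\<^sub>C x + (- l / m) *\<^sub>C y"
      by (simp add: scaleC_add_right scaleC_scaleC cvec.scale_right_diff_distrib)
    finally show False using z by blast
  qed
  then show ?thesis using xy[of k l] assms(3) by simp
qed

lemma one_neq_0: "one \<noteq> 0"
proof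
  assume "one = 0"
  then have "x = 0" for x :: 'v using one_left[of x] by (metis bil'(1))
  moreover obtain z :: 'v where "\<And>k l. z \<noteq> k *\<^sub>C 0 + l *\<^sub>C 0" using outside_plane by blast
  ultimately show False by metis
qed

end

locale idempotent_pair = algebra3 +
  fixes e f :: 'a
  assumes ee [simp]: "e \<cdot> e = e" and ff [simp]: "f \<cdot> f = f" and ef [simp]: "e \<cdot> f = 0" and fe [simp]: "f \<cdot> e = 0"
    and one: "e + f = one" and e0: "e \<noteq> 0" and f0: "f \<noteq> 0"
begin

lemma independent_ef: "k *\<^sub>C e + l *\<^sub>C f = 0 \<Longrightarrow> k = 0 \<and> l = 0"
proof -
  assume *: "k *\<^sub>C e + l *\<^sub>C f = 0"
  have "e \<cdot> (k *\<^sub>C e + l *\<^sub>C f) = k *\<^sub>C e" "f \<cdot> (k *\<^sub>C e + l *\<^sub>C f) = l *\<^sub>C f" by simp_all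
  then show ?thesis using e0 f0 unfolding * by simp
qed

lemma one_expand: "one = tri 1 1 0 1 *\<^sub>C f + tri 1 1 0 2 *\<^sub>C e + tri 1 1 0 3 *\<^sub>C w"
  by (simp only: tri_simps scaleC_one cvec.scale_zero_left add_0_right one[symmetric] add.commute[of e f])

text \<open>
  A vector \<open>w = e w f\<close> outside the span of \<open>e\<close> and \<open>f\<close> squares to \<open>w f e w = 0\<close>.
\<close>
lemma off_diagonal:
  assumes "e \<cdot> w = w" "w \<cdot> f = w" and w: "\<And>k l. w \<noteq> k *\<^sub>C e + l *\<^sub>C f"
  shows "has_table triangular_table (tri 1 1 0)"
proof (rule has_tableI)
  show "k = 0 \<and> l = 0 \<and> m = 0" if "k *\<^sub>C f + l *\<^sub>C e + m *\<^sub>C w = 0" for k l m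
    using independent_extend[OF w independent_ef, of l k m] that by (auto simp: add.commute)
  have "w \<cdot> e = (w \<cdot> f) \<cdot> e" "f \<cdot> w = f \<cdot> (e \<cdot> w)" "w \<cdot> w = (w \<cdot> f) \<cdot> (e \<cdot> w)" using assms by simp_all
  then have "w \<cdot> e = 0" "f \<cdot> w = 0" "w \<cdot> w = 0" using assms(1,2)
    by (simp_all only: assoc fe ef bil') (metis assoc fe bil')+
  then show "\<forall>i j. tri f e w i \<cdot> tri f e w j = triangular_table i j 1 *\<^sub>C f +
      triangular_table i j 2 *\<^sub>C e + triangular_table i j 3 *\<^sub>C w"
    using assms(1,2) by (simp add: forall_3 triangular_table_def scaleC_one)
qed (rule one_expand)

text \<open>
  A vector \<open>w = e w e\<close> outside the span satisfies a quadratic equation over the corner, with identity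
  \<open>e\<close>. Completing the square replaces it by \<open>v\<close> with \<open>v v = \<delta> e\<close>: a nilpotent if \<open>\<delta> = 0\<close>, and
  otherwise a square root of a multiple of \<open>e\<close>, which splits \<open>e\<close> into two orthogonal idempotents.
\<close>
lemma diagonal:
  assumes ew: "e \<cdot> w = w" and we: "w \<cdot> e = w" and w: "\<And>k l. w \<noteq> k *\<^sub>C e + l *\<^sub>C f"
  shows "has_table idempotent_table (\<lambda>_. 1) \<or> has_table dual_table (tri 1 1 0)"
proof -
  have indep: "k = 0 \<and> l = 0 \<and> m = 0" if "k *\<^sub>C f + l *\<^sub>C e + m *\<^sub>C w = 0" for k l m
    using independent_extend[OF w independent_ef, of l k m] that by (auto simp: add.commute)
  obtain \<beta> where "coordinates (tri f e w) \<beta>"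
    using coordinates_of_independent[OF dim indep] by blast
  then have "w \<cdot> w = (\<Sum>i\<in>UNIV. \<beta> i (w \<cdot> w) *\<^sub>C tri f e w i)" by (rule coordinates.expand[symmetric])
  then obtain \<phi> \<alpha> \<gamma> where ww: "w \<cdot> w = \<phi> *\<^sub>C f + \<alpha> *\<^sub>C e + \<gamma> *\<^sub>C w" by (auto simp: sum_3)
  have "e \<cdot> (w \<cdot> w) = w \<cdot> w" by (metis assoc ew)
  then have ww: "w \<cdot> w = \<alpha> *\<^sub>C e + \<gamma> *\<^sub>C w" using ew unfolding ww by simp
  have fw: "f \<cdot> w = 0" "w \<cdot> f = 0" by (metis assoc ew fe bil'(1)) (metis assoc we ef bil'(2))
  define v where "v = w - (\<gamma> / 2) *\<^sub>C e"
  define \<delta> where "\<delta> = \<alpha> + \<gamma>\<^sup>2 / 4"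
  have v: "e \<cdot> v = v" "v \<cdot> e = v" "f \<cdot> v = 0" "v \<cdot> f = 0"
    by (simp_all add: v_def ew we fw)
  have vv: "v \<cdot> v = \<delta> *\<^sub>C e"
  proof -
    have "v \<cdot> v = \<alpha> *\<^sub>C e + (\<gamma> *\<^sub>C w - (\<gamma> / 2) *\<^sub>C w - (\<gamma> / 2) *\<^sub>C w) + (\<gamma> / 2 * (\<gamma> / 2)) *\<^sub>C e"
      by (simp add: v_def ew we ww scaleC_scaleC cvec.scale_right_diff_distrib algebra_simps)
    also have "\<gamma> *\<^sub>C w - (\<gamma> / 2) *\<^sub>C w - (\<gamma> / 2) *\<^sub>C w = 0"
      by (simp add: cvec.scale_left_diff_distrib[symmetric])
    finally show ?thesis by (simp add: \<delta>_def scaleC_add_left power2_eq_square)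
  qed
  have outside: "v \<noteq> k *\<^sub>C e + l *\<^sub>C f" for k l
  proof
    assume "v = k *\<^sub>C e + l *\<^sub>C f"
    then have "w = (k + \<gamma> / 2) *\<^sub>C e + l *\<^sub>C f" by (simp add: v_def scaleC_add_left algebra_simps)
    then show False using w by blast
  qed
  have indep_v: "k = 0 \<and> l = 0 \<and> m = 0" if "k *\<^sub>C f + l *\<^sub>C e + m *\<^sub>C v = 0" for k l m
    using independent_extend[OF outside independent_ef, of l k m] that by (auto simp: add.commute)
  show ?thesis
  proof (cases "\<delta> = 0")
    case True
    have "has_table dual_table (tri 1 1 0)"
    proof (rule has_tableI[OF indep_v])
      show "\<forall>i j. tri f e v i \<cdot> tri f e v j = dual_table i j 1 *\<^sub>C f +
        dual_table i j 2 *\<^sub>C e + dual_table i j 3 *\<^sub>C v"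
        using True by (simp add: forall_3 dual_table_def scaleC_one v vv)
    qed (simp_all only: one_expand)
    then show ?thesis ..
  next
    case False
    define r where "r = csqrt \<delta>"
    have r: "r \<noteq> 0" "r * r = \<delta>" using False by (simp_all add: r_def power2_eq_square[symmetric])
    \<comment> \<open>As \<open>v / r\<close> is a square root of \<open>e\<close>, these are orthogonal idempotents with sum \<open>e\<close>.\<close>
    define g h where "g = (1/2) *\<^sub>C e + (1 / (2 * r)) *\<^sub>C v" and "h = (1/2) *\<^sub>C e - (1 / (2 * r)) *\<^sub>C v"
    have "has_table idempotent_table (\<lambda>_. 1)"
    proof (rule has_tableI)
      fix k l m assume "k *\<^sub>C f + l *\<^sub>C g + m *\<^sub>C h = 0"
      then have "k *\<^sub>C f + ((l + m) / 2) *\<^sub>C e + ((l - m) / (2 * r)) *\<^sub>C v = 0"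
        by (simp add: g_def h_def scaleC_add_left scaleC_add_right scaleC_scaleC
            cvec.scale_right_diff_distrib cvec.scale_left_diff_distrib add_divide_distrib
            diff_divide_distrib algebra_simps)
      from indep_v[OF this] r show "k = 0 \<and> l = 0 \<and> m = 0" by auto
    next
      have half: "x = (1/2) *\<^sub>C x + (1/2) *\<^sub>C x" for x :: 'a
        by (simp add: scaleC_add_left[symmetric] scaleC_one)
      have q: "(1 / (2 * r) * (1 / (2 * r))) *\<^sub>C (\<delta> *\<^sub>C e) = (1/4) *\<^sub>C e"
        using r by (simp add: scaleC_scaleC r(2)[symmetric])
      have "g \<cdot> g = g" "h \<cdot> h = h" "g \<cdot> h = 0" "h \<cdot> g = 0"
        using q r False by (simp_all add: g_def h_def v vv scaleC_add_right scaleC_scaleC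
            cvec.scale_right_diff_distrib) (simp_all add: algebra_simps scaleC_add_left[symmetric])
      moreover have "f \<cdot> g = 0" "f \<cdot> h = 0" "g \<cdot> f = 0" "h \<cdot> f = 0" by (simp_all add: g_def h_def v)
      ultimately show "\<forall>i j. tri f g h i \<cdot> tri f g h j = idempotent_table i j 1 *\<^sub>C f +
        idempotent_table i j 2 *\<^sub>C g + idempotent_table i j 3 *\<^sub>C h"
        by (simp add: forall_3 idempotent_table_def scaleC_one)
      have "g + h = e" using half[of e] by (simp add: g_def h_def)
      then show "one = 1 *\<^sub>C f + 1 *\<^sub>C g + 1 *\<^sub>C h"
        by (simp add: scaleC_one one[symmetric] add.commute add.left_commute)
    qed
    then show ?thesis ..
  qed
qed

end

context algebra3
begin

text \<open>
  Some Peirce component of a vector outside the span of \<open>e\<close> and \<open>f\<close> is outside that span, too.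
\<close>
lemma has_table_if_idempotent:
  assumes ee: "e \<cdot> e = e" and e0: "e \<noteq> 0" and e1: "e \<noteq> one"
  shows "has_table idempotent_table (\<lambda>_. 1) \<or> has_table dual_table (tri 1 1 0) \<or>
    has_table triangular_table (tri 1 1 0)"
proof -
  define f where "f = one - e"
  interpret ef: idempotent_pair mul one e f
    by unfold_locales (use e0 e1 in \<open>simp_all add: f_def ee\<close>)
  interpret fe: idempotent_pair mul one f e
    by unfold_locales (use ef.e0 ef.f0 ef.one in \<open>simp_all add: add.commute\<close>)
  obtain z where z: "\<And>k l. z \<noteq> k *\<^sub>C e + l *\<^sub>C f" using outside_plane by blast
  define a b c d where "a = e \<cdot> z \<cdot> e" and "b = e \<cdot> z \<cdot> f" and "c = f \<cdot> z \<cdot> e" and "d = f \<cdot> z \<cdot> f"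
  note defs = a_def b_def c_def d_def
  have "(e + f) \<cdot> z \<cdot> (e + f) = a + b + c + d"
    by (simp only: defs bil(1,3) add_ac)
  then have sum: "z = a + b + c + d" by (simp only: ef.one one_left one_right)
  have ee': "e \<cdot> (e \<cdot> x) = e \<cdot> x" "f \<cdot> (f \<cdot> x) = f \<cdot> x" for x
    using assoc[of e e x] assoc[of f f x] by simp_all
  have corners: "e \<cdot> a = a" "a \<cdot> e = a" "e \<cdot> b = b" "b \<cdot> f = b" "f \<cdot> c = c" "c \<cdot> e = c" "f \<cdot> d = d" "d \<cdot> f = d"
    by (simp_all only: defs assoc ee' ef.ee ef.ff)
  let ?in = "\<lambda>w. \<exists>k l. w = k *\<^sub>C e + l *\<^sub>C f"
  have add: "?in (u + v)" if "?in u" "?in v" for u v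
  proof -
    from that obtain k l k' l' where "u = k *\<^sub>C e + l *\<^sub>C f" "v = k' *\<^sub>C e + l' *\<^sub>C f" by blast
    then have "u + v = (k + k') *\<^sub>C e + (l + l') *\<^sub>C f" by (simp add: scaleC_add_left add_ac)
    then show ?thesis by blast
  qed
  have swap: "?in w" if "w = k *\<^sub>C f + l *\<^sub>C e" for w k l
    by (intro exI[of _ l] exI[of _ k]) (simp only: that add.commute)
  have "\<not> (?in a \<and> ?in b \<and> ?in c \<and> ?in d)"
  proof
    assume "?in a \<and> ?in b \<and> ?in c \<and> ?in d"
    then have "?in z" unfolding sum by (intro add) simp_all
    then show False using z by simp
  qed
  then consider "\<not> ?in a" | "\<not> ?in b" | "\<not> ?in c" | "\<not> ?in d" by argo
  then show ?thesis
  proof cases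
    case 1 then show ?thesis using ef.diagonal[OF corners(1,2)] by blast
  next
    case 2 then show ?thesis using ef.off_diagonal[OF corners(3,4)] by blast
  next
    case 3 then show ?thesis using fe.off_diagonal[OF corners(5,6)] swap by blast
  next
    case 4 then show ?thesis using fe.diagonal[OF corners(7,8)] swap by blast
  qed
qed

end

locale local_algebra3 = algebra3 +
  assumes no_idempotent: "e \<cdot> e = e \<Longrightarrow> e = 0 \<or> e = one"
begin

text \<open>
  For a root \<open>a\<close> of the quadratic polynomial, \<open>y = x - a\<close> satisfies \<open>y y = s y\<close>. If \<open>s\<close> is not zero,
  then \<open>y / s\<close> is idempotent, hence trivial, and \<open>x\<close> is a scalar.
\<close>
lemma square_zero_if_quadratic:
  assumes x: "x \<cdot> x = k *\<^sub>C one + l *\<^sub>C x"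
  obtains a where "(x - a *\<^sub>C one) \<cdot> (x - a *\<^sub>C one) = 0"
proof -
  define r where "r = csqrt (k + l\<^sup>2 / 4)"
  have r: "r * r = k + l\<^sup>2 / 4" by (simp add: r_def power2_eq_square[symmetric])
  define a where "a = l / 2 + r"
  have a: "a * a = k + l * a" using r by (simp add: a_def algebra_simps power2_eq_square)
  define y where "y = x - a *\<^sub>C one"
  define s where "s = l - 2 * a"
  have yy: "y \<cdot> y = s *\<^sub>C y"
  proof -
    have "y \<cdot> y = (k + a * a) *\<^sub>C one + (l - 2 * a) *\<^sub>C x"
      by (simp add: y_def x scaleC_add_left cvec.scale_left_diff_distrib cvec.scale_right_diff_distrib
          scaleC_scaleC scaleC_double algebra_simps)
    also have "\<dots> = s *\<^sub>C x - (s * a) *\<^sub>C one"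
    proof -
      have "k + a * a = - (s * a)" using a unfolding s_def by algebra
      then show ?thesis by (simp add: s_def)
    qed
    finally show ?thesis by (simp add: y_def cvec.scale_right_diff_distrib scaleC_scaleC)
  qed
  show thesis
  proof (cases "s = 0")
    case True
    then show thesis using yy that[of a] by (simp add: y_def)
  next
    case False
    have "((1 / s) *\<^sub>C y) \<cdot> ((1 / s) *\<^sub>C y) = (1 / s) *\<^sub>C y" using False by (simp add: yy scaleC_scaleC)
    then have "(1 / s) *\<^sub>C y = 0 \<or> (1 / s) *\<^sub>C y = one" by (rule no_idempotent)
    then have "s *\<^sub>C ((1 / s) *\<^sub>C y) = s *\<^sub>C 0 \<or> s *\<^sub>C ((1 / s) *\<^sub>C y) = s *\<^sub>C one" by metis
    then have "y = 0 \<or> y = s *\<^sub>C one" using False by (simp add: scaleC_scaleC scaleC_one)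
    then have "x - a *\<^sub>C one = 0 \<or> x - (a + s) *\<^sub>C one = 0"
      by (auto simp: y_def scaleC_add_left algebra_simps)
    then show thesis using that by (metis bil'(1))
  qed
qed

lemma cubic_root: 
  obtains a :: complex where "a ^ 3 = c0 + c1 * a + c2 * a\<^sup>2"
proof -
  have "\<not> constant (poly [:- c0, - c1, - c2, 1:])" by (simp add: constant_degree)
  then obtain a where "poly [:- c0, - c1, - c2, 1:] a = 0" using fundamental_theorem_of_algebra by blast
  then show thesis using that[of a] by (simp add: algebra_simps power2_eq_square power3_eq_cube)
qed

text \<open>
  Translating \<open>x\<close> by a root of a polynomial that it satisfies gives \<open>y\<close> with \<open>y\<^sup>3 = s y\<^sup>2 + t y\<close>. As in
  the quadratic case, nonzero \<open>s\<close> or \<open>t\<close> would produce an idempotent.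
\<close>
lemma scalar_plus_nilpotent:
  obtains a where "(x - a *\<^sub>C one) \<cdot> ((x - a *\<^sub>C one) \<cdot> (x - a *\<^sub>C one)) = 0"
proof (cases "\<forall>k l m. k *\<^sub>C one + l *\<^sub>C x + m *\<^sub>C (x \<cdot> x) = 0 \<longrightarrow> k = 0 \<and> l = 0 \<and> m = 0")
  case True
  then obtain \<beta> where "coordinates (tri one x (x \<cdot> x)) \<beta>"
    using coordinates_of_independent[OF dim] by blast
  then have "x \<cdot> (x \<cdot> x) = (\<Sum>i\<in>UNIV. \<beta> i (x \<cdot> (x \<cdot> x)) *\<^sub>C tri one x (x \<cdot> x) i)"
    by (rule coordinates.expand[symmetric])
  then obtain c0 c1 c2 where xxx: "x \<cdot> (x \<cdot> x) = c0 *\<^sub>C one + c1 *\<^sub>C x + c2 *\<^sub>C (x \<cdot> x)"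
    by (auto simp: sum_3)
  obtain a where a: "a ^ 3 = c0 + c1 * a + c2 * a\<^sup>2" by (rule cubic_root)
  define y where "y = x - a *\<^sub>C one"
  \<comment> \<open>The Taylor coefficients of the cubic polynomial at its root \<open>a\<close>, up to sign.\<close>
  define s t where "s = c2 - 3 * a" and "t = c1 + 2 * a * c2 - 3 * a\<^sup>2"
  have yy: "y \<cdot> y = x \<cdot> x - (2 * a) *\<^sub>C x + (a * a) *\<^sub>C one"
    by (simp add: y_def scaleC_double scaleC_scaleC cvec.scale_right_diff_distrib)
  have yyy: "y \<cdot> (y \<cdot> y) = s *\<^sub>C (y \<cdot> y) + t *\<^sub>C y"
  proof -
    have "y \<cdot> (y \<cdot> y) = x \<cdot> (x \<cdot> x) - (3 * a) *\<^sub>C (x \<cdot> x) + (3 * a\<^sup>2) *\<^sub>C x - (a ^ 3) *\<^sub>C one"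
    proof -
      have "y \<cdot> (y \<cdot> y) = x \<cdot> (y \<cdot> y) - a *\<^sub>C (y \<cdot> y)" by (simp add: y_def)
      also have "\<dots> = x \<cdot> (x \<cdot> x) - ((2 * a) *\<^sub>C (x \<cdot> x) + a *\<^sub>C (x \<cdot> x)) + ((a * a) *\<^sub>C x + (a * (2 * a)) *\<^sub>C x)
          - (a * (a * a)) *\<^sub>C one"
        by (simp add: yy cvec.scale_right_diff_distrib scaleC_add_right scaleC_scaleC)
      also have "(2 * a) *\<^sub>C (x \<cdot> x) + a *\<^sub>C (x \<cdot> x) = (3 * a) *\<^sub>C (x \<cdot> x)"
        by (simp add: scaleC_add_left[symmetric])
      also have "(a * a) *\<^sub>C x + (a * (2 * a)) *\<^sub>C x = (3 * a\<^sup>2) *\<^sub>C x"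
        by (simp add: scaleC_add_left[symmetric] power2_eq_square)
      finally show ?thesis by (simp add: power3_eq_cube mult.assoc)
    qed
    also have "\<dots> = (c0 - a ^ 3) *\<^sub>C one + (c1 + 3 * a\<^sup>2) *\<^sub>C x + (c2 - 3 * a) *\<^sub>C (x \<cdot> x)"
      by (simp add: xxx scaleC_add_left cvec.scale_left_diff_distrib)
    also have "c0 - a ^ 3 = s * (a * a) - t * a"
      by (simp add: a s_def t_def algebra_simps power2_eq_square)
    also have "c1 + 3 * a\<^sup>2 = t - 2 * (s * a)"
      by (simp add: s_def t_def algebra_simps power2_eq_square)
    also have "(s * (a * a) - t * a) *\<^sub>C one + (t - 2 * (s * a)) *\<^sub>C x + (c2 - 3 * a) *\<^sub>C (x \<cdot> x) =
        s *\<^sub>C (y \<cdot> y) + t *\<^sub>C y"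
      by (simp add: yy y_def s_def[symmetric] cvec.scale_left_diff_distrib cvec.scale_right_diff_distrib
          scaleC_add_right scaleC_scaleC scaleC_double)
    finally show ?thesis .
  qed
  show thesis
  proof (cases "y \<cdot> (y \<cdot> y) = 0")
    case True
    then show thesis using that unfolding y_def by blast
  next
    case False
    \<comment> \<open>The multiplicative relation for \<open>y\<close> yields a nonzero idempotent in the span of \<open>y\<close> and
      \<open>y \<cdot> y\<close>, which has to be \<open>one\<close>; this contradicts independence of \<open>one\<close>, \<open>x\<close>, \<open>x \<cdot> x\<close>.\<close>
    have "\<exists>k l. k *\<^sub>C y + l *\<^sub>C (y \<cdot> y) = one"
    proof (cases "t = 0")
      case t: False
      define u where "u = (1 / t) *\<^sub>C (y \<cdot> y - s *\<^sub>C y)"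
      have uy: "u \<cdot> y = y"
        using t by (simp add: u_def assoc yyy scaleC_scaleC cvec.scale_right_diff_distrib scaleC_add_right scaleC_one)
      then have "u \<cdot> u = u"
        unfolding u_def[of] using uy by (simp add: assoc[symmetric] uy)
      then have "u = 0 \<or> u = one" by (rule no_idempotent)
      moreover have "u \<noteq> 0" using uy False by auto
      ultimately have "u = one" by blast
      moreover have "u = (- (s / t)) *\<^sub>C y + (1 / t) *\<^sub>C (y \<cdot> y)"
        by (simp add: u_def cvec.scale_right_diff_distrib scaleC_scaleC)
      ultimately show ?thesis by metis
    next
      case t: True
      then have yyy: "y \<cdot> (y \<cdot> y) = s *\<^sub>C (y \<cdot> y)" using yyy by simp
      then have s: "s \<noteq> 0" using False by auto
      define u where "u = (1 / s\<^sup>2) *\<^sub>C (y \<cdot> y)"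
      have "u \<cdot> u = u"
        using s by (simp add: u_def assoc yyy scaleC_scaleC power2_eq_square)
      then have "u = 0 \<or> u = one" by (rule no_idempotent)
      moreover have "u \<noteq> 0"
      proof
        assume "u = 0"
        then have "s\<^sup>2 *\<^sub>C u = 0" by simp
        then have "y \<cdot> y = 0" using s by (simp add: u_def scaleC_scaleC scaleC_one)
        then show False using False by simp
      qed
      ultimately have "0 *\<^sub>C y + (1 / s\<^sup>2) *\<^sub>C (y \<cdot> y) = one" by (simp add: u_def)
      then show ?thesis by blast
    qed
    then obtain k l where "k *\<^sub>C y + l *\<^sub>C (y \<cdot> y) = one" by blast
    then have "(l * (a * a) - k * a - 1) *\<^sub>C one + (k - l * (2 * a)) *\<^sub>C x + l *\<^sub>C (x \<cdot> x) = 0"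
      by (simp add: yy y_def cvec.scale_left_diff_distrib cvec.scale_right_diff_distrib
          scaleC_add_right scaleC_scaleC scaleC_one scaleC_double algebra_simps)
    with \<open>\<forall>k l m. _\<close> have "l * (a * a) - k * a - 1 = 0 \<and> k - l * (2 * a) = 0 \<and> l = 0" by blast
    then show thesis by auto
  qed
next
  case False
  then obtain k l m where rel: "k *\<^sub>C one + l *\<^sub>C x + m *\<^sub>C (x \<cdot> x) = 0" and nz: "\<not> (k = 0 \<and> l = 0 \<and> m = 0)"
    by blast
  show thesis
  proof (cases "m = 0")
    case m: False
    have "m *\<^sub>C (x \<cdot> x) = - (k *\<^sub>C one + l *\<^sub>C x)" using rel by (simp only: add_eq_0_iff)
    then have "(1 / m) *\<^sub>C (m *\<^sub>C (x \<cdot> x)) = (1 / m) *\<^sub>C (- (k *\<^sub>C one + l *\<^sub>C x))" by simp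
    then have "x \<cdot> x = (- (k / m)) *\<^sub>C one + (- (l / m)) *\<^sub>C x"
      using m by (simp add: scaleC_scaleC scaleC_one scaleC_add_right cvec.scale_right_diff_distrib)
    then obtain a where "(x - a *\<^sub>C one) \<cdot> (x - a *\<^sub>C one) = 0" by (rule square_zero_if_quadratic)
    then show thesis using that by (metis bil'(2))
  next
    case m: True
    then have l: "l \<noteq> 0" using rel nz one_neq_0 by auto
    have "l *\<^sub>C x = - (k *\<^sub>C one)" using rel m by (simp add: add_eq_0_iff)
    then have "(1 / l) *\<^sub>C (l *\<^sub>C x) = (1 / l) *\<^sub>C (- (k *\<^sub>C one))" by simp
    then have "x - (- (k / l)) *\<^sub>C one = 0" using l by (simp add: scaleC_scaleC scaleC_one)
    then show thesis using that by (metis bil'(1))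
  qed
qed

text \<open>
  Write \<open>x y = a + b x + c y\<close>. Multiplication by \<open>x\<close> on the left annihilates this product and forces
  \<open>a = c = 0\<close>; then multiplication by \<open>y\<close> on the right forces \<open>b = 0\<close>.
\<close>
lemma square_zero_product:
  assumes "x \<cdot> x = 0" "y \<cdot> y = 0"
    and indep: "\<And>k l m. k *\<^sub>C one + l *\<^sub>C x + m *\<^sub>C y = 0 \<Longrightarrow> k = 0 \<and> l = 0 \<and> m = 0"
  shows "x \<cdot> y = 0"
proof -
  obtain \<beta> where "coordinates (tri one x y) \<beta>"
    using coordinates_of_independent[OF dim indep] by blast
  then have "x \<cdot> y = (\<Sum>i\<in>UNIV. \<beta> i (x \<cdot> y) *\<^sub>C tri one x y i)" by (rule coordinates.expand[symmetric])
  then obtain a b c where xy: "x \<cdot> y = a *\<^sub>C one + b *\<^sub>C x + c *\<^sub>C y" by (auto simp: sum_3)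
  have "x \<cdot> (x \<cdot> y) = 0" using assms(1) assoc[of x x y] by simp
  then have "(c * a) *\<^sub>C one + (a + c * b) *\<^sub>C x + (c * c) *\<^sub>C y = 0"
    by (simp add: xy assms(1) scaleC_add_right scaleC_add_left scaleC_scaleC add_ac)
  from indep[OF this] have ac: "a = 0" "c = 0" by auto
  then have xy: "x \<cdot> y = b *\<^sub>C x" using xy by simp
  have "(x \<cdot> y) \<cdot> y = 0" using assms(2) assoc[of x y y] by simp
  then have "0 *\<^sub>C one + (b * b) *\<^sub>C x + 0 *\<^sub>C y = 0" by (simp add: xy scaleC_scaleC)
  from indep[OF this] show ?thesis by (simp add: xy)
qed

text \<open>
  Either some nilpotent has a nonzero square, and its powers form a basis, or all nilpotents square to
  zero and any two of them that are independent modulo scalars have zero product.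
\<close>
theorem has_local_table: "\<exists>\<kappa>\<in>{0, 1}. has_table (local_table \<kappa>) (tri 1 0 0)"
proof (cases "\<exists>y. y \<cdot> (y \<cdot> y) = 0 \<and> y \<cdot> y \<noteq> 0")
  case True
  then obtain y where y3: "y \<cdot> (y \<cdot> y) = 0" and y2: "y \<cdot> y \<noteq> 0" by blast
  have y3': "(y \<cdot> y) \<cdot> y = 0" and y4: "(y \<cdot> y) \<cdot> (y \<cdot> y) = 0" using y3 by (simp_all add: assoc)
  have indep: "k = 0 \<and> l = 0 \<and> m = 0" if "k *\<^sub>C one + l *\<^sub>C y + m *\<^sub>C (y \<cdot> y) = 0" for k l m
  proof -
    have "(k *\<^sub>C one + l *\<^sub>C y + m *\<^sub>C (y \<cdot> y)) \<cdot> (y \<cdot> y) = k *\<^sub>C (y \<cdot> y)" by (simp add: y3 y4)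
    then have k: "k = 0" using y2 unfolding that by simp
    have "(k *\<^sub>C one + l *\<^sub>C y + m *\<^sub>C (y \<cdot> y)) \<cdot> y = l *\<^sub>C (y \<cdot> y)" by (simp add: k y3')
    then have l: "l = 0" using y2 unfolding that by simp
    show ?thesis using that k l y2 by simp
  qed
  have "has_table (local_table 1) (tri 1 0 0)"
  proof (rule has_tableI)
    show "k *\<^sub>C one + l *\<^sub>C y + m *\<^sub>C (y \<cdot> y) = 0 \<Longrightarrow> k = 0 \<and> l = 0 \<and> m = 0" for k l m by (rule indep)
    show "\<forall>i j. tri one y (y \<cdot> y) i \<cdot> tri one y (y \<cdot> y) j = local_table 1 i j 1 *\<^sub>C one +
      local_table 1 i j 2 *\<^sub>C y + local_table 1 i j 3 *\<^sub>C (y \<cdot> y)"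
      by (simp add: forall_3 local_table_def scaleC_one y3 y3' y4)
  qed (simp add: scaleC_one)
  then show ?thesis by blast
next
  case False
  have square: "\<exists>a. (x - a *\<^sub>C one) \<cdot> (x - a *\<^sub>C one) = 0" for x
    using scalar_plus_nilpotent[of x] False by metis
  obtain z1 where z1: "\<And>k l. z1 \<noteq> k *\<^sub>C one + l *\<^sub>C 0" using outside_plane by blast
  obtain a1 where a1: "(z1 - a1 *\<^sub>C one) \<cdot> (z1 - a1 *\<^sub>C one) = 0" using square by blast
  define x where "x = z1 - a1 *\<^sub>C one"
  have x: "x \<noteq> k *\<^sub>C one + l *\<^sub>C 0" for k l
  proof
    assume "x = k *\<^sub>C one + l *\<^sub>C 0"
    then have "z1 = (k + a1) *\<^sub>C one + l *\<^sub>C 0" by (simp add: x_def scaleC_add_left algebra_simps)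
    then show False using z1 by blast
  qed
  have indep1: "k = 0 \<and> l = 0" if "k *\<^sub>C one + l *\<^sub>C x = 0" for k l
  proof -
    have "l = 0"
    proof (rule ccontr)
      assume l: "l \<noteq> 0"
      have "l *\<^sub>C x = - (k *\<^sub>C one)" using that by (simp add: add_eq_0_iff)
      then have "(1 / l) *\<^sub>C (l *\<^sub>C x) = (1 / l) *\<^sub>C (- (k *\<^sub>C one))" by simp
      then have "x = (- (k / l)) *\<^sub>C one + 0 *\<^sub>C 0" using l by (simp add: scaleC_scaleC scaleC_one)
      then show False using x by blast
    qed
    then show ?thesis using that one_neq_0 by simp
  qed
  obtain z2 where z2: "\<And>k l. z2 \<noteq> k *\<^sub>C one + l *\<^sub>C x" using outside_plane by blast
  obtain a2 where a2: "(z2 - a2 *\<^sub>C one) \<cdot> (z2 - a2 *\<^sub>C one) = 0" using square by blast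
  define y where "y = z2 - a2 *\<^sub>C one"
  have y: "y \<noteq> k *\<^sub>C one + l *\<^sub>C x" for k l
  proof
    assume "y = k *\<^sub>C one + l *\<^sub>C x"
    then have "z2 = (k + a2) *\<^sub>C one + l *\<^sub>C x" by (simp add: y_def scaleC_add_left algebra_simps)
    then show False using z2 by blast
  qed
  note indep = independent_extend[OF y indep1]
  have indep': "k = 0 \<and> l = 0 \<and> m = 0" if "k *\<^sub>C one + l *\<^sub>C y + m *\<^sub>C x = 0" for k l m
    using indep[of k m l] that by (simp add: add_ac)
  have xx: "x \<cdot> x = 0" and yy: "y \<cdot> y = 0" using a1 a2 by (simp_all only: x_def y_def)
  have xy: "x \<cdot> y = 0" "y \<cdot> x = 0"
    using square_zero_product[OF xx yy indep] square_zero_product[OF yy xx indep'] by blast+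
  have "has_table (local_table 0) (tri 1 0 0)"
  proof (rule has_tableI)
    show "k *\<^sub>C one + l *\<^sub>C x + m *\<^sub>C y = 0 \<Longrightarrow> k = 0 \<and> l = 0 \<and> m = 0" for k l m by (rule indep)
    show "\<forall>i j. tri one x y i \<cdot> tri one x y j = local_table 0 i j 1 *\<^sub>C one +
      local_table 0 i j 2 *\<^sub>C x + local_table 0 i j 3 *\<^sub>C y"
      by (simp add: forall_3 local_table_def scaleC_one xx yy xy)
  qed (simp add: scaleC_one)
  then show ?thesis by blast
qed

end

theorem (in algebra3) has_table_cases:
  "has_table idempotent_table (\<lambda>_. 1) \<or> has_table dual_table (tri 1 1 0) \<or>
    has_table triangular_table (tri 1 1 0) \<or> (\<exists>\<kappa>\<in>{0, 1}. has_table (local_table \<kappa>) (tri 1 0 0))"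
proof (cases "\<forall>e. e \<cdot> e = e \<longrightarrow> e = 0 \<or> e = one")
  case True
  then interpret local_algebra3 mul one by unfold_locales blast
  show ?thesis using has_local_table by blast
next
  case False
  then show ?thesis using has_table_if_idempotent by blast
qed

section \<open>Comultiplications on the local, dual-number and triangular algebras\<close>

lemma structure_equationsD:
  assumes "structure_equations M U D E"
  shows "(\<Sum>l\<in>UNIV. D r l k * D l i j) = (\<Sum>l\<in>UNIV. D r i l * D l j k)"
    and "(\<Sum>l\<in>UNIV. E l * D i l r) = (if r = i then 1 else 0)"
    and "(\<Sum>l\<in>UNIV. E l * D i r l) = (if r = i then 1 else 0)"
    and "(\<Sum>l\<in>UNIV. M i j l * D l r s) = tensor_product_coeff M (D i) (D j) r s"
    and "(\<Sum>l\<in>UNIV. (\<Sum>m\<in>UNIV. U m * D m l k) * D l i j) =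
      (\<Sum>a\<in>UNIV. \<Sum>b\<in>UNIV. (\<Sum>m\<in>UNIV. U m * D m i a) * (\<Sum>m\<in>UNIV. U m * D m b k) * M a b j)"
    and "(\<Sum>l\<in>UNIV. M i j l * (\<Sum>r\<in>UNIV. M l k r * E r)) =
      (\<Sum>a\<in>UNIV. \<Sum>b\<in>UNIV. D j a b * (\<Sum>r\<in>UNIV. M i a r * E r) * (\<Sum>s\<in>UNIV. M b k s * E s))"
proof -
  note s = assms[unfolded structure_equations_def Let_def]
  note s4 = conjunct2[OF conjunct2[OF conjunct2[OF s]]]
  note s7 = conjunct2[OF conjunct2[OF conjunct2[OF s4]]]
  note s8 = conjunct2[OF s7]
  show "(\<Sum>l\<in>UNIV. D r l k * D l i j) = (\<Sum>l\<in>UNIV. D r i l * D l j k)"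
    using conjunct1[OF s4] by blast
  show "(\<Sum>l\<in>UNIV. E l * D i l r) = (if r = i then 1 else 0)"
    using conjunct1[OF conjunct2[OF s4]] by blast
  show "(\<Sum>l\<in>UNIV. E l * D i r l) = (if r = i then 1 else 0)"
    using conjunct1[OF conjunct2[OF conjunct2[OF s4]]] by blast
  show "(\<Sum>l\<in>UNIV. M i j l * D l r s) = tensor_product_coeff M (D i) (D j) r s"
    using conjunct1[OF s7] by blast
  show "(\<Sum>l\<in>UNIV. (\<Sum>m\<in>UNIV. U m * D m l k) * D l i j) =
      (\<Sum>a\<in>UNIV. \<Sum>b\<in>UNIV. (\<Sum>m\<in>UNIV. U m * D m i a) * (\<Sum>m\<in>UNIV. U m * D m b k) * M a b j)"
    using conjunct1[OF conjunct1[OF s8]] by blast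
  show "(\<Sum>l\<in>UNIV. M i j l * (\<Sum>r\<in>UNIV. M l k r * E r)) =
      (\<Sum>a\<in>UNIV. \<Sum>b\<in>UNIV. D j a b * (\<Sum>r\<in>UNIV. M i a r * E r) * (\<Sum>s\<in>UNIV. M b k s * E s))"
    using conjunct2[OF s8] by blast
qed

text \<open>
  The coefficients of a product involve only coefficients of the factors of no higher degree in the nilpotents,
  which is why the comparisons below can proceed degree by degree.
\<close>
lemma tensor_product_coeff_local:
  "tensor_product_coeff (local_table \<kappa>) X Y 1 1 = X 1 1 * Y 1 1"
  "tensor_product_coeff (local_table \<kappa>) X Y 1 2 = X 1 1 * Y 1 2 + X 1 2 * Y 1 1"
  "tensor_product_coeff (local_table \<kappa>) X Y 2 1 = X 1 1 * Y 2 1 + X 2 1 * Y 1 1"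
  "tensor_product_coeff (local_table \<kappa>) X Y 1 3 = X 1 1 * Y 1 3 + X 1 3 * Y 1 1 + \<kappa> * X 1 2 * Y 1 2"
  "tensor_product_coeff (local_table \<kappa>) X Y 3 1 = X 1 1 * Y 3 1 + X 3 1 * Y 1 1 + \<kappa> * X 2 1 * Y 2 1"
  "tensor_product_coeff (local_table \<kappa>) X Y 2 2 = X 1 1 * Y 2 2 + X 1 2 * Y 2 1 + X 2 1 * Y 1 2 + X 2 2 * Y 1 1"
  "tensor_product_coeff (local_table \<kappa>) X Y 2 3 = X 1 1 * Y 2 3 + X 1 3 * Y 2 1 + X 2 1 * Y 1 3 + X 2 3 * Y 1 1
    + \<kappa> * (X 1 2 * Y 2 2 + X 2 2 * Y 1 2)"
  "tensor_product_coeff (local_table \<kappa>) X Y 3 2 = X 1 1 * Y 3 2 + X 1 2 * Y 3 1 + X 3 1 * Y 1 2 + X 3 2 * Y 1 1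
    + \<kappa> * (X 2 1 * Y 2 2 + X 2 2 * Y 2 1)"
  "tensor_product_coeff (local_table \<kappa>) X Y 3 3 = X 1 1 * Y 3 3 + X 1 3 * Y 3 1 + X 3 1 * Y 1 3 + X 3 3 * Y 1 1
    + \<kappa> * (X 1 2 * Y 3 2 + X 2 1 * Y 2 3 + X 2 3 * Y 2 1 + X 3 2 * Y 1 2) + \<kappa> * \<kappa> * X 2 2 * Y 2 2"
  by (simp_all add: tensor_product_coeff_def sum_3 local_table_def algebra_simps)

lemma tensor_product_coeff_dual:
  "tensor_product_coeff dual_table X Y 1 1 = X 1 1 * Y 1 1"
  "tensor_product_coeff dual_table X Y 1 2 = X 1 2 * Y 1 2"
  "tensor_product_coeff dual_table X Y 2 1 = X 2 1 * Y 2 1"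
  "tensor_product_coeff dual_table X Y 2 2 = X 2 2 * Y 2 2"
  "tensor_product_coeff dual_table X Y 1 3 = X 1 2 * Y 1 3 + X 1 3 * Y 1 2"
  "tensor_product_coeff dual_table X Y 2 3 = X 2 2 * Y 2 3 + X 2 3 * Y 2 2"
  "tensor_product_coeff dual_table X Y 3 1 = X 2 1 * Y 3 1 + X 3 1 * Y 2 1"
  "tensor_product_coeff dual_table X Y 3 2 = X 2 2 * Y 3 2 + X 3 2 * Y 2 2"
  "tensor_product_coeff dual_table X Y 3 3 = X 2 2 * Y 3 3 + X 2 3 * Y 3 2 + X 3 2 * Y 2 3 + X 3 3 * Y 2 2"
  by (simp_all add: tensor_product_coeff_def sum_3 dual_table_def algebra_simps)

lemma tensor_product_coeff_triangular:
  "tensor_product_coeff triangular_table X Y 1 1 = X 1 1 * Y 1 1"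
  "tensor_product_coeff triangular_table X Y 1 2 = X 1 2 * Y 1 2"
  "tensor_product_coeff triangular_table X Y 2 1 = X 2 1 * Y 2 1"
  "tensor_product_coeff triangular_table X Y 2 2 = X 2 2 * Y 2 2"
  "tensor_product_coeff triangular_table X Y 1 3 = X 1 2 * Y 1 3 + X 1 3 * Y 1 1"
  "tensor_product_coeff triangular_table X Y 2 3 = X 2 2 * Y 2 3 + X 2 3 * Y 2 1"
  "tensor_product_coeff triangular_table X Y 3 1 = X 2 1 * Y 3 1 + X 3 1 * Y 1 1"
  "tensor_product_coeff triangular_table X Y 3 2 = X 2 2 * Y 3 2 + X 3 2 * Y 1 2"
  "tensor_product_coeff triangular_table X Y 3 3 = X 2 2 * Y 3 3 + X 2 3 * Y 3 1 + X 3 2 * Y 1 3 + X 3 3 * Y 1 1"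
  by (simp_all add: tensor_product_coeff_def sum_3 triangular_table_def algebra_simps)

text \<open>
  The coefficients of \<open>\<Delta>(1)\<close> vanish in the order of their degree, except for the one of \<open>1 \<otimes> 1\<close>.
\<close>
theorem no_local_structure:
  assumes s: "structure_equations (local_table \<kappa>) (tri 1 0 0) D E" and "\<kappa> = 0 \<or> \<kappa> = 1"
  shows False
proof -
  note mult = structure_equationsD(4)[OF s, unfolded sum_3]
  note sm = local_table_def tensor_product_coeff_local
  note counit = structure_equationsD(2,3)[OF s, unfolded sum_3]
  note cm = structure_equationsD(6)[OF s, unfolded sum_3]
  have one: "D 1 1 1 = D 1 1 1 * D 1 1 1" using mult[of 1 1 1 1] by (simp add: sm)
  have *: "t = 0" if "d = 0 \<or> d = 1" "t = d * t + t * d" for t d :: complex using that by auto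
  have d: "D 1 1 1 = 0 \<or> D 1 1 1 = 1" using one by (metis mult_cancel_left2)
  have "D 1 1 2 = 0" "D 1 2 1 = 0"
    using mult[of 1 1 1 2] mult[of 1 1 2 1] by (intro *[OF d]; simp add: sm)+
  note z = this
  have "D 1 1 3 = 0" "D 1 3 1 = 0" "D 1 2 2 = 0"
    using mult[of 1 1 1 3] mult[of 1 1 3 1] mult[of 1 1 2 2] by (intro *[OF d]; simp add: sm z)+
  note z = z this
  have "D 1 2 3 = 0" "D 1 3 2 = 0"
    using mult[of 1 1 2 3] mult[of 1 1 3 2] by (intro *[OF d]; simp add: sm z)+
  note z = z this
  have "D 1 3 3 = 0"
    using mult[of 1 1 3 3] by (intro *[OF d]; simp add: sm z)
  note z = z this
  have "E 1 * D 1 1 1 = 1" using counit(1)[of 1 1] by (simp add: z)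
  with d have one: "D 1 1 1 = 1" "E 1 = 1" by auto
  have "E 3 * E 3 = 0" using cm[of 3 1 3] by (simp add: local_table_def one z)
  then have E3: "E 3 = 0" by simp
  have "E 2 * E 2 = 0" using cm[of 2 1 2] by (simp add: local_table_def one z E3)
  then have E2: "E 2 = 0" by simp
  have c: "D i 1 r = (if r = i then 1 else 0)" "D i r 1 = (if r = i then 1 else 0)" for i r
    using counit[of i r] by (simp_all add: one E2 E3)
  \<comment> \<open>The coefficients of \<open>x \<otimes> x\<close> in \<open>\<Delta>(x x)\<close> and of \<open>x \<otimes> y\<close> in \<open>\<Delta>(x y)\<close>.\<close>
  have "\<kappa> * D 3 2 2 = 2" using mult[of 2 2 2 2] by (simp add: sm c)
  with assms(2) have k: "\<kappa> = 1" "D 3 2 2 = 2" by auto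
  show False using mult[of 2 3 2 3] by (simp add: sm c k)
qed

abbreviation mat3 :: "'a \<Rightarrow> 'a \<Rightarrow> 'a \<Rightarrow> 'a \<Rightarrow> 'a \<Rightarrow> 'a \<Rightarrow> 'a \<Rightarrow> 'a \<Rightarrow> 'a \<Rightarrow> 3 \<Rightarrow> 3 \<Rightarrow> 'a" where
  "mat3 a b c d e f g h i \<equiv> tri (tri a b c) (tri d e f) (tri g h i)"

lemma tri_eq_iff: "f = tri x y z \<longleftrightarrow> f 1 = x \<and> f 2 = y \<and> f 3 = z"
  by (simp add: fun_eq_iff forall_3)

text \<open>
  The comultiplication \<open>\<Delta>(p) = p \<otimes> p\<close>, \<open>\<Delta>(q) = p \<otimes> q + q \<otimes> p + q \<otimes> q\<close> and
  \<open>\<Delta>(n) = p \<otimes> n + n \<otimes> p + x n \<otimes> q + y q \<otimes> n + z n \<otimes> n\<close>.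
\<close>
definition dual_comult :: "complex \<Rightarrow> complex \<Rightarrow> complex \<Rightarrow> 3 \<Rightarrow> 3 \<Rightarrow> 3 \<Rightarrow> complex" where
  "dual_comult x y z = tri (mat3 1 0 0 0 0 0 0 0 0) (mat3 0 1 0 1 1 0 0 0 0) (mat3 0 0 1 0 0 y 1 x z)"

text \<open>
  First, \<open>\<epsilon>(n)\<close> and \<open>\<epsilon>(q)\<close> vanish, since otherwise the counit law for \<open>n\<close> fails; so \<open>\<epsilon>\<close> is the
  character of \<open>p\<close>, and the counit laws determine all coefficients with an index \<open>p\<close>. The coefficient of
  \<open>q \<otimes> q\<close> in \<open>\<Delta>(1)\<close> is \<open>1\<close> by the axiom on \<open>\<Delta>(1)\<close>, so it belongs to \<open>\<Delta>(p)\<close> or to \<open>\<Delta>(q)\<close>. In the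
  first case the character of \<open>q\<close> would be an involution in the dual algebra whose product with the functional
  dual to \<open>n\<close> has no component along that functional, against associativity.
\<close>
theorem dual_structure:
  assumes s: "structure_equations dual_table (tri 1 1 0) D E"
  obtains x y z where "E = tri 1 0 0" "D = dual_comult x y z"
    "x * x = x" "y * y = y" "x * y = 0" "x * z = 0" "y * z = 0"
proof -
  note mult = structure_equationsD(4)[OF s, unfolded sum_3]
  note sm = dual_table_def tensor_product_coeff_dual
  note counit = structure_equationsD(2,3)[OF s, unfolded sum_3]
  note cm = structure_equationsD(6)[OF s, unfolded sum_3]
  note coassoc = structure_equationsD(1)[OF s, unfolded sum_3]
  note unit = structure_equationsD(5)[OF s, unfolded sum_3]
  have nil: "D 3 1 1 = 0" "D 3 1 2 = 0" "D 3 2 1 = 0" "D 3 2 2 = 0"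
    using mult[of 3 3 1 1] mult[of 3 3 1 2] mult[of 3 3 2 1] mult[of 3 3 2 2] by (simp_all add: sm)
  have E3: "E 3 = 0"
  proof (rule ccontr)
    assume E3: "E 3 \<noteq> 0"
    then have D2: "D 2 2 2 = 0" using cm[of 3 2 3] by (simp add: dual_table_def)
    have "D 3 2 3 = 0" "D 3 3 2 = 0" using mult[of 2 3 2 3] mult[of 2 3 3 2] by (simp_all add: sm nil D2)
    moreover from this have "D 3 3 3 = 0" using mult[of 2 3 3 3] by (simp add: sm nil D2)
    moreover have "D 3 1 3 = 0" using counit(2)[of 3 1] E3 by (simp add: nil)
    ultimately show False using counit(1)[of 3 3] by simp
  qed
  have sq: "D 3 2 3 * D 3 3 2 = 0" using mult[of 3 3 3 3] by (simp add: sm nil)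
  have E2: "E 2 = 0"
  proof (rule ccontr)
    assume E2: "E 2 \<noteq> 0"
    have "E 1 = 0 \<or> D 2 1 2 = 0 \<and> D 2 2 1 = 0"
      using cm[of 1 2 2] cm[of 2 2 1] E2 by (auto simp: dual_table_def E3)
    then have "E 1 * D 3 1 3 = 0 \<and> E 1 * D 3 3 1 = 0"
      using mult[of 2 3 1 3] mult[of 2 3 3 1] by (auto simp: sm nil)
    then have "E 2 * D 3 2 3 = 1" "E 2 * D 3 3 2 = 1"
      using counit(1)[of 3 3] counit(2)[of 3 3] by (auto simp: E3)
    then show False using sq by auto
  qed
  have a: "E 1 * D 3 1 3 = 1" using counit(1)[of 3 3] by (simp add: E2 E3)
  have "E 1 = E 1 * E 1 * D 1 1 1" using cm[of 1 1 1] by (simp add: dual_table_def mult_ac)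
  moreover have "D 1 1 1 = D 1 1 1 * D 1 1 1" using mult[of 1 1 1 1] by (simp add: sm)
  ultimately have E1: "E 1 = 1" using a by (metis mult_cancel_left2 mult_zero_left mult_zero_right zero_neq_one mult.right_neutral)
  have c: "D i 1 r = (if r = i then 1 else 0)" "D i r 1 = (if r = i then 1 else 0)" for i r
    using counit[of i r] by (simp_all add: E1 E2 E3)
  \<comment> \<open>The axiom on \<open>\<Delta>(1)\<close> at the coefficient of \<open>q \<otimes> p \<otimes> q\<close>.\<close>
  have T: "D 1 2 2 + D 2 2 2 = 1" using unit[of 2 2 1] by (simp add: dual_table_def c)
  have i12: "D 1 2 2 * D 2 2 2 = 0" using mult[of 1 2 2 2] by (simp add: sm)
  have "D 2 2 2 \<noteq> 0"
  proof
    assume D2: "D 2 2 2 = 0"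
    then have "D 1 2 2 = 1" using T by simp
    moreover have "D 3 2 3 = 0" using mult[of 2 3 2 3] by (simp add: sm nil D2)
    ultimately show False using coassoc[of 3 3 2 2] by (simp add: nil c D2)
  qed
  with i12 T have D22: "D 1 2 2 = 0" "D 2 2 2 = 1" by auto
  have D1: "D 1 2 3 = 0" "D 1 3 2 = 0" "D 2 2 3 = 0" "D 2 3 2 = 0"
    using mult[of 1 2 2 3] mult[of 1 2 3 2] mult[of 2 2 2 3] mult[of 2 2 3 2] by (simp_all add: sm D22)
  then have D33: "D 1 3 3 = 0" "D 2 3 3 = 0"
    using mult[of 1 2 3 3] mult[of 2 2 3 3] by (simp_all add: sm D22)
  define x y z where "x = D 3 3 2" and "y = D 3 2 3" and "z = D 3 3 3"
  show thesis
  proof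
    show "E = tri 1 0 0" by (simp add: tri_eq_iff E1 E2 E3)
    show "D = dual_comult x y z"
      unfolding dual_comult_def tri_eq_iff by (simp add: c D22 D1 D33 nil x_def y_def z_def)
    show "x * x = x" using coassoc[of 3 2 3 2] by (simp add: x_def nil c D22 D1)
    show "y * y = y" using coassoc[of 3 3 2 2] by (simp add: y_def nil c D22 D1)
    show xy: "x * y = 0" using sq by (simp add: x_def y_def mult.commute)
    have "x * z = y * z" using coassoc[of 3 3 3 2] by (simp add: x_def y_def z_def nil c D22 D1 mult_ac)
    then show "x * z = 0" "y * z = 0" using xy by auto
  qed
qed

text \<open>
  The bialgebra structures with \<open>\<epsilon>\<close> the character of \<open>p\<close> and of \<open>q\<close>, respectively: \<open>\<Delta>\<close> of that idempotent
  \<open>r\<close> is \<open>r \<otimes> r + a n \<otimes> n\<close>, and \<open>\<Delta>(n) = r \<otimes> n + n \<otimes> r + c n \<otimes> n\<close>.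
\<close>
definition triangular_comult1 :: "complex \<Rightarrow> complex \<Rightarrow> 3 \<Rightarrow> 3 \<Rightarrow> 3 \<Rightarrow> complex" where
  "triangular_comult1 a c = tri (mat3 1 0 0 0 0 0 0 0 a) (mat3 0 1 0 1 1 0 0 0 (- a)) (mat3 0 0 1 0 0 0 1 0 c)"

definition triangular_comult2 :: "complex \<Rightarrow> complex \<Rightarrow> 3 \<Rightarrow> 3 \<Rightarrow> 3 \<Rightarrow> complex" where
  "triangular_comult2 a c = tri (mat3 1 1 0 1 0 0 0 0 (- a)) (mat3 0 0 0 0 1 0 0 0 a) (mat3 0 0 0 0 0 1 0 1 c)"

definition grouplike_comult :: "3 \<Rightarrow> 3 \<Rightarrow> 3 \<Rightarrow> complex" where
  "grouplike_comult = tri (mat3 1 0 0 0 0 0 0 0 0) (mat3 0 0 0 0 1 0 0 0 0) (mat3 0 0 0 0 0 0 0 0 1)"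

text \<open>
  If \<open>\<epsilon>(n) = 0\<close>, then \<open>\<epsilon>(p)\<close> and \<open>\<epsilon>(q)\<close> are \<open>0\<close> or \<open>1\<close>, and not both are \<open>1\<close>. Hence \<open>\<epsilon>\<close> is one of the two characters,
  and the argument proceeds as for the dual numbers; the two cases correspond to each other under
  the anti-automorphism that exchanges \<open>p\<close> and \<open>q\<close>.
\<close>
lemma triangular_structure_bialgebra:
  assumes s: "structure_equations triangular_table (tri 1 1 0) D E" and E3: "E 3 = 0"
  shows "(E = tri 1 0 0 \<and> (\<exists>a c. D = triangular_comult1 a c)) \<or>
    (E = tri 0 1 0 \<and> (\<exists>a c. D = triangular_comult2 a c))"
proof -
  note mult = structure_equationsD(4)[OF s, unfolded sum_3]
  note sm = triangular_table_def tensor_product_coeff_triangular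
  note counit = structure_equationsD(2,3)[OF s, unfolded sum_3]
  note cm = structure_equationsD(6)[OF s, unfolded sum_3]
  note coassoc = structure_equationsD(1)[OF s, unfolded sum_3]
  note unit = structure_equationsD(5)[OF s, unfolded sum_3]
  have nil: "D 3 1 1 = 0" "D 3 1 2 = 0" "D 3 2 1 = 0" "D 3 2 2 = 0"
    using mult[of 3 3 1 1] mult[of 3 3 1 2] mult[of 3 3 2 1] mult[of 3 3 2 2] by (simp_all add: sm)
  have idem: "a = 0 \<or> a = 1" if "a = a * a * d" "d = d * d" for a d :: complex
    using that by (metis mult_cancel_left2 mult_zero_right mult.right_neutral)
  have E1: "E 1 = 0 \<or> E 1 = 1" and E2: "E 2 = 0 \<or> E 2 = 1"
    using cm[of 1 1 1] mult[of 1 1 1 1] cm[of 2 2 2] mult[of 2 2 2 2] E3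
    by (intro idem[of _ "D 1 1 1"] idem[of _ "D 2 2 2"]; simp add: sm mult_ac)+
  have "E 1 \<noteq> 0 \<or> E 2 \<noteq> 0" using counit(1)[of 1 1] E3 by auto
  moreover have "\<not> (E 1 = 1 \<and> E 2 = 1)"
  proof
    assume E: "E 1 = 1 \<and> E 2 = 1"
    have "D 2 1 2 = 0" "D 1 2 1 = 0" using cm[of 1 2 2] cm[of 2 1 1] E E3 by (simp_all add: triangular_table_def)
    then have "D 3 1 3 = 0" "D 3 2 3 = 0" using mult[of 2 3 1 3] mult[of 3 1 2 3] by (simp_all add: sm nil)
    then show False using counit(1)[of 3 3] E3 by simp
  qed
  ultimately consider "E 1 = 1" "E 2 = 0" | "E 1 = 0" "E 2 = 1" using E1 E2 by blast
  then show ?thesis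
  proof cases
    case 1
    have c: "D i 1 r = (if r = i then 1 else 0)" "D i r 1 = (if r = i then 1 else 0)" for i r
      using counit[of i r] by (simp_all add: 1 E3)
    \<comment> \<open>The axiom on \<open>\<Delta>(1)\<close> at the coefficient of \<open>q \<otimes> p \<otimes> q\<close>.\<close>
    have T: "D 1 2 2 + D 2 2 2 = 1" using unit[of 2 2 1] by (simp add: triangular_table_def c)
    have i12: "D 1 2 2 * D 2 2 2 = 0" using mult[of 1 2 2 2] by (simp add: sm)
    have "D 2 2 2 \<noteq> 0"
    proof
      assume D2: "D 2 2 2 = 0"
      then have "D 1 2 2 = 1" using T by simp
      moreover have "D 3 2 3 = 0" using mult[of 2 3 2 3] by (simp add: sm nil D2)
      ultimately show False using coassoc[of 3 3 2 2] by (simp add: nil c D2)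
    qed
    with i12 T have D22: "D 1 2 2 = 0" "D 2 2 2 = 1" by auto
    have z: "D 1 2 3 = 0" "D 1 3 2 = 0" "D 2 2 3 = 0" "D 2 3 2 = 0"
      using mult[of 1 1 2 3] mult[of 1 1 3 2] mult[of 2 2 2 3] mult[of 2 2 3 2] by (simp_all add: sm D22 c)
    have z3: "D 3 2 3 = 0" "D 3 3 2 = 0"
      using mult[of 3 1 2 3] mult[of 3 1 3 2] by (simp_all add: sm D22 c nil)
    have "D 1 3 3 + D 2 3 3 = 0" using mult[of 2 1 3 3] by (simp add: sm D22 c z)
    then have "D 2 3 3 = - D 1 3 3" by (simp add: add_eq_0_iff)
    then have "D = triangular_comult1 (D 1 3 3) (D 3 3 3)"
      unfolding triangular_comult1_def tri_eq_iff by (simp add: c D22 z z3 nil)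
    moreover have "E = tri 1 0 0" by (simp add: tri_eq_iff 1 E3)
    ultimately show ?thesis by blast
  next
    case 2
    have c: "D i 2 r = (if r = i then 1 else 0)" "D i r 2 = (if r = i then 1 else 0)" for i r
      using counit[of i r] by (simp_all add: 2 E3)
    \<comment> \<open>The axiom on \<open>\<Delta>(1)\<close> at the coefficient of \<open>p \<otimes> q \<otimes> p\<close>.\<close>
    have T: "D 1 1 1 + D 2 1 1 = 1" using unit[of 1 1 2] by (simp add: triangular_table_def c)
    have i12: "D 1 1 1 * D 2 1 1 = 0" using mult[of 1 2 1 1] by (simp add: sm)
    have "D 1 1 1 \<noteq> 0"
    proof
      assume D1: "D 1 1 1 = 0"
      then have "D 2 1 1 = 1" using T by simp
      moreover have "D 3 1 3 = 0" using mult[of 3 1 1 3] by (simp add: sm c nil D1)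
      ultimately show False using coassoc[of 3 3 1 1] by (simp add: nil c D1)
    qed
    with i12 T have D11: "D 1 1 1 = 1" "D 2 1 1 = 0" by auto
    have z: "D 1 1 3 = 0" "D 1 3 1 = 0" "D 2 1 3 = 0" "D 2 3 1 = 0"
      using mult[of 1 1 1 3] mult[of 1 1 3 1] mult[of 2 2 1 3] mult[of 2 2 3 1] by (simp_all add: sm D11 c)
    have z3: "D 3 1 3 = 0" "D 3 3 1 = 0"
      using mult[of 2 3 1 3] mult[of 2 3 3 1] by (simp_all add: sm D11 c nil z)
    have "D 1 3 3 + D 2 3 3 = 0" using mult[of 2 1 3 3] by (simp add: sm D11 c z)
    then have "D 1 3 3 = - D 2 3 3" by (simp add: add_eq_0_iff2)
    then have "D = triangular_comult2 (D 2 3 3) (D 3 3 3)"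
      unfolding triangular_comult2_def tri_eq_iff by (simp add: c D11 z z3 nil)
    moreover have "E = tri 0 1 0" by (simp add: tri_eq_iff 2 E3)
    ultimately show ?thesis by blast
  qed
qed

text \<open>
  If \<open>\<epsilon>(n) \<noteq> 0\<close>, a change of basis achieves \<open>\<epsilon>(p) = \<epsilon>(n) = 1\<close>. The axiom on \<open>\<epsilon>(xyz)\<close>, evaluated at \<open>x = p\<close>
  and at \<open>z = n\<close>, determines the rows with first index \<open>p\<close> and the columns with second index \<open>q\<close>. By the counit
  laws, the rest depends on \<open>\<beta> = \<epsilon>(q)\<close> and two coefficients \<open>x\<close>, \<open>y\<close>, which coassociativity makes \<open>0\<close>;
  the axiom on \<open>\<Delta>(1)\<close> then gives \<open>\<beta> = 1\<close>.
\<close>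
lemma triangular_structure_category:
  assumes s: "structure_equations triangular_table (tri 1 1 0) D E" and E3: "E 3 = 1" and E1: "E 1 = 1"
  shows "E = tri 1 1 1" "D = grouplike_comult"
proof -
  note mult = structure_equationsD(4)[OF s, unfolded sum_3]
  note sm = triangular_table_def tensor_product_coeff_triangular
  note counit = structure_equationsD(2,3)[OF s, unfolded sum_3]
  note cm = structure_equationsD(6)[OF s, unfolded sum_3]
  note coassoc = structure_equationsD(1)[OF s, unfolded sum_3]
  note unit = structure_equationsD(5)[OF s, unfolded sum_3]
  note cms = triangular_table_def E1 E3
  have nil: "D 3 1 1 = 0" "D 3 1 2 = 0" "D 3 2 1 = 0" "D 3 2 2 = 0"
    using mult[of 3 3 1 1] mult[of 3 3 1 2] mult[of 3 3 2 1] mult[of 3 3 2 2] by (simp_all add: sm)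
  have r1: "D 1 1 2 = 0" "D 2 1 2 = 0" using cm[of 1 1 3] cm[of 1 2 3] by (simp_all add: cms)
  have r2: "D 1 1 1 + D 1 1 3 = 1" "D 2 1 1 + D 2 1 3 = 0"
    using cm[of 1 1 1] cm[of 1 2 1] by (simp_all add: cms)
  have N13: "D 3 1 3 = 0" using mult[of 2 3 1 3] by (simp add: sm nil r1)
  have "D 1 1 1 \<noteq> 0"
  proof
    assume "D 1 1 1 = 0"
    moreover from this have "D 1 1 3 = 0" using mult[of 1 1 1 3] by (simp add: sm r1)
    ultimately show False using r2 by simp
  qed
  then have P1: "D 1 1 1 = 1" "D 1 1 3 = 0" "D 2 1 1 = 0" "D 2 1 3 = 0"
    using mult[of 1 1 1 1] mult[of 1 2 1 1] r2 by (auto simp: sm)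
  have c2: "E 2 * D 1 2 2 + D 1 3 2 = 0" "E 2 * D 2 2 2 + D 2 3 2 = 1"  "E 2 * D 3 2 2 + D 3 3 2 = 0"
    using cm[of 2 1 3] cm[of 2 2 3] cm[of 2 3 3] by (simp_all add: cms mult_ac)
  have "D 2 2 2 \<noteq> 0"
  proof
    assume "D 2 2 2 = 0"
    moreover from this have "D 2 3 2 = 0" using mult[of 2 2 3 2] by (simp add: sm r1)
    ultimately show False using c2 by simp
  qed
  then have Q2: "D 2 2 2 = 1" "D 1 2 2 = 0" using mult[of 2 2 2 2] mult[of 1 2 2 2] by (auto simp: sm)
  define \<beta> where "\<beta> = E 2"
  define x y where "x = D 1 2 1" and "y = D 2 2 1"
  have v1: "D 1 3 2 = 0" "D 2 3 2 = 1 - \<beta>" "D 3 3 2 = 0" using c2 by (simp_all add: Q2 nil \<beta>_def algebra_simps)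
  have v2: "D 1 2 3 = - x" "D 2 2 3 = 1 - \<beta> - y" "D 3 2 3 = 0"
    using counit(2)[of 1 2] counit(2)[of 2 2] counit(2)[of 3 2]
    by (simp_all add: E1 E3 Q2 nil x_def y_def \<beta>_def algebra_simps add_eq_0_iff)
  have v3: "D 1 3 1 = - \<beta> * x" "D 2 3 1 = - \<beta> * y" "D 3 3 1 = 0" "D 1 3 3 = \<beta> * x" "D 3 3 3 = 1"
      "D 2 3 3 = - \<beta> * (1 - \<beta> - y)"
    using counit(1)[of 1 1] counit(1)[of 2 1] counit(1)[of 3 1] counit(1)[of 1 3] counit(1)[of 2 3]
      counit(1)[of 3 3]
    by (simp_all add: E1 E3 P1 nil N13 v2 x_def[symmetric] y_def[symmetric] \<beta>_def[symmetric]
        add_eq_0_iff algebra_simps)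
  note vs = nil r1 N13 P1 Q2 v1 v2 v3 x_def[symmetric] y_def[symmetric]
  have x0: "x = 0"
  proof -
    have "x * (1 - \<beta>) = - \<beta> * x * x" using coassoc[of 1 1 3 2] by (simp add: vs)
    moreover have "x * x = x" using mult[of 1 1 2 1] by (simp add: sm vs)
    ultimately show ?thesis by (simp add: algebra_simps)
  qed
  have y0: "y = 0" using coassoc[of 2 2 2 3] by (simp add: vs)
  \<comment> \<open>The axiom on \<open>\<Delta>(1)\<close> at the coefficient of \<open>q \<otimes> n \<otimes> p\<close>.\<close>
  have "\<beta> = 1" using unit[of 1 2 3] by (simp add: vs x0 y0 triangular_table_def)
  then show "E = tri 1 1 1" "D = grouplike_comult"
    unfolding grouplike_comult_def tri_eq_iff by (simp_all add: vs x0 y0 E1 E3 \<beta>_def)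
qed

section \<open>Function algebras and finite categories\<close>

text \<open>
  A category with set of morphisms \<open>'n\<close>, described by its partial composition \<open>t\<close> and its set \<open>I\<close> of identities.
  The second condition says that composability depends on adjacent pairs only, which distinguishes categories
  from other partial semigroups with local units.
\<close>
definition partial_category :: "('n \<Rightarrow> 'n \<Rightarrow> 'n option) \<Rightarrow> 'n set \<Rightarrow> bool" where
  "partial_category t I \<longleftrightarrow>
    (\<forall>i j k. Option.bind (t i j) (\<lambda>x. t x k) = Option.bind (t j k) (\<lambda>x. t i x)) \<and>
    (\<forall>i j k. t i j \<noteq> None \<and> t j k \<noteq> None \<longrightarrow> Option.bind (t i j) (\<lambda>x. t x k) \<noteq> None) \<and>
    (\<forall>x. \<exists>u\<in>I. t u x = Some x) \<and> (\<forall>x. \<exists>u\<in>I. t x u = Some x) \<and>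
    (\<forall>u\<in>I. \<forall>x. t u x \<in> {None, Some x} \<and> t x u \<in> {None, Some x})"

text \<open>
  The comultiplication dual to composition: \<open>\<Delta>(k)\<close> is the sum of \<open>i \<otimes> j\<close> over all factorisations
  \<open>k = i j\<close>.
\<close>
definition function_comult :: "('n \<Rightarrow> 'n \<Rightarrow> 'n option) \<Rightarrow> 'n \<Rightarrow> 'n \<Rightarrow> 'n \<Rightarrow> complex" where
  "function_comult t k i j = of_bool (t i j = Some k)"

definition function_counit :: "'n set \<Rightarrow> 'n \<Rightarrow> complex" where
  "function_counit I i = of_bool (i \<in> I)"

lemma sum_idempotent_table:
  fixes f :: "'n::finite \<Rightarrow> complex" and g :: "'n \<Rightarrow> 'n \<Rightarrow> complex"
  shows "(\<Sum>l\<in>UNIV. idempotent_table i j l * f l) = of_bool (i = j) * f j"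
    and "(\<Sum>l\<in>UNIV. f l * idempotent_table i l j) = of_bool (i = j) * f j"
    and "(\<Sum>l\<in>UNIV. f l * idempotent_table l i j) = of_bool (i = j) * f j"
    and "(\<Sum>a\<in>UNIV. \<Sum>c\<in>UNIV. g a c * idempotent_table a c r) = g r r"
proof -
  have eq: "idempotent_table i j l * f l = (if l = j then of_bool (i = j) * f l else 0)"
    "f l * idempotent_table i l j = (if l = j then of_bool (i = j) * f l else 0)"
    "f l * idempotent_table l i j = (if l = j then of_bool (i = j) * f l else 0)" for l
    by (auto simp: idempotent_table_def)
  show "(\<Sum>l\<in>UNIV. idempotent_table i j l * f l) = of_bool (i = j) * f j"
    "(\<Sum>l\<in>UNIV. f l * idempotent_table i l j) = of_bool (i = j) * f j"
    "(\<Sum>l\<in>UNIV. f l * idempotent_table l i j) = of_bool (i = j) * f j"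
    unfolding eq by simp_all
  have "g a c * idempotent_table a c r = (if c = r then if a = r then g a r else 0 else 0)" for a c
    by (auto simp: idempotent_table_def)
  then show "(\<Sum>a\<in>UNIV. \<Sum>c\<in>UNIV. g a c * idempotent_table a c r) = g r r" by simp
qed

lemma tensor_product_coeff_idempotent:
  "tensor_product_coeff idempotent_table X Y r s = X r s * Y r s"
proof -
  have "tensor_product_coeff idempotent_table X Y r s =
    (\<Sum>a\<in>UNIV. \<Sum>b\<in>UNIV. \<Sum>c\<in>UNIV. (\<Sum>d\<in>UNIV. X a b * Y c d * idempotent_table b d s) * idempotent_table a c r)"
    by (simp add: tensor_product_coeff_def sum_distrib_left sum_distrib_right mult_ac)
  also have "\<dots> = (\<Sum>a\<in>UNIV. \<Sum>c\<in>UNIV. (\<Sum>b\<in>UNIV. \<Sum>d\<in>UNIV. X a b * Y c d * idempotent_table b d s) * idempotent_table a c r)"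
    by (rule sum.cong[OF refl], subst sum.swap) (simp add: sum_distrib_right)
  also have "\<dots> = X r s * Y r s" by (simp only: sum_idempotent_table(4))
  finally show ?thesis .
qed

lemma sum_function_comult:
  fixes f :: "'n::finite \<Rightarrow> complex"
  shows "(\<Sum>l\<in>UNIV. f l * function_comult t l i j) = (case t i j of None \<Rightarrow> 0 | Some l \<Rightarrow> f l)"
proof (cases "t i j")
  case (Some m)
  have "f l * function_comult t l i j = (if l = m then f l else 0)" for l
    using Some by (simp add: function_comult_def)
  then show ?thesis using Some by simp
qed (simp add: function_comult_def)

text \<open>
  With orthogonal idempotents, products of tensors are pointwise products of coefficients.
\<close>
lemma structure_equations_idempotent:
  fixes D :: "'n::finite \<Rightarrow> 'n \<Rightarrow> 'n \<Rightarrow> complex"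
  shows "structure_equations idempotent_table (\<lambda>_. 1) D E \<longleftrightarrow>
    (\<forall>r i j k. (\<Sum>l\<in>UNIV. D r l k * D l i j) = (\<Sum>l\<in>UNIV. D r i l * D l j k)) \<and>
    (\<forall>i r. (\<Sum>l\<in>UNIV. E l * D i l r) = of_bool (r = i)) \<and>
    (\<forall>i r. (\<Sum>l\<in>UNIV. E l * D i r l) = of_bool (r = i)) \<and>
    (\<forall>i j r s. of_bool (i = j) * D j r s = D i r s * D j r s) \<and>
    (\<forall>i j k. (\<Sum>l\<in>UNIV. (\<Sum>m\<in>UNIV. D m l k) * D l i j) =
      (\<Sum>m\<in>UNIV. D m i j) * (\<Sum>m\<in>UNIV. D m j k)) \<and>
    (\<forall>i j k. of_bool (i = j \<and> j = k) * E k = D j i k * E i * E k)"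
proof -
  have assoc: "(of_bool (i = j) * idempotent_table j k r = of_bool (j = k) * idempotent_table i k r) \<longleftrightarrow> True"
    for i j k r :: 'n by (auto simp: idempotent_table_def)
  have unit: "(\<Sum>l\<in>UNIV. idempotent_table l i r) = of_bool (r = i)"
    "(\<Sum>l\<in>UNIV. idempotent_table i l r) = of_bool (r = i)" for i r :: 'n
    using sum_idempotent_table(2,3)[of "\<lambda>_::'n. 1"] by auto
  have delta: "(\<Sum>a\<in>UNIV. \<Sum>b\<in>UNIV. D j a b * (of_bool (i = a) * E a) * (of_bool (b = k) * E k)) =
      D j i k * E i * E k" for i j k
  proof -
    have "D j a b * (of_bool (i = a) * E a) * (of_bool (b = k) * E k) =
      (if b = k then if a = i then D j a b * E a * E b else 0 else 0)" for a b by auto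
    then show ?thesis by simp
  qed
  have conj: "of_bool P * (of_bool Q * x) = of_bool (P \<and> Q) * x" for P Q and x :: complex by simp
  have sym: "idempotent_table b a j = idempotent_table a b j" for a b j :: 'n
    by (auto simp: idempotent_table_def)
  have T: "(\<Sum>a\<in>UNIV. \<Sum>b\<in>UNIV. X a * Y b * idempotent_table a b j) = X j * Y j"
    "(\<Sum>a\<in>UNIV. \<Sum>b\<in>UNIV. X a * Y b * idempotent_table b a j) = X j * Y j" for X Y and j :: 'n
    unfolding sym[of _ _ j] by (rule sum_idempotent_table)+
  have bool: "(if P then 1 else 0) = (of_bool P :: complex)" for P by simp
  show ?thesis
    unfolding structure_equations_def Let_def tensor_product_coeff_idempotent
    by (simp only: mult_1 assoc unit delta conj T bool sum_idempotent_table(1) simp_thms)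
qed

lemma partial_categoryD:
  assumes "partial_category t I"
  shows "Option.bind (t i j) (\<lambda>x. t x k) = Option.bind (t j k) (\<lambda>x. t i x)"
    and "t i j \<noteq> None \<Longrightarrow> t j k \<noteq> None \<Longrightarrow> Option.bind (t i j) (\<lambda>x. t x k) \<noteq> None"
    and "\<exists>u\<in>I. t u x = Some x" and "\<exists>u\<in>I. t x u = Some x"
    and "u \<in> I \<Longrightarrow> t u x \<in> {None, Some x}" and "u \<in> I \<Longrightarrow> t x u \<in> {None, Some x}"
  using assms unfolding partial_category_def by blast+

text \<open>
  If \<open>u\<close> and \<open>v\<close> are left identities of \<open>x\<close>, then \<open>u (v x)\<close> is defined, hence so is \<open>u v\<close>, and the composite equals both of them.
\<close>
lemma unit_unique:
  assumes c: "partial_category t I" and "u \<in> I" "v \<in> I"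
  shows "t u x = Some x \<Longrightarrow> t v x = Some x \<Longrightarrow> u = v" "t x u = Some x \<Longrightarrow> t x v = Some x \<Longrightarrow> u = v"
    and "t u v = (if u = v then Some u else None)"
proof -
  note a = partial_categoryD(1)[OF c] and lr = partial_categoryD(5,6)[OF c]
  have n: "u = v" if "t u v \<noteq> None" "u \<in> I" "v \<in> I" for u v
    using lr(1)[of u v] lr(2)[of v u] that by auto
  show "u = v" if "t u x = Some x" "t v x = Some x"
    using a[of u v x] that by (intro n assms) (auto split: bind_splits)
  show "u = v" if "t x u = Some x" "t x v = Some x"
    using a[of x u v] that by (intro n assms) (auto split: bind_splits)
  show "t u v = (if u = v then Some u else None)"
  proof (cases "u = v")
    case True
    obtain w where "w \<in> I" "t w u = Some u" using partial_categoryD(3)[OF c] by blast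
    moreover from this have "w = u" by (intro n assms) simp
    ultimately show ?thesis using True by simp
  next
    case False
    then show ?thesis using n[of u v] assms by (cases "t u v") auto
  qed
qed

theorem structure_equations_of_category:
  fixes t :: "'n::finite \<Rightarrow> 'n \<Rightarrow> 'n option"
  assumes c: "partial_category t I"
  shows "structure_equations idempotent_table (\<lambda>_. 1) (function_comult t) (function_counit I)"
  unfolding structure_equations_idempotent
proof (intro conjI allI)
  fix r i j k s :: 'n
  have T: "(\<Sum>m\<in>UNIV. function_comult t m i j) = of_bool (t i j \<noteq> None)" for i j
    using sum_function_comult[of "\<lambda>_. 1" t i j] by (auto split: option.splits)
  note a = partial_categoryD(1)[OF c, of i j k]
  show "(\<Sum>l\<in>UNIV. function_comult t r l k * function_comult t l i j) =
      (\<Sum>l\<in>UNIV. function_comult t r i l * function_comult t l j k)"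
    unfolding sum_function_comult using a
    by (cases "t i j"; cases "t j k") (simp_all add: function_comult_def)
  note comp = partial_categoryD(2)[OF c, of i j k]
  show "(\<Sum>l\<in>UNIV. (\<Sum>m\<in>UNIV. function_comult t m l k) * function_comult t l i j) =
      (\<Sum>m\<in>UNIV. function_comult t m i j) * (\<Sum>m\<in>UNIV. function_comult t m j k)"
    unfolding T sum_function_comult using a comp
    by (cases "t i j"; cases "t j k") simp_all
  show "of_bool (i = j) * function_comult t j r s = function_comult t i r s * function_comult t j r s"
    by (auto simp: function_comult_def)
  show "of_bool (i = j \<and> j = k) * function_counit I k =
      function_comult t j i k * function_counit I i * function_counit I k"
    using unit_unique(3)[OF c, of i k]
    by (auto simp: function_comult_def function_counit_def split: if_splits)
  obtain u where u: "u \<in> I" "t u r = Some r" using partial_categoryD(3)[OF c] by blast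
  have "function_counit I l * function_comult t i l r = (if l = u then of_bool (r = i) else 0)" for l
  proof (cases "l \<in> I \<and> t l r = Some r")
    case True
    then have "u = l" using unit_unique(1)[OF c u(1) _ u(2)] by blast
    then show ?thesis using u by (simp add: function_comult_def function_counit_def)
  next
    case False
    then have "l \<noteq> u" using u by blast
    then show ?thesis using False partial_categoryD(5)[OF c, of l r]
      by (auto simp: function_comult_def function_counit_def)
  qed
  then show "(\<Sum>l\<in>UNIV. function_counit I l * function_comult t i l r) = of_bool (r = i)" by simp
  obtain u where u: "u \<in> I" "t r u = Some r" using partial_categoryD(4)[OF c] by blast
  have "function_counit I l * function_comult t i r l = (if l = u then of_bool (r = i) else 0)" for l
  proof (cases "l \<in> I \<and> t r l = Some r")
    case True
    then have "u = l" using unit_unique(2)[OF c u(1) _ u(2)] by blast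
    then show ?thesis using u by (simp add: function_comult_def function_counit_def)
  next
    case False
    then have "l \<noteq> u" using u by blast
    then show ?thesis using False partial_categoryD(6)[OF c, of l r]
      by (auto simp: function_comult_def function_counit_def)
  qed
  then show "(\<Sum>l\<in>UNIV. function_counit I l * function_comult t i r l) = of_bool (r = i)" by simp
qed

text \<open>
  Multiplicativity of \<open>\<Delta>\<close> makes the coefficients at each pair \<open>(i, j)\<close> idempotent and orthogonal in \<open>k\<close>: at most one of
  them is \<open>1\<close>, and this defines \<open>t i j\<close>. The condition on \<open>\<epsilon>(xyz)\<close> makes the values of \<open>\<epsilon>\<close> idempotent.
\<close>
theorem category_of_structure_equations:
  fixes D :: "'n::finite \<Rightarrow> 'n \<Rightarrow> 'n \<Rightarrow> complex"
  assumes "structure_equations idempotent_table (\<lambda>_. 1) D E"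
  obtains t I where "partial_category t I" "D = function_comult t" "E = function_counit I"
proof -
  note eqs = assms[unfolded structure_equations_idempotent]
  note coassoc = conjunct1[OF eqs, rule_format]
  note e2 = conjunct2[OF eqs]
  note e3 = conjunct2[OF e2]
  note e4 = conjunct2[OF e3]
  note e5 = conjunct2[OF e4]
  note counit = conjunct1[OF e2, rule_format] conjunct1[OF e3, rule_format]
  note mult = conjunct1[OF e4, rule_format]
  note unit = conjunct1[OF e5, rule_format]
  note cm = conjunct2[OF e5, rule_format]
  define t where "t i j = (if \<exists>k. D k i j \<noteq> 0 then Some (SOME k. D k i j \<noteq> 0) else None)" for i j
  define I where "I = {i. E i \<noteq> 0}"
  have D01: "D k i j = 0 \<or> D k i j = 1" for k i j using mult[of k k i j] by simp
  have Duniq: "k = l" if "D k i j \<noteq> 0" "D l i j \<noteq> 0" for k l i j using mult[of k l i j] that by (cases "k = l") auto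
  have t: "t i j = Some k \<longleftrightarrow> D k i j \<noteq> 0" for i j k
  proof
    assume "t i j = Some k"
    then have "\<exists>k. D k i j \<noteq> 0" "k = (SOME k. D k i j \<noteq> 0)" by (auto simp: t_def split: if_splits)
    then show "D k i j \<noteq> 0" using someI_ex[of "\<lambda>k. D k i j \<noteq> 0"] by simp
  next
    assume k: "D k i j \<noteq> 0"
    then have "D (SOME k. D k i j \<noteq> 0) i j \<noteq> 0" by (rule someI)
    then have "(SOME k. D k i j \<noteq> 0) = k" using k by (rule Duniq)
    then show "t i j = Some k" using k by (auto simp: t_def)
  qed
  have D: "D = function_comult t"
    using D01 by (auto simp: fun_eq_iff function_comult_def t)
  have "E i = 0 \<or> E i = 1" for i
    using cm[of i i i] D01[of i i i] by (cases "D i i i = 0") simp_all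
  then have E: "E = function_counit I" by (auto simp: fun_eq_iff function_counit_def I_def)
  have T: "(\<Sum>m\<in>UNIV. D m i j) = of_bool (t i j \<noteq> None)" for i j
    using sum_function_comult[of "\<lambda>_. 1" t i j] by (auto simp: D split: option.splits)
  have "partial_category t I"
    unfolding partial_category_def
  proof (intro conjI allI ballI impI)
    fix i j k x
    have "Option.bind (t i j) (\<lambda>x. t x k) = Some r \<longleftrightarrow> Option.bind (t j k) (\<lambda>x. t i x) = Some r" for r
      using coassoc[of r k i j] unfolding D sum_function_comult
      by (cases "t i j"; cases "t j k") (simp_all add: function_comult_def of_bool_eq_iff)
    then show "Option.bind (t i j) (\<lambda>x. t x k) = Option.bind (t j k) (\<lambda>x. t i x)"
      by (metis not_Some_eq)
    show "Option.bind (t i j) (\<lambda>x. t x k) \<noteq> None" if "t i j \<noteq> None \<and> t j k \<noteq> None"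
      using unit[of k i j] that unfolding T unfolding D sum_function_comult
      by (cases "t i j") auto
    show "\<exists>u\<in>I. t u x = Some x"
    proof (rule ccontr)
      assume "\<not> ?thesis"
      then have "E l * D x l x = 0" for l by (auto simp: I_def t)
      then have "(\<Sum>l\<in>UNIV. E l * D x l x) = 0" by (intro sum.neutral) blast
      then show False using counit(1)[of x x] by simp
    qed
    show "\<exists>u\<in>I. t x u = Some x"
    proof (rule ccontr)
      assume "\<not> ?thesis"
      then have "E l * D x x l = 0" for l by (auto simp: I_def t)
      then have "(\<Sum>l\<in>UNIV. E l * D x x l) = 0" by (intro sum.neutral) blast
      then show False using counit(2)[of x x] by simp
    qed
    fix u assume u: "u \<in> I"
    have laws: "t u x = Some y \<Longrightarrow> y = x" "t x u = Some y \<Longrightarrow> y = x" for y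
    proof -
      have pos: "(\<Sum>l\<in>UNIV. f l) \<noteq> (0::complex)" if "\<And>l. f l = 0 \<or> f l = 1" "f u = 1" for f
      proof -
        have "f l = of_nat (if f l = 1 then 1 else 0)" for l using that(1)[of l] by auto
        then have "(\<Sum>l\<in>UNIV. f l) = of_nat (\<Sum>l\<in>UNIV. if f l = 1 then 1 else 0)"
          unfolding of_nat_sum by (rule sum.cong[OF refl])
        moreover have "(\<Sum>l\<in>UNIV. if f l = 1 then 1 else 0 :: nat) \<noteq> 0" using that(2) by auto
        ultimately show ?thesis by (metis of_nat_eq_0_iff)
      qed
      have ED: "E l * D y a b = 0 \<or> E l * D y a b = 1" for l y a b
        unfolding D E by (auto simp: function_comult_def function_counit_def)
      have Eu: "E u = 1" using u unfolding E by (simp add: function_counit_def)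
      show "y = x" if "t u x = Some y"
      proof -
        have "E u * D y u x = 1" using that D01[of y u x] by (auto simp: t Eu)
        then have "(\<Sum>l\<in>UNIV. E l * D y l x) \<noteq> 0" using ED by (intro pos) auto
        then show ?thesis unfolding counit by auto
      qed
      show "y = x" if "t x u = Some y"
      proof -
        have "E u * D y x u = 1" using that D01[of y x u] by (auto simp: t Eu)
        then have "(\<Sum>l\<in>UNIV. E l * D y x l) \<noteq> 0" using ED by (intro pos) auto
        then show ?thesis unfolding counit by auto
      qed
    qed
    show "t u x \<in> {None, Some x}" using laws(1) by (cases "t u x") auto
    show "t x u \<in> {None, Some x}" using laws(2) by (cases "t x u") auto
  qed
  then show thesis using D E by (rule that)
qed

section \<open>Categories with three morphisms\<close>

text \<open>
  The categories behind the entries over \<open>A1\<close>, in the order of that list, with respect to the minimal idempotents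
  \<open>e1 - e2\<close>, \<open>e2 - e3\<close>, \<open>e3\<close>.
\<close>
definition A1_categories :: "((3 \<Rightarrow> 3 \<Rightarrow> 3 option) \<times> 3 set) list" where
  "A1_categories =
   [(mat3 (Some 2) (Some 3) (Some 1) (Some 3) (Some 1) (Some 2) (Some 1) (Some 2) (Some 3), {3}),
    (mat3 (Some 1) (Some 1) (Some 1) (Some 1) (Some 2) (Some 2) (Some 1) (Some 2) (Some 3), {3}),
    (mat3 (Some 1) (Some 1) (Some 1) (Some 1) (Some 2) (Some 3) (Some 1) (Some 3) (Some 2), {2}),
    (mat3 (Some 1) (Some 1) (Some 1) (Some 1) (Some 1) (Some 2) (Some 1) (Some 2) (Some 3), {3}),
    (mat3 (Some 1) (Some 1) (Some 3) (Some 1) (Some 2) (Some 3) (Some 1) (Some 3) (Some 3), {2}),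
    (mat3 (Some 1) (Some 1) (Some 1) (Some 1) (Some 2) (Some 3) (Some 3) (Some 3) (Some 3), {2}),
    (mat3 (Some 2) (Some 1) (Some 1) (Some 1) (Some 2) (Some 2) (Some 1) (Some 2) (Some 3), {3}),
    (mat3 (Some 1) None None None (Some 2) (Some 2) None (Some 2) (Some 3), {1, 3}),
    (mat3 (Some 1) None None None (Some 2) (Some 3) None (Some 3) (Some 2), {1, 2}),
    (mat3 (Some 1) None None None (Some 2) None None None (Some 3), {1, 2, 3}),
    (mat3 None (Some 1) None None (Some 2) None (Some 1) None (Some 3), {2, 3})]"

definition idempotent_basis :: "3 \<Rightarrow> complex ^ 3" where
  "idempotent_basis = tri (e1 - e2) (e2 - e3) e3"

definition idempotent_coord :: "3 \<Rightarrow> complex ^ 3 \<Rightarrow> complex" where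
  "idempotent_coord = tri (\<lambda>v. v $ 1) (\<lambda>v. v $ 1 + v $ 2) (\<lambda>v. v $ 1 + v $ 2 + v $ 3)"

lemma coordinates_idempotent_basis: "coordinates idempotent_basis idempotent_coord"
proof (rule coordinates.intro)
  have "\<forall>i. clinear (idempotent_coord i)"
    unfolding forall_3 idempotent_coord_def tri_simps
    by (intro conjI clinearI) (simp_all add: scaleC_complex_def algebra_simps)
  then show "clinear (idempotent_coord i)" for i by blast
  have "\<forall>i j. idempotent_coord i (idempotent_basis j) = (if i = j then 1 else 0)"
    by (simp add: forall_3 idempotent_coord_def idempotent_basis_def axis_def)
  then show "idempotent_coord i (idempotent_basis j) = (if i = j then 1 else 0)" for i j by blast
  show "(\<Sum>i\<in>UNIV. idempotent_coord i x *\<^sub>C idempotent_basis i) = x" for x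
    by (simp add: vec_eq_iff forall_3 sum_3 idempotent_coord_def idempotent_basis_def axis_def)
qed

lemma linear_data_A1:
  assumes "\<forall>k i j. std2 i j (lin3 d1 d2 d3 (idempotent_basis k)) =
      (\<Sum>l\<in>UNIV. \<Sum>m\<in>UNIV. function_comult t k l m * (idempotent_basis l $ i * idempotent_basis m $ j))"
    and "\<forall>k. lin3 c1 c2 c3 (idempotent_basis k) = function_counit I k"
  shows "linear_data idempotent_basis idempotent_coord (bialg A1_mult d1 d2 d3 c1 c2 c3)
    idempotent_table (function_comult t) (\<lambda>_. 1) (function_counit I)"
  unfolding A1_mult_def
proof (rule linear_data_bialg[OF coordinates_idempotent_basis])
  have "\<forall>i j. table_mult e3 e3 e3 (idempotent_basis i \<otimes> idempotent_basis j) =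
    (\<Sum>k\<in>UNIV. idempotent_table i j k *\<^sub>C idempotent_basis k)"
    by (simp add: forall_3 sum_3 table_mult_tens lin3_def vec_eq_iff idempotent_basis_def axis_def
        idempotent_table_def)
  then show "table_mult e3 e3 e3 (idempotent_basis i \<otimes> idempotent_basis j) =
    (\<Sum>k\<in>UNIV. idempotent_table i j k *\<^sub>C idempotent_basis k)" for i j by blast
  show "e1 = (\<Sum>k\<in>UNIV. 1 *\<^sub>C idempotent_basis k)"
    by (simp add: sum_3 idempotent_basis_def scaleC_one)
qed (use assms in blast)+

lemma A1_data:
  "list_all2 (\<lambda>S (t, I). linear_data idempotent_basis idempotent_coord S
     idempotent_table (function_comult t) (\<lambda>_. 1) (function_counit I)) A1_bialgs A1_categories"
  unfolding A1_bialgs_def A1_categories_def list_all2_Cons list_all2_Nil prod.case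
  by (intro conjI linear_data_A1 TrueI;
      simp add: forall_3 sum_3 lin3_def std2_simps std2_tens idempotent_basis_def axis_def
        function_comult_def function_counit_def scaleC_complex_def)

lemma A1_categories_partial_category:
  "\<forall>(t, I) \<in> set A1_categories. partial_category t I"
  unfolding A1_categories_def partial_category_def forall_3
  by simp

lemma A1_category_of_bialg:
  assumes "S \<in> set A1_bialgs"
  obtains t I where "(t, I) \<in> set A1_categories" "linear_data idempotent_basis idempotent_coord S
     idempotent_table (function_comult t) (\<lambda>_. 1) (function_counit I)"
proof -
  obtain n where n: "n < length A1_bialgs" "S = A1_bialgs ! n" using assms by (auto simp: in_set_conv_nth)
  obtain t I where tI: "A1_categories ! n = (t, I)" by (cases "A1_categories ! n")
  have "n < length A1_categories" using n(1) list_all2_lengthD[OF A1_data] by simp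
  then have "(t, I) \<in> set A1_categories" unfolding tI[symmetric] by (rule nth_mem)
  moreover have "linear_data idempotent_basis idempotent_coord S
     idempotent_table (function_comult t) (\<lambda>_. 1) (function_counit I)"
    using list_all2_nthD[OF A1_data n(1)] unfolding tI n(2) by simp
  ultimately show thesis by (rule that)
qed

lemma A1_bialg_of_category:
  assumes "(t, I) \<in> set A1_categories"
  obtains S where "S \<in> set A1_bialgs" "linear_data idempotent_basis idempotent_coord S
     idempotent_table (function_comult t) (\<lambda>_. 1) (function_counit I)"
proof -
  obtain n where n: "n < length A1_categories" "A1_categories ! n = (t, I)"
    using assms by (auto simp: in_set_conv_nth)
  have "n < length A1_bialgs" using n(1) list_all2_lengthD[OF A1_data] by simp
  then have "A1_bialgs ! n \<in> set A1_bialgs" by (rule nth_mem)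
  moreover have "linear_data idempotent_basis idempotent_coord (A1_bialgs ! n)
     idempotent_table (function_comult t) (\<lambda>_. 1) (function_counit I)"
    using list_all2_nthD2[OF A1_data n(1)] unfolding n(2) by simp
  ultimately show thesis by (rule that)
qed

lemma weak_bialgebra_A1:
  assumes "S \<in> set A1_bialgs"
  shows "weak_bialgebra S"
proof -
  obtain t I where tI: "(t, I) \<in> set A1_categories" and ld: "linear_data idempotent_basis idempotent_coord S
     idempotent_table (function_comult t) (\<lambda>_. 1) (function_counit I)"
    using assms by (rule A1_category_of_bialg)
  have "partial_category t I" using tI A1_categories_partial_category by blast
  then show ?thesis
    unfolding linear_data.weak_bialgebra_iff[OF ld] by (rule structure_equations_of_category)
qed

lemma bij_tri: "i \<noteq> j \<Longrightarrow> i \<noteq> k \<Longrightarrow> j \<noteq> k \<Longrightarrow> bij (tri i j k :: 3 \<Rightarrow> 3)"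
proof -
  assume d: "i \<noteq> j" "i \<noteq> k" "j \<noteq> k"
  have "\<forall>x y. tri i j k x = tri i j k y \<longrightarrow> x = y" using d by (simp add: forall_3)
  then have "inj (tri i j k)" by (simp add: inj_def)
  then show ?thesis by (simp add: bij_def finite_UNIV_inj_surj)
qed

lemma idempotent_table_relabel: "bij \<pi> \<Longrightarrow> idempotent_table (\<pi> i) (\<pi> j) (\<pi> k) = idempotent_table i j k"
  by (simp add: idempotent_table_def bij_def inj_eq)

definition category_iso :: "('n \<Rightarrow> 'n) \<Rightarrow> ('n \<Rightarrow> 'n \<Rightarrow> 'n option) \<Rightarrow> 'n set \<Rightarrow> ('n \<Rightarrow> 'n \<Rightarrow> 'n option) \<Rightarrow> 'n set \<Rightarrow> bool" where
  "category_iso \<pi> t I t' I' \<longleftrightarrow> bij \<pi> \<and> (\<forall>i j. t' (\<pi> i) (\<pi> j) = map_option \<pi> (t i j)) \<and>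
     (\<forall>i. \<pi> i \<in> I' \<longleftrightarrow> i \<in> I)"

lemma isomorphic_if_category_iso:
  assumes B: "linear_data b \<beta> B idempotent_table (function_comult t) (\<lambda>_. 1) (function_counit I)"
    and S: "linear_data c \<gamma> S idempotent_table (function_comult t') (\<lambda>_. 1) (function_counit I')"
    and iso: "category_iso \<pi> t I t' I'"
  shows "bialg_isomorphic B S"
proof -
  have bij: "bij \<pi>" and t: "t' (\<pi> i) (\<pi> j) = map_option \<pi> (t i j)" and I: "\<pi> i \<in> I' \<longleftrightarrow> i \<in> I" for i j
    using iso by (auto simp: category_iso_def)
  have "(\<lambda>k i j. function_comult t' (\<pi> k) (\<pi> i) (\<pi> j)) = function_comult t"
    using bij by (auto simp: fun_eq_iff function_comult_def t bij_def inj_eq)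
  moreover have "function_counit I' \<circ> \<pi> = function_counit I"
    by (auto simp: fun_eq_iff function_counit_def I)
  moreover have "(\<lambda>i j k. idempotent_table (\<pi> i) (\<pi> j) (\<pi> k)) = (idempotent_table :: 'a \<Rightarrow> _)"
    using idempotent_table_relabel[OF bij] by (intro ext)
  ultimately have "linear_data (c \<circ> \<pi>) (\<gamma> \<circ> \<pi>) S idempotent_table (function_comult t) ((\<lambda>_. 1) \<circ> \<pi>) (function_counit I)"
    using linear_data.relabel[OF S bij] by simp
  then show ?thesis by (rule linear_data.isomorphic_if_same_constants[OF B])
qed

text \<open>
  The associative completions of a composition table with identity \<open>1\<close>. The eleven tables form seven
  classes under exchanging \<open>2\<close> and \<open>3\<close>.
\<close>
lemma monoid_tables:
  assumes assoc: "\<And>i j k. Option.bind (t i j) (\<lambda>x. t x k) = Option.bind (t j k) (\<lambda>x. t i x)"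
    and t: "t = mat3 (Some 1) (Some 2) (Some 3) (Some 2) (Some a) (Some b) (Some 3) (Some c) (Some d)"
  shows "(a, b, c, d) \<in> {(1,3,3,3), (2,2,2,1), (2,2,2,2), (2,2,2,3), (2,2,3,3), (2,3,2,3), (2,3,3,2),
    (2,3,3,3), (3,1,1,2), (3,2,2,3), (3,3,3,3)}"
  using assoc[of 2 2 2] assoc[of 2 2 3] assoc[of 2 3 2] assoc[of 2 3 3] assoc[of 3 2 2] assoc[of 3 2 3]
    assoc[of 3 3 2] assoc[of 3 3 3] exhaust_3[of a] exhaust_3[of b] exhaust_3[of c] exhaust_3[of d]
  unfolding t by (elim disjE; simp)

lemma category_isoI:
  assumes "n < length A1_categories" "i \<noteq> j" "i \<noteq> k" "j \<noteq> k"
    and "\<forall>x y. fst (A1_categories ! n) (tri i j k x) (tri i j k y) = map_option (tri i j k) (t x y)"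
    and "\<forall>x. tri i j k x \<in> snd (A1_categories ! n) \<longleftrightarrow> x \<in> I"
  shows "\<exists>p \<in> set A1_categories. \<exists>\<pi>. category_iso \<pi> t I (fst p) (snd p)"
proof
  show "A1_categories ! n \<in> set A1_categories" using assms(1) by (rule nth_mem)
  have "category_iso (tri i j k) t I (fst (A1_categories ! n)) (snd (A1_categories ! n))"
    unfolding category_iso_def using assms(5,6) bij_tri[OF assms(2,3,4)] by simp
  then show "\<exists>\<pi>. category_iso \<pi> t I (fst (A1_categories ! n)) (snd (A1_categories ! n))" by blast
qed

theorem monoid_category_iso:
  assumes c: "partial_category t {1}"
  shows "\<exists>p \<in> set A1_categories. \<exists>\<pi>. category_iso \<pi> t {1} (fst p) (snd p)"
proof -
  have u: "t 1 x = Some x" "t x 1 = Some x" for x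
    using partial_categoryD(3,4)[OF c, of x] by simp_all
  have total: "t i j \<noteq> None" for i j
    using partial_categoryD(2)[OF c, of i 1 j] by (simp add: u)
  obtain a where a: "t 2 2 = Some a" using total[of 2 2] by blast
  obtain b where b: "t 2 3 = Some b" using total[of 2 3] by blast
  obtain c' where c': "t 3 2 = Some c'" using total[of 3 2] by blast
  obtain d where d: "t 3 3 = Some d" using total[of 3 3] by blast
  have t: "t = mat3 (Some 1) (Some 2) (Some 3) (Some 2) (Some a) (Some b) (Some 3) (Some c') (Some d)"
    unfolding tri_eq_iff by (simp add: u a b c' d)
  note ss = forall_3 A1_categories_def t
  note tables = monoid_tables[OF partial_categoryD(1)[OF c] t,
    unfolded insert_iff empty_iff prod.inject simp_thms]
  from tables show ?thesis
  proof (elim disjE)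
    assume "a = 1 \<and> b = 3 \<and> c' = 3 \<and> d = 3"
    then show ?thesis by (intro category_isoI[of 2 2 3 1]; simp add: ss)
  next
    assume "a = 2 \<and> b = 2 \<and> c' = 2 \<and> d = 1"
    then show ?thesis by (intro category_isoI[of 2 2 1 3]; simp add: ss)
  next
    assume "a = 2 \<and> b = 2 \<and> c' = 2 \<and> d = 2"
    then show ?thesis by (intro category_isoI[of 3 3 1 2]; simp add: ss)
  next
    assume "a = 2 \<and> b = 2 \<and> c' = 2 \<and> d = 3"
    then show ?thesis by (intro category_isoI[of 1 3 1 2]; simp add: ss)
  next
    assume "a = 2 \<and> b = 2 \<and> c' = 3 \<and> d = 3"
    then show ?thesis by (intro category_isoI[of 5 2 1 3]; simp add: ss)
  next
    assume "a = 2 \<and> b = 3 \<and> c' = 2 \<and> d = 3"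
    then show ?thesis by (intro category_isoI[of 4 2 1 3]; simp add: ss)
  next
    assume "a = 2 \<and> b = 3 \<and> c' = 3 \<and> d = 2"
    then show ?thesis by (intro category_isoI[of 6 3 2 1]; simp add: ss)
  next
    assume "a = 2 \<and> b = 3 \<and> c' = 3 \<and> d = 3"
    then show ?thesis by (intro category_isoI[of 1 3 2 1]; simp add: ss)
  next
    assume "a = 3 \<and> b = 1 \<and> c' = 1 \<and> d = 2"
    then show ?thesis by (intro category_isoI[of 0 3 1 2]; simp add: ss)
  next
    assume "a = 3 \<and> b = 2 \<and> c' = 2 \<and> d = 3"
    then show ?thesis by (intro category_isoI[of 6 3 1 2]; simp add: ss)
  next
    assume "a = 3 \<and> b = 3 \<and> c' = 3 \<and> d = 3"
    then show ?thesis by (intro category_isoI[of 3 3 2 1]; simp add: ss)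
  qed
qed

text \<open>
  The right identity of the morphism \<open>3\<close> is \<open>1\<close> or \<open>2\<close>. In the first case \<open>3\<close> is an endomorphism that squares to
  \<open>1\<close> or to itself; in the second it is an arrow between the two objects, which has no square.
\<close>
theorem two_object_category_iso:
  assumes c: "partial_category t {1, 2}" and l: "t 1 3 = Some 3"
  shows "\<exists>p \<in> set A1_categories. \<exists>\<pi>. category_iso \<pi> t {1, 2} (fst p) (snd p)"
proof -
  note uu = unit_unique(3)[OF c]
  have u: "t 1 1 = Some 1" "t 2 2 = Some 2" "t 1 2 = None" "t 2 1 = None"
    using uu[of 1 1] uu[of 2 2] uu[of 1 2] uu[of 2 1] by simp_all
  have "t 2 3 \<noteq> Some 3" using unit_unique(1)[OF c, of 1 2 3] l by auto
  then have t23: "t 2 3 = None" using partial_categoryD(5)[OF c, of 2 3] by auto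
  note as = partial_categoryD(1)[OF c]
  note ss = forall_3 A1_categories_def
  obtain r where "r \<in> {1, 2}" "t 3 r = Some 3" using partial_categoryD(4)[OF c, of 3] by blast
  then consider "t 3 1 = Some 3" | "t 3 2 = Some 3" by auto
  then show ?thesis
  proof cases
    case 1
    have "t 3 2 \<noteq> Some 3" using unit_unique(2)[OF c, of 1 2 3] 1 by auto
    then have t32: "t 3 2 = None" using partial_categoryD(6)[OF c, of 2 3] by auto
    have "t 3 3 \<noteq> None" using partial_categoryD(2)[OF c, of 3 1 3] 1 l by simp
    then obtain x where x: "t 3 3 = Some x" by blast
    have "x \<noteq> 2" using as[of 1 3 3] by (auto simp: l x u)
    then consider "x = 1" | "x = 3" using exhaust_3[of x] by blast
    then show ?thesis
    proof cases
      case 1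
      then have t: "t = mat3 (Some 1) None (Some 3) None (Some 2) None (Some 3) None (Some 1)"
        unfolding tri_eq_iff using \<open>t 3 1 = Some 3\<close> by (simp add: u l t23 t32 x)
      show ?thesis by (intro category_isoI[of 8 2 1 3]; simp add: ss t)
    next
      case 2
      then have t: "t = mat3 (Some 1) None (Some 3) None (Some 2) None (Some 3) None (Some 3)"
        unfolding tri_eq_iff using \<open>t 3 1 = Some 3\<close> by (simp add: u l t23 t32 x)
      show ?thesis by (intro category_isoI[of 7 3 1 2]; simp add: ss t)
    qed
  next
    case 2
    have "t 3 1 \<noteq> Some 3" using unit_unique(2)[OF c, of 1 2 3] 2 by auto
    then have t31: "t 3 1 = None" using partial_categoryD(6)[OF c, of 1 3] by auto
    have "t 3 3 = None" using as[of 3 1 3] by (simp add: l t31)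
    then have t: "t = mat3 (Some 1) None (Some 3) None (Some 2) None None (Some 3) None"
      unfolding tri_eq_iff by (simp add: u l t23 t31 2)
    show ?thesis by (intro category_isoI[of 10 3 2 1]; simp add: ss t)
  qed
qed

theorem discrete_category_iso:
  assumes c: "partial_category t (UNIV :: 3 set)"
  shows "\<exists>p \<in> set A1_categories. \<exists>\<pi>. category_iso \<pi> t UNIV (fst p) (snd p)"
proof -
  have t: "t i j = (if i = j then Some i else None)" for i j using unit_unique(3)[OF c, of i j] by simp
  show ?thesis by (intro category_isoI[of 9 1 2 3]; simp add: forall_3 A1_categories_def t)
qed

lemma third_index: "\<exists>m :: 3. m \<noteq> l \<and> m \<noteq> n"
proof -
  have "\<forall>l n :: 3. \<exists>m. m \<noteq> l \<and> m \<noteq> n"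
    unfolding forall_3
    by (intro conjI; ((rule exI[of _ 1], (simp; fail)) | (rule exI[of _ 2], (simp; fail))
        | (rule exI[of _ 3], simp)))
  then show ?thesis by blast
qed

text \<open>
  Unless all morphisms are identities, label a non-identity by \<open>3\<close> and its left identity by \<open>1\<close>.
\<close>
theorem isomorphic_A1:
  fixes b :: "3 \<Rightarrow> 'v::complex_vector"
  assumes wb: "weak_bialgebra B" and B: "linear_data b \<beta> B idempotent_table D (\<lambda>_. 1) E"
  shows "\<exists>S \<in> set A1_bialgs. bialg_isomorphic B S"
proof -
  have goal: ?thesis if B: "linear_data b \<beta> B idempotent_table (function_comult t) (\<lambda>_. 1) (function_counit I)"
    and ex: "\<exists>p \<in> set A1_categories. \<exists>\<pi>. category_iso \<pi> t I (fst p) (snd p)" for b \<beta> t I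
  proof -
    obtain t' I' \<pi> where p: "(t', I') \<in> set A1_categories" and iso: "category_iso \<pi> t I t' I'"
      using ex by auto
    obtain S where S: "S \<in> set A1_bialgs" and ld: "linear_data idempotent_basis idempotent_coord S
        idempotent_table (function_comult t') (\<lambda>_. 1) (function_counit I')"
      using p by (rule A1_bialg_of_category)
    show ?thesis using isomorphic_if_category_iso[OF B ld iso] S by blast
  qed
  have "structure_equations idempotent_table (\<lambda>_. 1) D E"
    using linear_data.weak_bialgebra_iff[OF B] wb by simp
  then obtain t I where c: "partial_category t I" and D: "D = function_comult t" and E: "E = function_counit I"
    by (rule category_of_structure_equations)
  note B = B[unfolded D E]
  show ?thesis
  proof (cases "I = UNIV")
    case True
    then show ?thesis using goal[OF B] discrete_category_iso c by simp
  next
    case False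
    then obtain n where n: "n \<notin> I" by blast
    obtain l where l: "l \<in> I" "t l n = Some n" using partial_categoryD(3)[OF c, of n] by blast
    obtain m where m: "m \<noteq> l" "m \<noteq> n"
      using third_index by blast
    have bij: "bij (tri l m n)" using n l m by (intro bij_tri) auto
    let ?\<pi> = "tri l m n"
    have B': "linear_data (b \<circ> ?\<pi>) (\<beta> \<circ> ?\<pi>) B idempotent_table
        (\<lambda>k i j. function_comult t (?\<pi> k) (?\<pi> i) (?\<pi> j)) (\<lambda>_. 1) (function_counit I \<circ> ?\<pi>)"
      using linear_data.relabel[OF B bij] by (simp add: idempotent_table_relabel[OF bij] o_def)
    have "structure_equations idempotent_table (\<lambda>_. 1)
        (\<lambda>k i j. function_comult t (?\<pi> k) (?\<pi> i) (?\<pi> j)) (function_counit I \<circ> ?\<pi>)"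
      using linear_data.weak_bialgebra_iff[OF B'] wb by simp
    then obtain t' I' where c': "partial_category t' I'"
      and D': "(\<lambda>k i j. function_comult t (?\<pi> k) (?\<pi> i) (?\<pi> j)) = function_comult t'"
      and E': "function_counit I \<circ> ?\<pi> = function_counit I'"
      by (rule category_of_structure_equations)
    note B' = B'[unfolded D' E']
    have I': "i \<in> I' \<longleftrightarrow> ?\<pi> i \<in> I" for i
      using fun_cong[OF E', of i] by (simp add: function_counit_def of_bool_eq_iff)
    have t13: "t' 1 3 = Some 3"
      using fun_cong[OF fun_cong[OF fun_cong[OF D', of 3], of 1], of 3] l(2)
      by (simp add: function_comult_def)
    show ?thesis
    proof (cases "m \<in> I")
      case True
      have "\<forall>i. i \<in> I' \<longleftrightarrow> i \<in> {1, 2}" unfolding I' forall_3 using n l True by simp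
      then have "I' = {1, 2}" by blast
      then show ?thesis using goal[OF B'] two_object_category_iso[of t'] c' t13 by simp
    next
      case False
      have "\<forall>i. i \<in> I' \<longleftrightarrow> i \<in> {1}" unfolding I' forall_3 using n l False by simp
      then have "I' = {1}" by blast
      then show ?thesis using goal[OF B'] monoid_category_iso[of t'] c' by simp
    qed
  qed
qed

section \<open>Coordinates for the bialgebras over the other two algebras\<close>

text \<open>
  The basis \<open>p - s n\<close>, \<open>q + s n\<close>, \<open>\<mu> n\<close>, where \<open>p = e1 - e2\<close>, \<open>q = e2\<close> and \<open>n = e3\<close>. The parameters produce
  the families of structure constants that represent the same entry of the list.
\<close>
definition shifted_basis :: "complex \<Rightarrow> complex \<Rightarrow> 3 \<Rightarrow> complex ^ 3" where
  "shifted_basis s \<mu> = tri (e1 - e2 - s *\<^sub>C e3) (e2 + s *\<^sub>C e3) (\<mu> *\<^sub>C e3)"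

definition shifted_coord :: "complex \<Rightarrow> complex \<Rightarrow> 3 \<Rightarrow> complex ^ 3 \<Rightarrow> complex" where
  "shifted_coord s \<mu> = tri (\<lambda>v. v $ 1) (\<lambda>v. v $ 1 + v $ 2) (\<lambda>v. (v $ 3 - s * v $ 2) / \<mu>)"

lemma coordinates_shifted_basis:
  assumes l: "\<mu> \<noteq> 0"
  shows "coordinates (shifted_basis s \<mu>) (shifted_coord s \<mu>)"
proof (rule coordinates.intro)
  have "\<forall>i. clinear (shifted_coord s \<mu> i)"
    unfolding forall_3 shifted_coord_def tri_simps
    by (intro conjI clinearI) (simp_all add: scaleC_complex_def add_divide_distrib diff_divide_distrib algebra_simps)
  then show "clinear (shifted_coord s \<mu> i)" for i by blast
  have "\<forall>i j. shifted_coord s \<mu> i (shifted_basis s \<mu> j) = (if i = j then 1 else 0)"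
    using l by (simp add: forall_3 shifted_coord_def shifted_basis_def axis_def)
  then show "shifted_coord s \<mu> i (shifted_basis s \<mu> j) = (if i = j then 1 else 0)" for i j by blast
  show "(\<Sum>i\<in>UNIV. shifted_coord s \<mu> i x *\<^sub>C shifted_basis s \<mu> i) = x" for x
    using l by (simp add: vec_eq_iff forall_3 sum_3 shifted_coord_def shifted_basis_def axis_def field_simps)
qed

lemma linear_data_shifted:
  assumes l: "\<mu> \<noteq> 0"
    and "\<forall>i j. table_mult p q r (shifted_basis s \<mu> i \<otimes> shifted_basis s \<mu> j) =
      (\<Sum>k\<in>UNIV. M i j k *\<^sub>C shifted_basis s \<mu> k)"
    and "\<forall>k i j. std2 i j (lin3 d1 d2 d3 (shifted_basis s \<mu> k)) =
      (\<Sum>l\<in>UNIV. \<Sum>m\<in>UNIV. D k l m * (shifted_basis s \<mu> l $ i * shifted_basis s \<mu> m $ j))"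
    and "\<forall>k. lin3 c1 c2 c3 (shifted_basis s \<mu> k) = E k"
  shows "linear_data (shifted_basis s \<mu>) (shifted_coord s \<mu>) (bialg (table_mult p q r) d1 d2 d3 c1 c2 c3)
    M D (tri 1 1 0) E"
proof (rule linear_data_bialg[OF coordinates_shifted_basis[OF l]])
  show "e1 = (\<Sum>k\<in>UNIV. tri 1 1 0 k *\<^sub>C shifted_basis s \<mu> k)"
    by (simp add: sum_3 shifted_basis_def scaleC_one)
qed (use assms in blast)+

lemma A2_mult_shifted:
  "\<forall>i j. table_mult e3 e3 0 (shifted_basis 0 \<mu> i \<otimes> shifted_basis 0 \<mu> j) =
      (\<Sum>k\<in>UNIV. dual_table i j k *\<^sub>C shifted_basis 0 \<mu> k)"
  by (simp add: forall_3 sum_3 table_mult_tens lin3_def vec_eq_iff shifted_basis_def axis_def dual_table_def)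

lemma A3_mult_shifted:
  "\<forall>i j. table_mult e3 0 0 (shifted_basis s \<mu> i \<otimes> shifted_basis s \<mu> j) =
      (\<Sum>k\<in>UNIV. triangular_table i j k *\<^sub>C shifted_basis s \<mu> k)"
  by (simp add: forall_3 sum_3 table_mult_tens lin3_def vec_eq_iff shifted_basis_def axis_def
      triangular_table_def algebra_simps)

lemmas shifted_simps = forall_3 sum_3 lin3_def std2_simps std2_tens shifted_basis_def axis_def
  scaleC_complex_def

lemma A2_data:
  assumes "\<mu> \<noteq> 0"
  shows "linear_data (shifted_basis 0 \<mu>) (shifted_coord 0 \<mu>) (A2_bialgs ! 0) dual_table (dual_comult 0 1 0) (tri 1 1 0) (tri 1 0 0)"
    and "linear_data (shifted_basis 0 \<mu>) (shifted_coord 0 \<mu>) (A2_bialgs ! 1) dual_table (dual_comult 0 0 (1 / \<mu>)) (tri 1 1 0) (tri 1 0 0)"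
    and "linear_data (shifted_basis 0 \<mu>) (shifted_coord 0 \<mu>) (A2_bialgs ! 2) dual_table (dual_comult 1 0 0) (tri 1 1 0) (tri 1 0 0)"
    and "linear_data (shifted_basis 0 \<mu>) (shifted_coord 0 \<mu>) (A2_bialgs ! 3) dual_table (dual_comult 0 0 0) (tri 1 1 0) (tri 1 0 0)"
proof -
  show "linear_data (shifted_basis 0 \<mu>) (shifted_coord 0 \<mu>) (A2_bialgs ! 0) dual_table (dual_comult 0 1 0) (tri 1 1 0) (tri 1 0 0)"
    unfolding A2_bialgs_def A2_mult_def
    by (simp, rule linear_data_shifted[OF assms A2_mult_shifted])
      (use assms in \<open>simp_all add: shifted_simps dual_comult_def\<close>)
  show "linear_data (shifted_basis 0 \<mu>) (shifted_coord 0 \<mu>) (A2_bialgs ! 1) dual_table (dual_comult 0 0 (1 / \<mu>)) (tri 1 1 0) (tri 1 0 0)"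
    unfolding A2_bialgs_def A2_mult_def
    by (simp, rule linear_data_shifted[OF assms A2_mult_shifted])
      (use assms in \<open>simp_all add: shifted_simps dual_comult_def\<close>)
  show "linear_data (shifted_basis 0 \<mu>) (shifted_coord 0 \<mu>) (A2_bialgs ! 2) dual_table (dual_comult 1 0 0) (tri 1 1 0) (tri 1 0 0)"
    unfolding A2_bialgs_def A2_mult_def
    by (simp, rule linear_data_shifted[OF assms A2_mult_shifted])
      (use assms in \<open>simp_all add: shifted_simps dual_comult_def\<close>)
  show "linear_data (shifted_basis 0 \<mu>) (shifted_coord 0 \<mu>) (A2_bialgs ! 3) dual_table (dual_comult 0 0 0) (tri 1 1 0) (tri 1 0 0)"
    unfolding A2_bialgs_def A2_mult_def
    by (simp, rule linear_data_shifted[OF assms A2_mult_shifted])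
      (use assms in \<open>simp_all add: shifted_simps dual_comult_def\<close>)
qed

lemma A3_data:
  assumes l: "\<mu> \<noteq> 0"
  shows "linear_data (shifted_basis 0 1) (shifted_coord 0 1) (A3_bialgs ! 0) triangular_table grouplike_comult (tri 1 1 0) (tri 1 1 1)"
    and "linear_data (shifted_basis s \<mu>) (shifted_coord s \<mu>) (A3_bialgs ! 1) triangular_table
      (triangular_comult1 (- s\<^sup>2 / \<mu>\<^sup>2) (2 * s / \<mu>)) (tri 1 1 0) (tri 1 0 0)"
    and "linear_data (shifted_basis s \<mu>) (shifted_coord s \<mu>) (A3_bialgs ! 2) triangular_table
      (triangular_comult1 ((1 - s\<^sup>2) / \<mu>\<^sup>2) (2 * s / \<mu>)) (tri 1 1 0) (tri 1 0 0)"
    and "linear_data (shifted_basis s \<mu>) (shifted_coord s \<mu>) (A3_bialgs ! 3) triangular_table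
      (triangular_comult2 (- s\<^sup>2 / \<mu>\<^sup>2) (- 2 * s / \<mu>)) (tri 1 1 0) (tri 0 1 0)"
    and "linear_data (shifted_basis s \<mu>) (shifted_coord s \<mu>) (A3_bialgs ! 4) triangular_table
      (triangular_comult2 ((1 - s\<^sup>2) / \<mu>\<^sup>2) (- 2 * s / \<mu>)) (tri 1 1 0) (tri 0 1 0)"
proof -
  note ss = shifted_simps triangular_comult1_def triangular_comult2_def grouplike_comult_def
    power2_eq_square field_simps
  show "linear_data (shifted_basis 0 1) (shifted_coord 0 1) (A3_bialgs ! 0) triangular_table grouplike_comult (tri 1 1 0) (tri 1 1 1)"
    unfolding A3_bialgs_def A3_mult_def
    by (simp, rule linear_data_shifted[OF _ A3_mult_shifted]) (simp_all add: shifted_simps grouplike_comult_def)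
  show "linear_data (shifted_basis s \<mu>) (shifted_coord s \<mu>) (A3_bialgs ! 1) triangular_table
      (triangular_comult1 (- s\<^sup>2 / \<mu>\<^sup>2) (2 * s / \<mu>)) (tri 1 1 0) (tri 1 0 0)"
    unfolding A3_bialgs_def A3_mult_def
    by (simp, rule linear_data_shifted[OF l A3_mult_shifted]) (use l in \<open>simp_all add: ss\<close>)
  show "linear_data (shifted_basis s \<mu>) (shifted_coord s \<mu>) (A3_bialgs ! 2) triangular_table
      (triangular_comult1 ((1 - s\<^sup>2) / \<mu>\<^sup>2) (2 * s / \<mu>)) (tri 1 1 0) (tri 1 0 0)"
    unfolding A3_bialgs_def A3_mult_def
    by (simp, rule linear_data_shifted[OF l A3_mult_shifted]) (use l in \<open>simp_all add: ss\<close>)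
  show "linear_data (shifted_basis s \<mu>) (shifted_coord s \<mu>) (A3_bialgs ! 3) triangular_table
      (triangular_comult2 (- s\<^sup>2 / \<mu>\<^sup>2) (- 2 * s / \<mu>)) (tri 1 1 0) (tri 0 1 0)"
    unfolding A3_bialgs_def A3_mult_def
    by (simp, rule linear_data_shifted[OF l A3_mult_shifted]) (use l in \<open>simp_all add: ss\<close>)
  show "linear_data (shifted_basis s \<mu>) (shifted_coord s \<mu>) (A3_bialgs ! 4) triangular_table
      (triangular_comult2 ((1 - s\<^sup>2) / \<mu>\<^sup>2) (- 2 * s / \<mu>)) (tri 1 1 0) (tri 0 1 0)"
    unfolding A3_bialgs_def A3_mult_def
    by (simp, rule linear_data_shifted[OF l A3_mult_shifted]) (use l in \<open>simp_all add: ss\<close>)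
qed

lemma dual_structure_equations:
  assumes "x * x = x" "y * y = y" "x * y = 0" "x * z = 0" "y * z = 0"
  shows "structure_equations dual_table (tri 1 1 0) (dual_comult x y z) (tri 1 0 0)"
  unfolding structure_equations_def Let_def
  using assms
  by (auto simp: forall_3 sum_3 tensor_product_coeff_dual dual_table_def dual_comult_def mult.commute)

lemma triangular_structure_equations:
  "structure_equations triangular_table (tri 1 1 0) grouplike_comult (tri 1 1 1)"
  "structure_equations triangular_table (tri 1 1 0) (triangular_comult1 a 0) (tri 1 0 0)"
  "structure_equations triangular_table (tri 1 1 0) (triangular_comult2 a 0) (tri 0 1 0)"
  unfolding structure_equations_def Let_def
  by (simp_all add: forall_3 sum_3 tensor_product_coeff_triangular triangular_table_def
      grouplike_comult_def triangular_comult1_def triangular_comult2_def)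

lemma set_A2_bialgs: "set A2_bialgs = {A2_bialgs ! 0, A2_bialgs ! 1, A2_bialgs ! 2, A2_bialgs ! 3}"
  by (simp add: A2_bialgs_def)

lemma set_A3_bialgs:
  "set A3_bialgs = {A3_bialgs ! 0, A3_bialgs ! 1, A3_bialgs ! 2, A3_bialgs ! 3, A3_bialgs ! 4}"
  by (simp add: A3_bialgs_def)

lemma weak_bialgebra_A2:
  assumes "S \<in> set A2_bialgs"
  shows "weak_bialgebra S"
proof -
  have one: "(1 :: complex) \<noteq> 0" by simp
  have "\<exists>x y z. linear_data (shifted_basis 0 1) (shifted_coord 0 1) S dual_table (dual_comult x y z)
      (tri 1 1 0) (tri 1 0 0) \<and> x * x = x \<and> y * y = y \<and> x * y = 0 \<and> x * z = 0 \<and> y * z = 0"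
    using assms unfolding set_A2_bialgs insert_iff empty_iff
  proof (elim disjE)
    assume "S = A2_bialgs ! 0" with A2_data(1)[OF one] show ?thesis by (intro exI[of _ 0] exI[of _ 1]) simp
  next
    assume "S = A2_bialgs ! 1" with A2_data(2)[OF one] show ?thesis by (intro exI[of _ 0] exI[of _ 1]) simp
  next
    assume "S = A2_bialgs ! 2" with A2_data(3)[OF one] show ?thesis by (intro exI[of _ 0] exI[of _ 1]) simp
  next
    assume "S = A2_bialgs ! 3" with A2_data(4)[OF one] show ?thesis by (intro exI[of _ 0] exI[of _ 1]) simp
  qed blast
  then obtain x y z where ld: "linear_data (shifted_basis 0 1) (shifted_coord 0 1) S dual_table (dual_comult x y z)
      (tri 1 1 0) (tri 1 0 0)" and "x * x = x" "y * y = y" "x * y = 0" "x * z = 0" "y * z = 0" by blast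
  from dual_structure_equations[OF this(2-6)] show ?thesis
    unfolding linear_data.weak_bialgebra_iff[OF ld] .
qed

lemma weak_bialgebra_A3:
  assumes "S \<in> set A3_bialgs"
  shows "weak_bialgebra S"
proof -
  have one: "(1 :: complex) \<noteq> 0" by simp
  note d = A3_data(1)[OF one] A3_data(2-5)[OF one, of 0]
  have z: "(- 0\<^sup>2 / 1\<^sup>2 :: complex) = 0" "(2 * 0 / 1 :: complex) = 0" "(- 2 * 0 / 1 :: complex) = 0"
    "((1 - 0\<^sup>2) / 1\<^sup>2 :: complex) = 1" by simp_all
  note d = d[unfolded z]
  note w = linear_data.weak_bialgebra_iff
  show ?thesis
    using assms unfolding set_A3_bialgs insert_iff empty_iff
    by (elim disjE)
      (simp_all only: w[OF d(1)] w[OF d(2)] w[OF d(3)] w[OF d(4)] w[OF d(5)] triangular_structure_equations)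
qed

theorem isomorphic_A2:
  fixes b :: "3 \<Rightarrow> 'v::complex_vector"
  assumes wb: "weak_bialgebra B" and B: "linear_data b \<beta> B dual_table D (tri 1 1 0) E"
  shows "\<exists>S \<in> set A2_bialgs. bialg_isomorphic B S"
proof -
  have "structure_equations dual_table (tri 1 1 0) D E"
    using linear_data.weak_bialgebra_iff[OF B] wb by simp
  then obtain x y z where E: "E = tri 1 0 0" and D: "D = dual_comult x y z" and
    eqs: "x * x = x" "y * y = y" "x * y = 0" "x * z = 0" "y * z = 0"
    by (rule dual_structure)
  note iso = linear_data.isomorphic_if_same_constants[OF B[unfolded D E]]
  have one: "(1 :: complex) \<noteq> 0" by simp
  have mem: "A2_bialgs ! 0 \<in> set A2_bialgs" "A2_bialgs ! 1 \<in> set A2_bialgs" "A2_bialgs ! 2 \<in> set A2_bialgs"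
    "A2_bialgs ! 3 \<in> set A2_bialgs" unfolding set_A2_bialgs by blast+
  have "x = 0 \<or> x = 1" "y = 0 \<or> y = 1" using eqs(1,2) by simp_all
  then consider "x = 1" "y = 0" "z = 0" | "x = 0" "y = 1" "z = 0" | "x = 0" "y = 0" "z = 0"
    | "x = 0" "y = 0" "z \<noteq> 0" using eqs by fastforce
  then show ?thesis
  proof cases
    case 1 then show ?thesis using iso A2_data(3)[OF one] mem by blast
  next
    case 2 then show ?thesis using iso A2_data(1)[OF one] mem by blast
  next
    case 3 then show ?thesis using iso A2_data(4)[OF one] mem by blast
  next
    case 4
    then have "1 / z \<noteq> 0" by simp
    from A2_data(2)[OF this] have "linear_data (shifted_basis 0 (1 / z)) (shifted_coord 0 (1 / z)) (A2_bialgs ! 1)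
      dual_table (dual_comult x y z) (tri 1 1 0) (tri 1 0 0)" using 4 by simp
    then show ?thesis using iso mem by blast
  qed
qed

text \<open>
  Conjugation by \<open>1 - s n\<close> and rescaling \<open>n\<close> are automorphisms of the triangular algebra, so the multiplication table is the same in the new basis.
\<close>
lemma triangular_change_basis:
  fixes b :: "3 \<Rightarrow> 'v::complex_vector" and s \<mu> :: complex
  assumes B: "linear_data b \<beta> B triangular_table D (tri 1 1 0) E" and l: "\<mu> \<noteq> 0"
  defines "b' \<equiv> tri (b 1 - s *\<^sub>C b 3) (b 2 + s *\<^sub>C b 3) (\<mu> *\<^sub>C b 3)"
  shows "\<exists>\<beta>'. coordinates b' \<beta>'"
    and "\<forall>i j. mult B (b' i \<otimes> b' j) = (\<Sum>k\<in>UNIV. triangular_table i j k *\<^sub>C b' k)"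
    and "unit B 1 = (\<Sum>k\<in>UNIV. tri 1 1 0 k *\<^sub>C b' k)"
    and "counit B (b' 1) = E 1 - s * E 3" and "counit B (b' 3) = \<mu> * E 3"
proof -
  interpret linear_data b \<beta> B triangular_table D "tri 1 1 0" E by (rule B)
  define \<beta>' where "\<beta>' = tri (\<beta> 1) (\<beta> 2) (\<lambda>v. (\<beta> 3 v + s * \<beta> 1 v - s * \<beta> 2 v) / \<mu>)"
  have "coordinates b' \<beta>'"
  proof (rule coordinates.intro)
    have "\<forall>i. clinear (\<beta>' i)"
      unfolding forall_3 \<beta>'_def tri_simps
      by (intro conjI linear_coord clinearI)
        (simp_all add: \<beta>_simps scaleC_complex_def add_divide_distrib diff_divide_distrib algebra_simps)
    then show "clinear (\<beta>' i)" for i by blast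
    have "\<forall>i j. \<beta>' i (b' j) = (if i = j then 1 else 0)"
      using l by (simp add: forall_3 \<beta>'_def b'_def \<beta>_simps coord_basis scaleC_complex_def)
    then show "\<beta>' i (b' j) = (if i = j then 1 else 0)" for i j by blast
    show "(\<Sum>i\<in>UNIV. \<beta>' i x *\<^sub>C b' i) = x" for x
    proof -
      have "(\<Sum>i\<in>UNIV. \<beta>' i x *\<^sub>C b' i) = (\<Sum>i\<in>UNIV. \<beta> i x *\<^sub>C b i)"
        using l by (simp add: sum_3 \<beta>'_def b'_def scaleC_scaleC cvec.scale_right_diff_distrib
            cvec.scale_left_diff_distrib scaleC_add_right scaleC_add_left mult.commute)
      then show ?thesis by (simp only: expand)
    qed
  qed
  then show "\<exists>\<beta>'. coordinates b' \<beta>'" by blast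
  have minus: "x \<otimes> (y - z) = x \<otimes> y - x \<otimes> z" "(y - z) \<otimes> x = y \<otimes> x - z \<otimes> x" for x y z :: 'v
    using tens_simps(3)[of x "y - z" z] tens_simps(1)[of "y - z" z x] by (simp_all add: algebra_simps)
  note bas = mult_basis[unfolded sum_3]
  show "\<forall>i j. mult B (b' i \<otimes> b' j) = (\<Sum>k\<in>UNIV. triangular_table i j k *\<^sub>C b' k)"
    by (simp add: forall_3 sum_3 b'_def tens_simps minus lin_simps clinearD(5)[OF lin_mult] bas
        triangular_table_def scaleC_scaleC scaleC_one scaleC_add_right cvec.scale_right_diff_distrib)
  show "unit B 1 = (\<Sum>k\<in>UNIV. tri 1 1 0 k *\<^sub>C b' k)"
    unfolding unit_basis by (simp add: sum_3 b'_def scaleC_one)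
  show "counit B (b' 1) = E 1 - s * E 3" "counit B (b' 3) = \<mu> * E 3"
    by (simp_all add: b'_def lin_simps clinearD(5)[OF lin_counit] counit_basis scaleC_complex_def)
qed

text \<open>
  In the bialgebra cases, the functional dual to \<open>n\<close> satisfies a quadratic equation with coefficients \<open>a\<close> and \<open>c\<close> in
  the dual algebra. Completing the square and rescaling leaves the cases of a zero and of a nonzero
  discriminant \<open>a + c\<^sup>2 / 4\<close>.
\<close>
theorem isomorphic_A3:
  fixes b :: "3 \<Rightarrow> 'v::complex_vector"
  assumes wb: "weak_bialgebra B" and B: "linear_data b \<beta> B triangular_table D (tri 1 1 0) E"
  shows "\<exists>S \<in> set A3_bialgs. bialg_isomorphic B S"
proof -
  have mem: "A3_bialgs ! 0 \<in> set A3_bialgs" "A3_bialgs ! 1 \<in> set A3_bialgs" "A3_bialgs ! 2 \<in> set A3_bialgs"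
    "A3_bialgs ! 3 \<in> set A3_bialgs" "A3_bialgs ! 4 \<in> set A3_bialgs" unfolding set_A3_bialgs by blast+
  have se: "structure_equations triangular_table (tri 1 1 0) D E"
    using linear_data.weak_bialgebra_iff[OF B] wb by simp
  show ?thesis
  proof (cases "E 3 = 0")
    case False
    define s \<mu> where "s = (E 1 - 1) / E 3" and "\<mu> = 1 / E 3"
    have "\<mu> \<noteq> 0" using False by (simp add: \<mu>_def)
    note ch = triangular_change_basis[OF B this, of s]
    obtain \<beta>' where \<beta>': "coordinates (tri (b 1 - s *\<^sub>C b 3) (b 2 + s *\<^sub>C b 3) (\<mu> *\<^sub>C b 3)) \<beta>'"
      using ch(1) by blast
    obtain D' E' where ld: "linear_data (tri (b 1 - s *\<^sub>C b 3) (b 2 + s *\<^sub>C b 3) (\<mu> *\<^sub>C b 3)) \<beta>' B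
        triangular_table D' (tri 1 1 0) E'" and se': "structure_equations triangular_table (tri 1 1 0) D' E'"
      using weak_bialgebra.structure_constants[OF wb \<beta>' ch(2)[rule_format] ch(3)] by blast
    have "E' 1 = 1" "E' 3 = 1"
      using linear_data.counit_basis[OF ld, of 1] linear_data.counit_basis[OF ld, of 3] ch(4,5) False
      by (simp_all add: s_def \<mu>_def)
    from triangular_structure_category[OF se' this(2,1)] ld
    have "linear_data (tri (b 1 - s *\<^sub>C b 3) (b 2 + s *\<^sub>C b 3) (\<mu> *\<^sub>C b 3)) \<beta>' B
        triangular_table grouplike_comult (tri 1 1 0) (tri 1 1 1)" by simp
    from linear_data.isomorphic_if_same_constants[OF this A3_data(1)[OF one_neq_zero]] mem
    show ?thesis by blast
  next
    case E3: True
    have choice: "\<exists>s \<mu>. \<mu> \<noteq> 0 \<and> c = 2 * s / \<mu> \<and> (a = - s\<^sup>2 / \<mu>\<^sup>2 \<or> a = (1 - s\<^sup>2) / \<mu>\<^sup>2)" for a c :: complex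
    proof (cases "a + c\<^sup>2 / 4 = 0")
      case True
      then have "a = - (c / 2)\<^sup>2" by (simp add: power_divide eq_neg_iff_add_eq_0)
      then show ?thesis by (intro exI[of _ "c / 2"] exI[of _ 1]) simp
    next
      case False
      define r where "r = csqrt (a + c\<^sup>2 / 4)"
      have r: "r \<noteq> 0" "r\<^sup>2 = a + c\<^sup>2 / 4" using False by (simp_all add: r_def)
      have "(1 - (c / (2 * r))\<^sup>2) / (1 / r)\<^sup>2 = r\<^sup>2 - c\<^sup>2 / 4"
        using r(1) by (simp add: power_divide power_mult_distrib field_simps)
      then have "a = (1 - (c / (2 * r))\<^sup>2) / (1 / r)\<^sup>2" by (simp add: r(2))
      then show ?thesis using r(1) by (intro exI[of _ "c / (2 * r)"] exI[of _ "1 / r"]) simp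
    qed
    from triangular_structure_bialgebra[OF se E3] show ?thesis
    proof (elim disjE conjE exE)
      fix a c assume E: "E = tri 1 0 0" and D: "D = triangular_comult1 a c"
      obtain s \<mu> where l: "\<mu> \<noteq> 0" and c: "c = 2 * s / \<mu>" and a: "a = - s\<^sup>2 / \<mu>\<^sup>2 \<or> a = (1 - s\<^sup>2) / \<mu>\<^sup>2"
        using choice[of c a] by blast
      note iso = linear_data.isomorphic_if_same_constants[OF B[unfolded E D]]
      from a show ?thesis
      proof
        assume a: "a = - s\<^sup>2 / \<mu>\<^sup>2"
        from iso[OF A3_data(2)[OF l, of s, folded a c]] mem show ?thesis by blast
      next
        assume a: "a = (1 - s\<^sup>2) / \<mu>\<^sup>2"
        from iso[OF A3_data(3)[OF l, of s, folded a c]] mem show ?thesis by blast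
      qed
    next
      fix a c assume E: "E = tri 0 1 0" and D: "D = triangular_comult2 a c"
      obtain s \<mu> where l: "\<mu> \<noteq> 0" and c: "c = 2 * s / \<mu>" and a: "a = - s\<^sup>2 / \<mu>\<^sup>2 \<or> a = (1 - s\<^sup>2) / \<mu>\<^sup>2"
        using choice[of c a] by blast
      have c': "c = - 2 * (- s) / \<mu>" using c by simp
      note iso = linear_data.isomorphic_if_same_constants[OF B[unfolded E D]]
      from a show ?thesis
      proof
        assume "a = - s\<^sup>2 / \<mu>\<^sup>2"
        then have a: "a = - (- s)\<^sup>2 / \<mu>\<^sup>2" by simp
        from iso[OF A3_data(4)[OF l, of "- s", folded a c']] mem show ?thesis by blast
      next
        assume "a = (1 - s\<^sup>2) / \<mu>\<^sup>2"
        then have a: "a = (1 - (- s)\<^sup>2) / \<mu>\<^sup>2" by simp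
        from iso[OF A3_data(5)[OF l, of "- s", folded a c']] mem show ?thesis by blast
      qed
    qed
  qed
qed

section \<open>The classification\<close>
lemma (in weak_bialgebra) algebra3_mult:
  assumes "cvec.dim (UNIV :: 'v set) = 3"
  shows "algebra3 (\<lambda>x y. mult B (x \<otimes> y)) (unit B 1)"
proof
  show "cbilinear (\<lambda>x y. mult B (x \<otimes> y))"
    by (rule cbilinearI) (simp_all only: tens_simps clinearD(1,2)[OF linear_mult])
qed (fact mult_assoc unit_left unit_right assms)+

theorem proposition4p5:
  fixes B :: "'v::complex_vector bialg_data"
  shows "(\<forall>S \<in> set (A1_bialgs @ A2_bialgs @ A3_bialgs). weak_bialgebra S) \<and>
    (weak_bialgebra B \<and> cvec.dim (UNIV :: 'v set) = 3 \<longrightarrow>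
      (\<exists>S \<in> set (A1_bialgs @ A2_bialgs @ A3_bialgs). bialg_isomorphic B S))"
proof (intro conjI impI)
  show "\<forall>S \<in> set (A1_bialgs @ A2_bialgs @ A3_bialgs). weak_bialgebra S"
    using weak_bialgebra_A1 weak_bialgebra_A2 weak_bialgebra_A3 by auto
  assume "weak_bialgebra B \<and> cvec.dim (UNIV :: 'v set) = 3"
  then have wb: "weak_bialgebra B" and dim: "cvec.dim (UNIV :: 'v set) = 3" by auto
  interpret weak_bialgebra B by (rule wb)
  interpret algebra3 "\<lambda>x y. mult B (x \<otimes> y)" "unit B 1" by (rule algebra3_mult[OF dim])
  have constants: "\<exists>b \<beta> D E. linear_data b \<beta> B M D U E \<and> structure_equations M U D E" if "has_table M U" for M U
  proof -
    from that obtain b \<beta> where "coordinates b \<beta>"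
      and "\<And>i j. mult B (b i \<otimes> b j) = (\<Sum>k\<in>UNIV. M i j k *\<^sub>C b k)"
      and "unit B 1 = (\<Sum>k\<in>UNIV. U k *\<^sub>C b k)"
      unfolding has_table_def by blast
    then show ?thesis by (rule structure_constants) blast
  qed
  have in_all: "\<exists>S \<in> set (A1_bialgs @ A2_bialgs @ A3_bialgs). bialg_isomorphic B S"
    if "\<exists>S \<in> set L. bialg_isomorphic B S" "L = A1_bialgs \<or> L = A2_bialgs \<or> L = A3_bialgs" for L
    using that by auto
  from has_table_cases show "\<exists>S \<in> set (A1_bialgs @ A2_bialgs @ A3_bialgs). bialg_isomorphic B S"
  proof (elim disjE bexE)
    assume "has_table idempotent_table (\<lambda>_. 1)"
    then obtain b :: "3 \<Rightarrow> 'v" and \<beta> D E where "linear_data b \<beta> B idempotent_table D (\<lambda>_. 1) E" using constants by blast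
    then show ?thesis using isomorphic_A1[OF wb] in_all[of A1_bialgs] by blast
  next
    assume "has_table dual_table (tri 1 1 0)"
    then obtain b \<beta> D E where "linear_data b \<beta> B dual_table D (tri 1 1 0) E" using constants by blast
    then show ?thesis using isomorphic_A2[OF wb] in_all[of A2_bialgs] by blast
  next
    assume "has_table triangular_table (tri 1 1 0)"
    then obtain b \<beta> D E where "linear_data b \<beta> B triangular_table D (tri 1 1 0) E" using constants by blast
    then show ?thesis using isomorphic_A3[OF wb] in_all[of A3_bialgs] by blast
  next
    fix \<kappa> :: complex assume k: "\<kappa> \<in> {0, 1}" and "has_table (local_table \<kappa>) (tri 1 0 0)"
    then obtain D E where "structure_equations (local_table \<kappa>) (tri 1 0 0) D E" using constants by blast
    then show ?thesis using no_local_structure k by blast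
  qed
qed

end
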